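(* Let $G$ be a Lie group, $\mathfrak{g}$ its Lie algebra and $X\in\mathfrak{g}$ an element generating a precompact one-parameter group in $G$. Then $\mathrm{ad}_X$ is either trivial or not nilpotent. Furthermore, there is no $0\ne Y\in\mathfrak{g}$ such that $[X,Y]=\lambda Y$ for some non-zero $\lambda\in\mathbb{R}$, and there is no $Y\in\mathfrak g$ such that $[X,Y]\ne0$ and $\mathrm{ad}_X^k(Y)=0$ for some integer $k>0$. If additionally $\mathfrak{g}=\mathfrak{l}\oplus\mathfrak{m}$ is a direct sum of algebras with $\mathfrak{l}$ semisimple and $X\in\mathfrak{l}$, then $\mathrm{ad}_X$ is semisimple (that is, diagonalizable over the complex numbers) and its eigenvalues are all purely imaginary.
   Context: Lie groups and Lie algebras are real and finite-dimensional. $X$ generates a precompact one-parameter group if $\{\exp(tX)\}_{t\in\mathbb{R}}$ has compact closure in $G$. Zero counts as purely imaginary. *)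

theory Defs
  imports "HOL-Analysis.Analysis" "HOL-Library.Function_Algebras"
begin

section \<open>Pointwise real vector space structure on functions\<close>

instantiation "fun" :: (type, scaleR) scaleR
begin

definition scaleR_fun :: "real \<Rightarrow> ('a \<Rightarrow> 'b) \<Rightarrow> 'a \<Rightarrow> 'b"
  where "scaleR_fun r f = (\<lambda>x. r *\<^sub>R f x)"

instance ..

end

instance "fun" :: (type, real_vector) real_vector
  by standard (simp_all add: scaleR_fun_def plus_fun_def fun_eq_iff algebra_simps)


section \<open>Smooth maps between manifolds\<close>

text \<open>The definition is meant for open \<open>S\<close> and a finite-dimensional domain; there, being
  \<open>C\<close>-\<open>(k+1)\<close> amounts to being differentiable with all directional derivatives \<open>C\<close>-\<open>k\<close>.\<close>

primrec Ck_on :: "nat \<Rightarrow> ('a::real_normed_vector \<Rightarrow> 'b::real_normed_vector) \<Rightarrow> 'a set \<Rightarrow> bool"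
  where
    "Ck_on 0 f S \<longleftrightarrow> continuous_on S f"
  | "Ck_on (Suc k) f S \<longleftrightarrow>
      (\<forall>x\<in>S. f differentiable (at x)) \<and> (\<forall>v. Ck_on k (\<lambda>x. frechet_derivative f (at x) v) S)"

definition smooth_on :: "('a::real_normed_vector \<Rightarrow> 'b::real_normed_vector) \<Rightarrow> 'a set \<Rightarrow> bool"
  where "smooth_on f S \<longleftrightarrow> (\<forall>k. Ck_on k f S)"

text \<open>A chart is a pair of a coordinate domain and a coordinate map, whose values off the domain
  are irrelevant. The model space is any finite-dimensional normed space rather than a
  \<^class>\<open>euclidean_space\<close>, because the latter has positive dimension; here the dimension
  may be zero. (In finite dimension the class \<^class>\<open>banach\<close> is no restriction.)\<close>

type_synonym ('m, 'e) atlas = "('m set \<times> ('m \<Rightarrow> 'e)) set"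

definition smooth_atlas ::
    "('m::{t2_space,second_countable_topology}, 'e::banach) atlas \<Rightarrow> bool"
  where "smooth_atlas A \<longleftrightarrow>
    (\<exists>B::'e set. finite B \<and> span B = UNIV) \<and>
    \<Union> (fst ` A) = UNIV \<and>
    (\<forall>(U, \<phi>)\<in>A. open U \<and> open (\<phi> ` U) \<and> homeomorphism U (\<phi> ` U) \<phi> (inv_into U \<phi>)) \<and>
    (\<forall>(U, \<phi>)\<in>A. \<forall>(V, \<psi>)\<in>A. smooth_on (\<psi> \<circ> inv_into U \<phi>) (\<phi> ` (U \<inter> V)))"

definition smooth_map ::
    "('m::topological_space, 'e::real_normed_vector) atlas \<Rightarrow>
     ('n::topological_space, 'f::real_normed_vector) atlas \<Rightarrow> ('m \<Rightarrow> 'n) \<Rightarrow> bool"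
  where "smooth_map A B F \<longleftrightarrow>
    continuous_on UNIV F \<and>
    (\<forall>(U, \<phi>)\<in>A. \<forall>(V, \<psi>)\<in>B. smooth_on (\<psi> \<circ> F \<circ> inv_into U \<phi>) (\<phi> ` (U \<inter> F -` V)))"

definition prod_atlas :: "('m, 'e) atlas \<Rightarrow> ('n, 'f) atlas \<Rightarrow> ('m \<times> 'n, 'e \<times> 'f) atlas"
  where "prod_atlas A B = {(U \<times> V, map_prod \<phi> \<psi>) | U \<phi> V \<psi>. (U, \<phi>) \<in> A \<and> (V, \<psi>) \<in> B}"

definition real_line :: "(real, real) atlas"
  where "real_line = {(UNIV, id)}"

abbreviation smooth_fun ::
    "('m::topological_space, 'e::real_normed_vector) atlas \<Rightarrow> ('m \<Rightarrow> real) \<Rightarrow> bool"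
  where "smooth_fun A f \<equiv> smooth_map A real_line f"

abbreviation smooth_curve ::
    "('m::topological_space, 'e::real_normed_vector) atlas \<Rightarrow> (real \<Rightarrow> 'm) \<Rightarrow> bool"
  where "smooth_curve A c \<equiv> smooth_map real_line A c"


section \<open>Tangent vectors and vector fields\<close>

text \<open>A tangent vector at \<open>p\<close> is the velocity at time 0 of a smooth curve through \<open>p\<close>,
  recorded as the directional derivative it defines on the smooth functions. The value 0 is
  used on non-smooth functions, so that equality of tangent vectors is equality on the
  smooth functions.\<close>

type_synonym 'm tangent = "('m \<Rightarrow> real) \<Rightarrow> real"

definition velocity ::
    "('m::topological_space, 'e::real_normed_vector) atlas \<Rightarrow> (real \<Rightarrow> 'm) \<Rightarrow> 'm tangent"
  where "velocity A c = (\<lambda>f. if smooth_fun A f then deriv (f \<circ> c) 0 else 0)"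

definition tangent_space ::
    "('m::topological_space, 'e::real_normed_vector) atlas \<Rightarrow> 'm \<Rightarrow> 'm tangent set"
  where "tangent_space A p = {velocity A c | c. smooth_curve A c \<and> c 0 = p}"

definition push_forward ::
    "('m::topological_space, 'e::real_normed_vector) atlas \<Rightarrow> ('m \<Rightarrow> 'm) \<Rightarrow> 'm tangent \<Rightarrow> 'm tangent"
  where "push_forward A F v = (\<lambda>f. if smooth_fun A f then v (f \<circ> F) else 0)"

type_synonym 'm vector_field = "'m \<Rightarrow> 'm tangent"

definition smooth_vector_field ::
    "('m::topological_space, 'e::real_normed_vector) atlas \<Rightarrow> 'm vector_field \<Rightarrow> bool"
  where "smooth_vector_field A X \<longleftrightarrow>
    (\<forall>p. X p \<in> tangent_space A p) \<and> (\<forall>f. smooth_fun A f \<longrightarrow> smooth_fun A (\<lambda>p. X p f))"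

definition lie_bracket :: "'m vector_field \<Rightarrow> 'm vector_field \<Rightarrow> 'm vector_field"
  where "lie_bracket X Y = (\<lambda>p f. X p (\<lambda>q. Y q f) - Y p (\<lambda>q. X q f))"


section \<open>Lie groups, their Lie algebras and exponential maps\<close>

definition lie_group ::
    "('g::{t2_space,second_countable_topology}, 'e::banach) atlas \<Rightarrow>
     ('g \<Rightarrow> 'g \<Rightarrow> 'g) \<Rightarrow> 'g \<Rightarrow> ('g \<Rightarrow> 'g) \<Rightarrow> bool"
  where "lie_group A mul e invs \<longleftrightarrow>
    smooth_atlas A \<and> group mul e invs \<and>
    smooth_map (prod_atlas A A) A (\<lambda>(x, y). mul x y) \<and> smooth_map A A invs"

definition lie_algebra ::
    "('g::topological_space, 'e::real_normed_vector) atlas \<Rightarrow> ('g \<Rightarrow> 'g \<Rightarrow> 'g) \<Rightarrow>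
     'g vector_field set"
  where "lie_algebra A mul =
    {X. smooth_vector_field A X \<and> (\<forall>h p. X (mul h p) = push_forward A (mul h) (X p))}"

definition one_parameter_group ::
    "('g::topological_space, 'e::real_normed_vector) atlas \<Rightarrow> ('g \<Rightarrow> 'g \<Rightarrow> 'g) \<Rightarrow> (real \<Rightarrow> 'g) \<Rightarrow> bool"
  where "one_parameter_group A mul \<gamma> \<longleftrightarrow>
    smooth_curve A \<gamma> \<and> (\<forall>s t. \<gamma> (s + t) = mul (\<gamma> s) (\<gamma> t))"

text \<open>For \<open>X\<close> in the Lie algebra the one-parameter group with initial velocity \<open>X e\<close>
  exists and is unique, so the choice operator makes no actual choice.\<close>

definition lie_exp ::
    "('g::topological_space, 'e::real_normed_vector) atlas \<Rightarrow> ('g \<Rightarrow> 'g \<Rightarrow> 'g) \<Rightarrow> 'g \<Rightarrow>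
     'g vector_field \<Rightarrow> 'g"
  where "lie_exp A mul e X =
    (SOME \<gamma>. one_parameter_group A mul \<gamma> \<and> velocity A \<gamma> = X e) 1"

definition generates_precompact ::
    "('g::topological_space, 'e::real_normed_vector) atlas \<Rightarrow> ('g \<Rightarrow> 'g \<Rightarrow> 'g) \<Rightarrow> 'g \<Rightarrow>
     'g vector_field \<Rightarrow> bool"
  where "generates_precompact A mul e X \<longleftrightarrow>
    compact (closure (range (\<lambda>t::real. lie_exp A mul e (t *\<^sub>R X))))"


section \<open>Lie algebra notions relative to a bracket\<close>

definition lie_subalgebra :: "('v::real_vector \<Rightarrow> 'v \<Rightarrow> 'v) \<Rightarrow> 'v set \<Rightarrow> 'v set \<Rightarrow> bool"
  where "lie_subalgebra br H L \<longleftrightarrow>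
    subspace H \<and> H \<subseteq> L \<and> (\<forall>x\<in>H. \<forall>y\<in>H. br x y \<in> H)"

definition lie_ideal :: "('v::real_vector \<Rightarrow> 'v \<Rightarrow> 'v) \<Rightarrow> 'v set \<Rightarrow> 'v set \<Rightarrow> bool"
  where "lie_ideal br I L \<longleftrightarrow>
    subspace I \<and> I \<subseteq> L \<and> (\<forall>x\<in>L. \<forall>y\<in>I. br x y \<in> I)"

definition derived_algebra :: "('v::real_vector \<Rightarrow> 'v \<Rightarrow> 'v) \<Rightarrow> 'v set \<Rightarrow> 'v set"
  where "derived_algebra br L = span {br x y | x y. x \<in> L \<and> y \<in> L}"

definition solvable_lie :: "('v::real_vector \<Rightarrow> 'v \<Rightarrow> 'v) \<Rightarrow> 'v set \<Rightarrow> bool"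
  where "solvable_lie br L \<longleftrightarrow> (\<exists>k. (derived_algebra br ^^ k) L = {0})"

text \<open>Semisimple means that the radical is zero, that is, zero is the only solvable ideal.\<close>

definition semisimple_lie :: "('v::real_vector \<Rightarrow> 'v \<Rightarrow> 'v) \<Rightarrow> 'v set \<Rightarrow> bool"
  where "semisimple_lie br L \<longleftrightarrow> (\<forall>I. lie_ideal br I L \<and> solvable_lie br I \<longrightarrow> I = {0})"

definition lie_direct_sum ::
    "('v::real_vector \<Rightarrow> 'v \<Rightarrow> 'v) \<Rightarrow> 'v set \<Rightarrow> 'v set \<Rightarrow> 'v set \<Rightarrow> bool"
  where "lie_direct_sum br L L1 L2 \<longleftrightarrow>
    lie_subalgebra br L1 L \<and> lie_subalgebra br L2 L \<and>
    L1 \<inter> L2 = {0} \<and> L = {x + y | x y. x \<in> L1 \<and> y \<in> L2} \<and>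
    (\<forall>x\<in>L1. \<forall>y\<in>L2. br x y = 0 \<and> br y x = 0)"


section \<open>Nilpotent and semisimple operators on a subspace\<close>

definition nilpotent_on :: "'v::real_vector set \<Rightarrow> ('v \<Rightarrow> 'v) \<Rightarrow> bool"
  where "nilpotent_on V T \<longleftrightarrow> (\<exists>k. \<forall>v\<in>V. (T ^^ k) v = 0)"

text \<open>The complexification of \<open>V\<close> is \<open>V \<times> V\<close>, the pair \<open>(u, v)\<close> standing for \<open>u + \<i> v\<close>;
  an operator \<open>T\<close> on \<open>V\<close> extends to it as \<^term>\<open>map_prod T T\<close>.\<close>

definition cscale :: "complex \<Rightarrow> 'v::real_vector \<times> 'v \<Rightarrow> 'v \<times> 'v"
  where "cscale c w =
    (Re c *\<^sub>R fst w - Im c *\<^sub>R snd w, Im c *\<^sub>R fst w + Re c *\<^sub>R snd w)"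

global_interpretation cplx: vector_space "cscale :: complex \<Rightarrow> 'v::real_vector \<times> 'v \<Rightarrow> 'v \<times> 'v"
  by standard (simp_all add: cscale_def prod_eq_iff algebra_simps)

definition complex_eigenvalue :: "'v::real_vector set \<Rightarrow> ('v \<Rightarrow> 'v) \<Rightarrow> complex \<Rightarrow> bool"
  where "complex_eigenvalue V T c \<longleftrightarrow> (\<exists>w \<in> V \<times> V. w \<noteq> 0 \<and> map_prod T T w = cscale c w)"

definition complex_diagonalizable :: "'v::real_vector set \<Rightarrow> ('v \<Rightarrow> 'v) \<Rightarrow> bool"
  where "complex_diagonalizable V T \<longleftrightarrow>
    (\<exists>B. B \<subseteq> V \<times> V \<and> cplx.independent B \<and> cplx.span B = V \<times> V \<and>
         (\<forall>w\<in>B. \<exists>c. map_prod T T w = cscale c w))"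

end

theory Submission
  imports Defs "HOL-Computational_Algebra.Fundamental_Theorem_Algebra"
begin

text \<open>
  The idea is that conjugation by \<open>exp (tX)\<close> acts on the Lie algebra \<open>\<gg>\<close> as \<open>e\<close> to the power \<open>t
  ad\<^sub>X\<close>, and that this family of operators stays bounded because \<open>exp (tX)\<close> stays in a compact set.
  A one-parameter group of operators can be bounded only if its generator has purely imaginary
  eigenvalues and no Jordan chains: a chain \<open>ad\<^sub>X w = c w + z\<close>, \<open>ad\<^sub>X z = c z\<close> in the
  complexification with \<open>w \<noteq> 0\<close> evolves as \<open>exp (tc) (w + t z)\<close>, which is unbounded in \<open>t\<close> unless
  \<open>Re c = 0\<close> and \<open>z = 0\<close>. Everything claimed is a form of this. A non-zero real eigenvalue of \<open>ad\<^sub>X\<close>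
  is an eigenvalue that is not imaginary; a vector killed by a power of \<open>ad\<^sub>X\<close> but not by \<open>ad\<^sub>X\<close>
  yields a Jordan chain for \<open>c = 0\<close>; and an operator without Jordan chains on a finite-dimensional
  complex space is diagonalizable.

  The action by conjugation is observed through one smooth function \<open>f\<close> at a time. For \<open>Y \<in> \<gg>\<close> and
  \<open>g\<close> in the group, let \<open>C Y g\<close> be the derivative at \<open>e\<close> in the direction \<open>Y\<close> of the function \<open>p \<mapsto> f
  (g p g\<inverse>)\<close>. It is continuous in \<open>g\<close> (\<open>conjugation_continuous\<close>), hence bounded on the compact
  closure. Along a one-parameter group \<open>\<gamma>\<close> generated by \<open>X\<close> the derivative of \<open>C Y (\<gamma> s)\<close> is \<open>C [X,
  Y] (\<gamma> s)\<close> (\<open>conjugation_derivative\<close>); this is the symmetry of second derivatives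
  (\<open>second_derivative_symmetric\<close>). For a Jordan chain this differential equation can be solved
  explicitly (\<open>jordan_chain_flow\<close>), and a non-zero vector of \<open>\<gg>\<close> is detected by some \<open>f\<close>.

  The exponential map is defined by choosing, for each \<open>t\<close>, some one-parameter group with initial
  velocity \<open>tX\<close>, so one has to know that such a group exists (\<open>one_parameter_group_exists\<close>); it is
  constructed from the flow of \<open>X\<close> in a chart with the Banach fixed point theorem. For each \<open>t\<close> the
  differential equation above determines \<open>C Y (\<gamma> 1)\<close>, whichever group \<open>\<gamma>\<close> was chosen. Finally,
  diagonalizability of \<open>ad\<^sub>X\<close> on \<open>\<gg>\<close> requires that \<open>\<gg>\<close>, as a space of operators on smooth functions,
  is a finite-dimensional subspace closed under the bracket; this follows from the description of
  the tangent space at a point as the image of the model space under a linear map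
  (\<open>tangent_space_chart\<close>).
\<close>

section \<open>Coordinates on finite-dimensional normed spaces\<close>

text \<open>The model space of an atlas and its product with a line need not be Euclidean spaces, and
  their dimension may be zero, so finite dimension is expressed by a finite spanning set.\<close>

definition finite_dimensional :: "'a::real_vector itself \<Rightarrow> bool"
  where "finite_dimensional _ \<longleftrightarrow> (\<exists>B::'a set. finite B \<and> span B = UNIV)"

lemma finite_dimensional_real: "finite_dimensional TYPE(real)"
proof -
  have "x \<in> span {1::real}" for x
    by (metis mult.right_neutral real_scaleR_def span_base singletonI span_scale)
  then show ?thesis
    unfolding finite_dimensional_def by (intro exI[of _ "{1}"]) auto
qed

lemma finite_dimensional_prod:
  assumes "finite_dimensional TYPE('a::real_vector)" "finite_dimensional TYPE('b::real_vector)"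
  shows "finite_dimensional TYPE('a \<times> 'b)"
proof -
  obtain B :: "'a set" and C :: "'b set"
    where B: "finite B" "span B = UNIV" and C: "finite C" "span C = UNIV"
    using assms unfolding finite_dimensional_def by auto
  let ?i = "\<lambda>x::'a. (x, 0::'b)" and ?j = "\<lambda>y::'b. (0::'a, y)"
  let ?D = "?i ` B \<union> ?j ` C"
  have "linear ?i" "linear ?j"
    by (auto intro!: linearI)
  then have i: "range ?i = span (?i ` B)" and j: "range ?j = span (?j ` C)"
    by (simp_all add: B C linear_span_image)
  have "z \<in> span ?D" for z :: "'a \<times> 'b"
  proof -
    have "?i (fst z) \<in> span ?D"
      using i span_mono[of "?i ` B" ?D] by blast
    moreover have "?j (snd z) \<in> span ?D"
      using j span_mono[of "?j ` C" ?D] by blast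
    ultimately have "?i (fst z) + ?j (snd z) \<in> span ?D"
      by (rule span_add)
    then show ?thesis by simp
  qed
  then show ?thesis
    unfolding finite_dimensional_def using B C by (intro exI[of _ ?D]) auto
qed

text \<open>In finite dimension the norm dominates the sum of the absolute values of the coordinates, since
  the norm is continuous and positive on the compact set of coordinate vectors with absolute sum 1.\<close>

lemma representation_bounded:
  fixes B :: "'a::real_normed_vector set"
  assumes B: "finite B" "independent B"
  obtains c where "c > 0" "\<And>u. c * (\<Sum>b\<in>B. \<bar>u b\<bar>) \<le> norm (\<Sum>b\<in>B. u b *\<^sub>R b)"
proof -
  \<comment> \<open>Coordinate vectors are functions on the whole space that vanish off \<open>B\<close>, so that compactness
    of the cube \<open>P\<close> is the theorem of Tychonoff.\<close>
  define P :: "('a \<Rightarrow> real) set" where "P = (\<Pi>\<^sub>E b\<in>UNIV. if b \<in> B then {-1..1} else {0})"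
  define K where "K = P \<inter> {u. (\<Sum>b\<in>B. \<bar>u b\<bar>) = 1}"
  have "compact P"
    unfolding P_def compactin_euclidean_iff[symmetric] euclidean_product_topology[symmetric] compactin_PiE
    by simp
  moreover have "closed {u::'a \<Rightarrow> real. (\<Sum>b\<in>B. \<bar>u b\<bar>) = 1}"
    by (intro closed_Collect_eq continuous_intros)
       (auto intro: continuous_on_product_coordinates)
  ultimately have K: "compact K"
    unfolding K_def by (rule compact_Int_closed)
  have cont: "continuous_on K (\<lambda>u. norm (\<Sum>b\<in>B. u b *\<^sub>R b))"
    by (intro continuous_intros continuous_on_subset[OF continuous_on_product_coordinates]) auto
  have normalize: "\<exists>w\<in>K. \<forall>b\<in>B. u b = (\<Sum>b\<in>B. \<bar>u b\<bar>) * w b"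
    if "(\<Sum>b\<in>B. \<bar>u b\<bar>) \<noteq> 0" for u :: "'a \<Rightarrow> real"
  proof -
    let ?s = "\<Sum>b\<in>B. \<bar>u b\<bar>"
    have s: "?s > 0" using that by (simp add: order_less_le sum_nonneg)
    define w where "w b = (if b \<in> B then u b / ?s else 0)" for b
    have sum1: "(\<Sum>b\<in>B. \<bar>w b\<bar>) = 1"
      using s by (simp add: w_def sum_divide_distrib[symmetric])
    have "w b \<in> {-1..1}" if "b \<in> B" for b
    proof -
      have "\<bar>w b\<bar> \<le> 1"
        using member_le_sum[of b B "\<lambda>b. \<bar>w b\<bar>"] that B sum1 by simp
      then show ?thesis by (simp add: abs_le_iff)
    qed
    moreover have "w b = 0" if "b \<notin> B" for b using that by (simp add: w_def)
    ultimately have "w \<in> P"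
      unfolding P_def PiE_UNIV_domain by (intro Pi_I) simp
    then show ?thesis
      using s sum1 by (intro bexI[of _ w]) (auto simp: K_def w_def)
  qed
  show ?thesis
  proof (cases "K = {}")
    case True
    then have "(\<Sum>b\<in>B. \<bar>u b\<bar>) = 0" for u :: "'a \<Rightarrow> real" using normalize by blast
    then show ?thesis using that[of 1] by simp
  next
    case False
    obtain w where w: "w \<in> K" and min: "\<And>u. u \<in> K \<Longrightarrow> norm (\<Sum>b\<in>B. w b *\<^sub>R b) \<le> norm (\<Sum>b\<in>B. u b *\<^sub>R b)"
      using continuous_attains_inf[OF K False cont] by blast
    let ?m = "norm (\<Sum>b\<in>B. w b *\<^sub>R b)"
    have "?m \<noteq> 0"
    proof
      assume "?m = 0"
      then have "\<forall>b\<in>B. w b = 0"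
        using independentD[OF B(2,1) order_refl] by auto
      then show False using w by (simp add: K_def)
    qed
    then have "?m > 0" by simp
    moreover have "?m * (\<Sum>b\<in>B. \<bar>u b\<bar>) \<le> norm (\<Sum>b\<in>B. u b *\<^sub>R b)" for u :: "'a \<Rightarrow> real"
    proof (cases "(\<Sum>b\<in>B. \<bar>u b\<bar>) = 0")
      case True then show ?thesis by (simp only: mult_zero_right norm_ge_zero)
    next
      case False
      let ?s = "\<Sum>b\<in>B. \<bar>u b\<bar>"
      from normalize[OF False] obtain v where v: "v \<in> K" "\<forall>b\<in>B. u b = ?s * v b" by blast
      have "(\<Sum>b\<in>B. u b *\<^sub>R b) = ?s *\<^sub>R (\<Sum>b\<in>B. v b *\<^sub>R b)"
        unfolding scaleR_sum_right scaleR_scaleR by (rule sum.cong[OF refl]) (metis v(2))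
      then have "norm (\<Sum>b\<in>B. u b *\<^sub>R b) = ?s * norm (\<Sum>b\<in>B. v b *\<^sub>R b)"
        by (simp add: sum_nonneg)
      then show ?thesis using min[OF v(1)]
        by (simp add: mult.commute mult_left_mono sum_nonneg)
    qed
    ultimately show ?thesis using that by blast
  qed
qed

text \<open>Bounded coordinate functionals are what is needed to expand a derivative \<open>D g (v)\<close> along a
  basis when \<open>v\<close> varies from point to point.\<close>

lemma finite_dimensional_coordinates:
  assumes "finite_dimensional TYPE('a::real_normed_vector)"
  obtains B :: "'a::real_normed_vector set" and l :: "'a \<Rightarrow> 'a \<Rightarrow> real"
  where "finite B" "\<And>b. b \<in> B \<Longrightarrow> bounded_linear (l b)" "\<And>v. (\<Sum>b\<in>B. l b v *\<^sub>R b) = v"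
proof -
  obtain C :: "'a set" where C: "finite C" "span C = UNIV"
    using assms unfolding finite_dimensional_def by auto
  obtain B where B: "B \<subseteq> C" "independent B" "C \<subseteq> span B"
    using maximal_independent_subset by blast
  have fin: "finite B" using B(1) C(1) by (rule finite_subset)
  have sp: "span B = UNIV"
    using C(2) span_minimal[OF B(3) subspace_span] by auto
  obtain c where c: "c > 0" "\<And>u. c * (\<Sum>b\<in>B. \<bar>u b\<bar>) \<le> norm (\<Sum>b\<in>B. u b *\<^sub>R b)"
    using representation_bounded[OF fin B(2)] by blast
  let ?l = "\<lambda>b v. representation B v b"
  have rep: "(\<Sum>b\<in>B. ?l b v *\<^sub>R b) = v" for v
    using sum_representation_eq[OF B(2), of v B] fin sp by auto
  have "bounded_linear (?l b)" if b: "b \<in> B" for b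
  proof (rule bounded_linear_intro[where K = "1/c"])
    show "?l b (x + y) = ?l b x + ?l b y" for x y
      using representation_add[OF B(2), of y x] sp by auto
    show "?l b (r *\<^sub>R x) = r *\<^sub>R ?l b x" for r x
      using representation_scale[OF B(2), of x r] sp by auto
    show "norm (?l b x) \<le> norm x * (1/c)" for x
    proof -
      have "\<bar>?l b x\<bar> \<le> (\<Sum>b\<in>B. \<bar>?l b x\<bar>)"
        using member_le_sum[of b B "\<lambda>b. \<bar>?l b x\<bar>"] b fin by simp
      then have "c * \<bar>?l b x\<bar> \<le> c * (\<Sum>b\<in>B. \<bar>?l b x\<bar>)"
        using c(1) by simp
      also have "\<dots> \<le> norm x"
        using c(2)[of "\<lambda>b. ?l b x"] rep by simp
      finally show ?thesis using c(1) by (simp add: field_simps)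
    qed
  qed
  then show ?thesis using that[of B ?l] fin rep by blast
qed

section \<open>Smooth maps between normed spaces\<close>

lemma Ck_on_subset: "Ck_on k f S \<Longrightarrow> T \<subseteq> S \<Longrightarrow> Ck_on k f T"
  by (induction k arbitrary: f) (auto intro: continuous_on_subset)

lemma Ck_on_cong:
  assumes "open S" "Ck_on k f S" "\<And>x. x \<in> S \<Longrightarrow> f x = g x"
  shows "Ck_on k g S"
  using assms(2,3)
proof (induction k arbitrary: f g)
  case 0
  then show ?case by (simp cong: continuous_on_cong)
next
  case (Suc k)
  have "g differentiable (at x)" if "x \<in> S" for x
    using Suc.prems \<open>open S\<close> that
    by (meson Ck_on.simps(2) differentiable_def has_derivative_transform_within_open)
  moreover have "Ck_on k (\<lambda>x. frechet_derivative g (at x) v) S" for v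
  proof (rule Suc.IH)
    show "Ck_on k (\<lambda>x. frechet_derivative f (at x) v) S" using Suc.prems by simp
    show "frechet_derivative f (at x) v = frechet_derivative g (at x) v" if "x \<in> S" for x
      using frechet_derivative_transform_within_open[of f x S g] Suc.prems \<open>open S\<close> that by auto
  qed
  ultimately show ?case by simp
qed

lemma Ck_on_SucI:
  assumes "open S" "\<And>x. x \<in> S \<Longrightarrow> (f has_derivative f' x) (at x)" "\<And>v. Ck_on k (\<lambda>x. f' x v) S"
  shows "Ck_on (Suc k) f S"
proof -
  have "Ck_on k (\<lambda>x. frechet_derivative f (at x) v) S" for v
    by (rule Ck_on_cong[OF assms(1) assms(3)[of v]]) (simp add: frechet_derivative_at[OF assms(2)])
  then show ?thesis using assms(2) by (auto simp: differentiable_def)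
qed

lemma Ck_on_Suc_has_derivative:
  "Ck_on (Suc k) f S \<Longrightarrow> x \<in> S \<Longrightarrow> (f has_derivative frechet_derivative f (at x)) (at x)"
  by (simp add: frechet_derivative_works)

lemma Ck_on_Suc_imp: "Ck_on (Suc k) f S \<Longrightarrow> Ck_on k f S"
proof (induction k arbitrary: f)
  case 0
  then show ?case
    by (auto intro!: continuous_at_imp_continuous_on differentiable_imp_continuous_within)
next
  case (Suc k)
  have "\<forall>x\<in>S. f differentiable (at x)"
    and "\<forall>v. Ck_on (Suc k) (\<lambda>x. frechet_derivative f (at x) v) S"
    using Suc.prems unfolding Ck_on.simps(2)[of "Suc k"] by blast+
  with Suc.IH show ?case unfolding Ck_on.simps(2)[of k f] by blast
qed

lemma Ck_on_local:
  assumes "\<And>x. x \<in> S \<Longrightarrow> \<exists>N. open N \<and> x \<in> N \<and> Ck_on k f (N \<inter> S)" "open S"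
  shows "Ck_on k f S"
  using assms(1)
proof (induction k arbitrary: f)
  case 0
  show ?case
    unfolding Ck_on.simps
  proof (rule continuous_at_imp_continuous_on, rule ballI)
    fix x assume x: "x \<in> S"
    with 0 obtain N where "open N" "x \<in> N" "continuous_on (N \<inter> S) f" by auto
    then show "isCont f x"
      using x \<open>open S\<close> continuous_on_eq_continuous_at[of "N \<inter> S" f] by auto
  qed
next
  case (Suc k)
  have diff: "f differentiable (at x)" if "x \<in> S" for x
  proof -
    obtain N where "x \<in> N" "Ck_on (Suc k) f (N \<inter> S)" using Suc.prems \<open>x \<in> S\<close> by blast
    then show ?thesis using that by simp
  qed
  have "Ck_on k (\<lambda>x. frechet_derivative f (at x) v) S" for v
  proof (rule Suc.IH)
    fix x assume "x \<in> S"
    then obtain N where "open N" "x \<in> N" "Ck_on (Suc k) f (N \<inter> S)" using Suc.prems by blast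
    then show "\<exists>N. open N \<and> x \<in> N \<and> Ck_on k (\<lambda>x. frechet_derivative f (at x) v) (N \<inter> S)"
      by (intro exI[of _ N]) simp
  qed
  with diff show ?case by simp
qed

lemma Ck_on_const: "open S \<Longrightarrow> Ck_on k (\<lambda>x. c) S"
proof (induction k arbitrary: c)
  case (Suc k)
  then show ?case
    by (intro Ck_on_SucI[where f'="\<lambda>x v. 0"]) auto
qed simp

lemma Ck_on_bounded_linear:
  assumes "bounded_linear L" "open S" "Ck_on k f S"
  shows "Ck_on k (\<lambda>x. L (f x)) S"
  using assms(3)
proof (induction k arbitrary: f)
  case 0
  then show ?case by (simp add: bounded_linear.continuous_on[OF assms(1)])
next
  case (Suc k)
  show ?case
  proof (rule Ck_on_SucI[OF assms(2)])
    show "((\<lambda>x. L (f x)) has_derivative (\<lambda>v. L (frechet_derivative f (at x) v))) (at x)"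
      if "x \<in> S" for x
      using bounded_linear.has_derivative[OF assms(1) Ck_on_Suc_has_derivative[OF Suc.prems that]] .
    show "Ck_on k (\<lambda>x. L (frechet_derivative f (at x) v)) S" for v
      using Suc by simp
  qed
qed

lemma Ck_on_id: "open S \<Longrightarrow> Ck_on k (\<lambda>x. x) S"
proof (cases k)
  case (Suc j)
  assume "open S"
  then show ?thesis
    unfolding Suc by (intro Ck_on_SucI[where f'="\<lambda>x v. v"]) (auto intro: Ck_on_const)
qed simp

lemma Ck_on_add:
  assumes "open S" "Ck_on k f S" "Ck_on k g S"
  shows "Ck_on k (\<lambda>x. f x + g x) S"
  using assms(2,3)
proof (induction k arbitrary: f g)
  case 0
  then show ?case by (simp add: continuous_on_add)
next
  case (Suc k)
  show ?case
  proof (rule Ck_on_SucI[OF assms(1)])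
    show "((\<lambda>x. f x + g x) has_derivative
        (\<lambda>v. frechet_derivative f (at x) v + frechet_derivative g (at x) v)) (at x)"
      if "x \<in> S" for x
      using Ck_on_Suc_has_derivative[OF Suc.prems(1) that]
        Ck_on_Suc_has_derivative[OF Suc.prems(2) that] by (rule has_derivative_add)
    show "Ck_on k (\<lambda>x. frechet_derivative f (at x) v + frechet_derivative g (at x) v) S" for v
      using Suc by simp
  qed
qed

lemma Ck_on_sum:
  assumes "open S" "finite I" "\<And>i. i \<in> I \<Longrightarrow> Ck_on k (f i) S"
  shows "Ck_on k (\<lambda>x. \<Sum>i\<in>I. f i x) S"
  using assms(2,3) by (induction I rule: finite_induct) (auto intro: Ck_on_const Ck_on_add assms(1))

lemma Ck_on_scaleR:
  assumes "open S" "Ck_on k f S" "Ck_on k g S"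
  shows "Ck_on k (\<lambda>x. f x *\<^sub>R g x) S"
  using assms(2,3)
proof (induction k arbitrary: f g)
  case 0
  then show ?case by (simp add: continuous_on_scaleR)
next
  case (Suc k)
  show ?case
  proof (rule Ck_on_SucI[OF assms(1)])
    show "((\<lambda>x. f x *\<^sub>R g x) has_derivative
        (\<lambda>v. f x *\<^sub>R frechet_derivative g (at x) v + frechet_derivative f (at x) v *\<^sub>R g x)) (at x)"
      if "x \<in> S" for x
      using Ck_on_Suc_has_derivative[OF Suc.prems(1) that]
        Ck_on_Suc_has_derivative[OF Suc.prems(2) that] by (rule has_derivative_scaleR)
    show "Ck_on k (\<lambda>x. f x *\<^sub>R frechet_derivative g (at x) v + frechet_derivative f (at x) v *\<^sub>R g x) S" for v
      using Suc Ck_on_Suc_imp[OF Suc.prems(1)] Ck_on_Suc_imp[OF Suc.prems(2)]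
      by (intro Ck_on_add assms(1) Suc.IH) auto
  qed
qed

lemma Ck_on_Pair:
  assumes "open S" "Ck_on k f S" "Ck_on k g S"
  shows "Ck_on k (\<lambda>x. (f x, g x)) S"
proof -
  have "bounded_linear (\<lambda>x::'b. (x, 0::'c))" "bounded_linear (\<lambda>x::'c. (0::'b, x))"
    by (auto intro: bounded_linear_Pair bounded_linear_ident bounded_linear_zero)
  from this(1)[THEN Ck_on_bounded_linear, OF assms(1,2)]
    this(2)[THEN Ck_on_bounded_linear, OF assms(1,3)]
  have "Ck_on k (\<lambda>x. (f x, 0) + (0, g x)) S" by (intro Ck_on_add assms)
  then show ?thesis by simp
qed

text \<open>The recursion for \<open>C\<close>-\<open>k\<close> speaks of directional derivatives \<open>D g (y) b\<close> in a fixed direction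
  \<open>b\<close>, whereas the chain rule produces \<open>D g (f x)\<close> in the moving direction \<open>D f (x) v\<close>. Expanding that
  direction in coordinates reduces the chain rule to the product rule; this is why the middle
  space has to be finite-dimensional.\<close>

lemma Ck_on_compose:
  fixes f :: "'a::real_normed_vector \<Rightarrow> 'b::real_normed_vector"
    and g :: "'b \<Rightarrow> 'c::real_normed_vector"
  assumes fd: "finite_dimensional TYPE('b)" and S: "open S" and T: "open T"
    and "Ck_on k g T" "Ck_on k f S" "f ` S \<subseteq> T"
  shows "Ck_on k (\<lambda>x. g (f x)) S"
  using assms(4,5,6)
proof (induction k arbitrary: g)
  case 0
  then show ?case by (auto intro: continuous_on_compose2)
next
  case (Suc k)
  obtain B :: "'b set" and l where B: "finite B"
    and l: "\<And>b. b \<in> B \<Longrightarrow> bounded_linear (l b)" "\<And>v. (\<Sum>b\<in>B. l b v *\<^sub>R b) = v"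
    using finite_dimensional_coordinates[OF fd] by blast
  let ?D = "\<lambda>x v. \<Sum>b\<in>B. l b (frechet_derivative f (at x) v) *\<^sub>R frechet_derivative g (at (f x)) b"
  show ?case
  proof (rule Ck_on_SucI[OF S])
    fix x assume x: "x \<in> S"
    have dg: "(g has_derivative frechet_derivative g (at (f x))) (at (f x))"
      using Ck_on_Suc_has_derivative[OF Suc.prems(1)] x Suc.prems(3) by blast
    have comp: "((\<lambda>x. g (f x)) has_derivative
        (\<lambda>v. frechet_derivative g (at (f x)) (frechet_derivative f (at x) v))) (at x)"
      using has_derivative_compose[OF Ck_on_Suc_has_derivative[OF Suc.prems(2) x] dg] .
    have expand: "frechet_derivative g (at (f x)) w = (\<Sum>b\<in>B. l b w *\<^sub>R frechet_derivative g (at (f x)) b)" for w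
    proof -
      have "linear (frechet_derivative g (at (f x)))"
        using dg by (rule has_derivative_linear)
      then show ?thesis
        using linear_sum[of "frechet_derivative g (at (f x))" "\<lambda>b. l b w *\<^sub>R b" B]
          linear_scale[of "frechet_derivative g (at (f x))"] l(2)[of w] by simp
    qed
    show "((\<lambda>x. g (f x)) has_derivative ?D x) (at x)"
      by (rule has_derivative_eq_rhs[OF comp]) (rule ext, rule expand)
  next
    fix v
    show "Ck_on k (\<lambda>x. ?D x v) S"
    proof (rule Ck_on_sum[OF S B], rule Ck_on_scaleR[OF S])
      fix b assume "b \<in> B"
      then show "Ck_on k (\<lambda>x. l b (frechet_derivative f (at x) v)) S"
        using Suc.prems by (intro Ck_on_bounded_linear[OF l(1) S]) simp_all
      show "Ck_on k (\<lambda>x. frechet_derivative g (at (f x)) b) S"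
        using Suc.prems Ck_on_Suc_imp[OF Suc.prems(2)] by (intro Suc.IH) simp_all
    qed
  qed
qed

lemma smooth_on_subset: "smooth_on f S \<Longrightarrow> T \<subseteq> S \<Longrightarrow> smooth_on f T"
  by (meson smooth_on_def Ck_on_subset)

lemma smooth_on_cong:
  "open S \<Longrightarrow> smooth_on f S \<Longrightarrow> (\<And>x. x \<in> S \<Longrightarrow> f x = g x) \<Longrightarrow> smooth_on g S"
  by (meson smooth_on_def Ck_on_cong)

lemma smooth_on_local:
  assumes "\<And>x. x \<in> S \<Longrightarrow> \<exists>N. open N \<and> x \<in> N \<and> smooth_on f (N \<inter> S)" "open S"
  shows "smooth_on f S"
  unfolding smooth_on_def by (meson assms Ck_on_local smooth_on_def)

lemma smooth_on_continuous: "smooth_on f S \<Longrightarrow> continuous_on S f"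
  unfolding smooth_on_def by (metis Ck_on.simps(1))

lemma smooth_on_has_derivative:
  "smooth_on f S \<Longrightarrow> x \<in> S \<Longrightarrow> (f has_derivative frechet_derivative f (at x)) (at x)"
  unfolding smooth_on_def by (blast intro: Ck_on_Suc_has_derivative)

lemma smooth_on_directional_derivative:
  "smooth_on f S \<Longrightarrow> smooth_on (\<lambda>x. frechet_derivative f (at x) v) S"
  unfolding smooth_on_def by (metis Ck_on.simps(2))

lemma smooth_on_const: "open S \<Longrightarrow> smooth_on (\<lambda>x. c) S"
  by (simp add: smooth_on_def Ck_on_const)

lemma smooth_on_id: "open S \<Longrightarrow> smooth_on (\<lambda>x. x) S"
  by (simp add: smooth_on_def Ck_on_id)

lemma smooth_on_bounded_linear:
  "bounded_linear L \<Longrightarrow> open S \<Longrightarrow> smooth_on f S \<Longrightarrow> smooth_on (\<lambda>x. L (f x)) S"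
  by (simp add: smooth_on_def Ck_on_bounded_linear)

lemma smooth_on_linear: "bounded_linear L \<Longrightarrow> open S \<Longrightarrow> smooth_on L S"
  using smooth_on_bounded_linear[OF _ _ smooth_on_id] .

lemma smooth_on_add: "open S \<Longrightarrow> smooth_on f S \<Longrightarrow> smooth_on g S \<Longrightarrow> smooth_on (\<lambda>x. f x + g x) S"
  by (simp add: smooth_on_def Ck_on_add)

lemma smooth_on_scaleR: "open S \<Longrightarrow> smooth_on f S \<Longrightarrow> smooth_on g S \<Longrightarrow> smooth_on (\<lambda>x. f x *\<^sub>R g x) S"
  by (simp add: smooth_on_def Ck_on_scaleR)

lemma smooth_on_Pair: "open S \<Longrightarrow> smooth_on f S \<Longrightarrow> smooth_on g S \<Longrightarrow> smooth_on (\<lambda>x. (f x, g x)) S"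
  by (simp add: smooth_on_def Ck_on_Pair)

lemma smooth_on_compose:
  fixes f :: "'a::real_normed_vector \<Rightarrow> 'b::real_normed_vector"
  assumes "finite_dimensional TYPE('b)" "open S" "open T" "smooth_on g T" "smooth_on f S" "f ` S \<subseteq> T"
  shows "smooth_on (\<lambda>x. g (f x)) S"
  using assms by (simp add: smooth_on_def Ck_on_compose)

section \<open>Smooth maps into a manifold\<close>

text \<open>The topological part of an atlas. It suffices for composing smooth maps and, unlike smoothness
  of the coordinate changes, passes to products without any calculus.\<close>

definition chart_atlas :: "('m::topological_space, 'e::real_normed_vector) atlas \<Rightarrow> bool"
  where "chart_atlas A \<longleftrightarrow> \<Union> (fst ` A) = UNIV \<and>
    (\<forall>(U, \<phi>)\<in>A. open U \<and> inj_on \<phi> U \<and> open (\<phi> ` U) \<and>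
      continuous_on U \<phi> \<and> continuous_on (\<phi> ` U) (inv_into U \<phi>))"

text \<open>Curves, families of curves and inverses of charts all have an open set of a normed space as
  their domain. For them smoothness can be expressed without an atlas on the domain.\<close>

definition smooth_into ::
    "('m::topological_space, 'e::real_normed_vector) atlas \<Rightarrow>
     'a::real_normed_vector set \<Rightarrow> ('a \<Rightarrow> 'm) \<Rightarrow> bool"
  where "smooth_into A S F \<longleftrightarrow>
    continuous_on S F \<and> (\<forall>(V, \<psi>)\<in>A. smooth_on (\<lambda>x. \<psi> (F x)) (S \<inter> F -` V))"

lemma chart_atlasD:
  assumes "chart_atlas A" "(U, \<phi>) \<in> A"
  shows "open U" "inj_on \<phi> U" "open (\<phi> ` U)" "continuous_on U \<phi>"
    "continuous_on (\<phi> ` U) (inv_into U \<phi>)"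
  using assms unfolding chart_atlas_def by auto

lemma chart_at: 
  assumes "chart_atlas A"
  obtains U \<phi> where "(U, \<phi>) \<in> A" "p \<in> U"
proof -
  have "p \<in> \<Union> (fst ` A)" using assms unfolding chart_atlas_def by auto
  then show ?thesis using that by auto
qed

lemma chart_open_image:
  assumes "chart_atlas A" "(U, \<phi>) \<in> A" "open W"
  shows "open (\<phi> ` (U \<inter> W))"
proof -
  note ch = chart_atlasD[OF assms(1,2)]
  have "\<phi> ` (U \<inter> W) = \<phi> ` U \<inter> inv_into U \<phi> -` W"
    using ch(2) by (auto simp: inv_into_f_f)
  then show ?thesis
    using continuous_open_preimage[OF ch(5,3) assms(3)] by simp
qed

lemma smooth_into_continuous: "smooth_into A S F \<Longrightarrow> continuous_on S F"
  by (simp add: smooth_into_def)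

lemma smooth_into_chart:
  "smooth_into A S F \<Longrightarrow> (V, \<psi>) \<in> A \<Longrightarrow> smooth_on (\<lambda>x. \<psi> (F x)) (S \<inter> F -` V)"
  by (auto simp: smooth_into_def)

lemma smooth_into_subset: "smooth_into A S F \<Longrightarrow> T \<subseteq> S \<Longrightarrow> smooth_into A T F"
  unfolding smooth_into_def
  by (auto intro: continuous_on_subset smooth_on_subset[of _ "S \<inter> F -` U" "T \<inter> F -` U" for U])

lemma smooth_into_const:
  assumes "open S"
  shows "smooth_into A S (\<lambda>x. p)"
proof -
  have "open (S \<inter> (\<lambda>x. p) -` V)" for V
    using assms by (cases "p \<in> V") auto
  then show ?thesis
    unfolding smooth_into_def by (auto intro: smooth_on_const)
qed

lemma smooth_into_local:
  assumes "\<And>x. x \<in> S \<Longrightarrow> \<exists>N. open N \<and> x \<in> N \<and> smooth_into A (N \<inter> S) F" "open S" "chart_atlas A"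
  shows "smooth_into A S F"
proof -
  have cont: "continuous_on S F"
  proof (rule continuous_at_imp_continuous_on, rule ballI)
    fix x assume x: "x \<in> S"
    with assms(1) obtain N where "open N" "x \<in> N" "continuous_on (N \<inter> S) F"
      unfolding smooth_into_def by blast
    then show "isCont F x"
      using x \<open>open S\<close> continuous_on_eq_continuous_at[of "N \<inter> S" F] by auto
  qed
  moreover have "smooth_on (\<lambda>x. \<psi> (F x)) (S \<inter> F -` V)" if V: "(V, \<psi>) \<in> A" for V \<psi>
  proof (rule smooth_on_local)
    show "open (S \<inter> F -` V)"
      using continuous_open_preimage[OF cont \<open>open S\<close>] chart_atlasD(1)[OF \<open>chart_atlas A\<close> V] .
    fix x assume "x \<in> S \<inter> F -` V"
    then obtain N where "open N" "x \<in> N" "smooth_into A (N \<inter> S) F"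
      using assms(1) by blast
    moreover from smooth_into_chart[OF this(3) V]
    have "smooth_on (\<lambda>x. \<psi> (F x)) (N \<inter> (S \<inter> F -` V))"
      by (rule smooth_on_subset) auto
    ultimately show "\<exists>N. open N \<and> x \<in> N \<and> smooth_on (\<lambda>x. \<psi> (F x)) (N \<inter> (S \<inter> F -` V))"
      by blast
  qed
  ultimately show ?thesis unfolding smooth_into_def by auto
qed

lemma smooth_into_cong:
  assumes "smooth_into A S F" "\<And>x. x \<in> S \<Longrightarrow> F x = G x" "open S" "chart_atlas A"
  shows "smooth_into A S G"
proof -
  have "continuous_on S G"
    using smooth_into_continuous[OF assms(1)] assms(2) by (simp cong: continuous_on_cong)
  moreover have "smooth_on (\<lambda>x. \<psi> (G x)) (S \<inter> G -` V)" if V: "(V, \<psi>) \<in> A" for V \<psi>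
  proof -
    have eq: "S \<inter> G -` V = S \<inter> F -` V" using assms(2) by auto
    have "open (S \<inter> G -` V)"
      using continuous_open_preimage[OF \<open>continuous_on S G\<close> \<open>open S\<close>]
        chart_atlasD(1)[OF \<open>chart_atlas A\<close> V] .
    then show ?thesis
      using smooth_into_chart[OF assms(1) V] assms(2) unfolding eq
      by (auto intro: smooth_on_cong)
  qed
  ultimately show ?thesis unfolding smooth_into_def by auto
qed

lemma smooth_into_precompose:
  fixes g :: "'a::real_normed_vector \<Rightarrow> 'b::real_normed_vector"
  assumes fd: "finite_dimensional TYPE('b)" and A: "chart_atlas A" and ST: "open S" "open T"
    and F: "smooth_into A T F" and g: "smooth_on g S" and sub: "g ` S \<subseteq> T"
  shows "smooth_into A S (\<lambda>x. F (g x))"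
proof -
  have cont: "continuous_on S (\<lambda>x. F (g x))"
    using continuous_on_compose2[OF smooth_into_continuous[OF F] smooth_on_continuous[OF g] sub] .
  moreover have "smooth_on (\<lambda>x. \<psi> (F (g x))) (S \<inter> (\<lambda>x. F (g x)) -` V)" if V: "(V, \<psi>) \<in> A" for V \<psi>
  proof (rule smooth_on_compose[OF fd])
    note oV = chart_atlasD(1)[OF A V]
    show "open (S \<inter> (\<lambda>x. F (g x)) -` V)"
      using continuous_open_preimage[OF cont ST(1) oV] .
    show "open (T \<inter> F -` V)"
      using continuous_open_preimage[OF smooth_into_continuous[OF F] ST(2) oV] .
    show "smooth_on (\<lambda>x. \<psi> (F x)) (T \<inter> F -` V)"
      using smooth_into_chart[OF F V] .
    show "smooth_on g (S \<inter> (\<lambda>x. F (g x)) -` V)"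
      using g by (rule smooth_on_subset) auto
    show "g ` (S \<inter> (\<lambda>x. F (g x)) -` V) \<subseteq> T \<inter> F -` V"
      using sub by auto
  qed
  ultimately show ?thesis unfolding smooth_into_def by auto
qed

text \<open>Near each point a chart of the manifold in the middle splits \<open>H \<circ> F\<close> into two smooth maps between
  normed spaces.\<close>

lemma smooth_map_smooth_into:
  fixes B :: "('n::topological_space, 'f::real_normed_vector) atlas"
  assumes fd: "finite_dimensional TYPE('f)" and A: "chart_atlas A" and B: "chart_atlas B"
    and H: "smooth_map B A H" and S: "open S" and F: "smooth_into B S F"
  shows "smooth_into A S (\<lambda>x. H (F x))"
proof -
  have cH: "continuous_on UNIV H" using H by (simp add: smooth_map_def)
  have cont: "continuous_on S (\<lambda>x. H (F x))"
    using continuous_on_compose2[OF cH smooth_into_continuous[OF F]] by auto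
  moreover have "smooth_on (\<lambda>x. \<psi> (H (F x))) (S \<inter> (\<lambda>x. H (F x)) -` V)" if V: "(V, \<psi>) \<in> A" for V \<psi>
  proof (rule smooth_on_local)
    note oV = chart_atlasD(1)[OF A V]
    show oS: "open (S \<inter> (\<lambda>x. H (F x)) -` V)"
      using continuous_open_preimage[OF cont S oV] .
    fix x assume "x \<in> S \<inter> (\<lambda>x. H (F x)) -` V"
    then have x: "x \<in> S" "H (F x) \<in> V" by auto
    obtain U \<phi> where U: "(U, \<phi>) \<in> B" "F x \<in> U" using chart_at[OF B] .
    note ch = chart_atlasD[OF B U(1)]
    let ?N = "S \<inter> F -` U"
    let ?T = "\<phi> ` (U \<inter> H -` V)"
    have N: "open ?N"
      using continuous_open_preimage[OF smooth_into_continuous[OF F] S ch(1)] .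
    have T: "open ?T"
      using chart_open_image[OF B U(1)] continuous_open_preimage[OF cH open_UNIV oV] by simp
    let ?M = "?N \<inter> (S \<inter> (\<lambda>x. H (F x)) -` V)"
    have M: "open ?M" using N oS by blast
    have "smooth_on (\<lambda>x. (\<psi> \<circ> H \<circ> inv_into U \<phi>) (\<phi> (F x))) ?M"
    proof (rule smooth_on_compose[OF fd M T])
      show "smooth_on (\<psi> \<circ> H \<circ> inv_into U \<phi>) ?T"
        using H U(1) V unfolding smooth_map_def by blast
      show "smooth_on (\<lambda>x. \<phi> (F x)) ?M"
        using smooth_into_chart[OF F U(1)] by (rule smooth_on_subset) auto
    qed auto
    then have "smooth_on (\<lambda>x. \<psi> (H (F x))) ?M"
      by (rule smooth_on_cong[OF M]) (use ch(2) in \<open>auto simp: inv_into_f_f\<close>)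
    then show "\<exists>N. open N \<and> x \<in> N \<and>
        smooth_on (\<lambda>x. \<psi> (H (F x))) (N \<inter> (S \<inter> (\<lambda>x. H (F x)) -` V))"
      using N x U(2) by (intro exI[of _ ?N]) auto
  qed
  ultimately show ?thesis unfolding smooth_into_def by auto
qed

lemma smooth_into_real_line: "smooth_into real_line S f \<longleftrightarrow> smooth_on f S"
  by (auto simp: smooth_into_def real_line_def smooth_on_continuous)

lemma chart_atlas_real_line: "chart_atlas real_line"
  by (auto simp: chart_atlas_def real_line_def)

lemma smooth_curve_iff: "smooth_curve A c \<longleftrightarrow> smooth_into A UNIV c"
  by (auto simp: smooth_map_def smooth_into_def real_line_def o_def)

lemma inv_into_map_prod:
  assumes "inj_on \<phi> U" "inj_on \<psi> V" "x \<in> \<phi> ` U" "y \<in> \<psi> ` V"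
  shows "inv_into (U \<times> V) (map_prod \<phi> \<psi>) (x, y) = (inv_into U \<phi> x, inv_into V \<psi> y)"
proof -
  obtain u v where "u \<in> U" "x = \<phi> u" "v \<in> V" "y = \<psi> v" using assms by auto
  moreover have "inj_on (map_prod \<phi> \<psi>) (U \<times> V)" using assms(1,2) by (rule map_prod_inj_on)
  ultimately show ?thesis
    using inv_into_f_f[of "map_prod \<phi> \<psi>" "U \<times> V" "(u, v)"] assms by (simp add: inv_into_f_f)
qed

lemma chart_atlas_prod:
  assumes A: "chart_atlas A" and B: "chart_atlas B"
  shows "chart_atlas (prod_atlas A B)"
proof -
  have "\<exists>W \<kappa>. (W, \<kappa>) \<in> prod_atlas A B \<and> z \<in> W" for z
  proof -
    obtain U \<phi> V \<psi> where "(U, \<phi>) \<in> A" "fst z \<in> U" "(V, \<psi>) \<in> B" "snd z \<in> V"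
      using chart_at[OF A] chart_at[OF B] by metis
    then show ?thesis
      unfolding prod_atlas_def by (intro exI[of _ "U \<times> V"] exI[of _ "map_prod \<phi> \<psi>"]) (auto simp: mem_Times_iff)
  qed
  then have "\<Union> (fst ` prod_atlas A B) = UNIV" by force
  moreover have "open W \<and> inj_on \<kappa> W \<and> open (\<kappa> ` W) \<and>
      continuous_on W \<kappa> \<and> continuous_on (\<kappa> ` W) (inv_into W \<kappa>)"
    if W: "(W, \<kappa>) \<in> prod_atlas A B" for W \<kappa>
  proof -
    obtain U \<phi> V \<psi> where U: "(U, \<phi>) \<in> A" and V: "(V, \<psi>) \<in> B"
      and W: "W = U \<times> V" "\<kappa> = map_prod \<phi> \<psi>" using W unfolding prod_atlas_def by auto
    note u = chart_atlasD[OF A U] and v = chart_atlasD[OF B V]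
    have im: "\<kappa> ` W = \<phi> ` U \<times> \<psi> ` V" unfolding W by (rule map_prod_surj_on[OF refl refl])
    have "continuous_on W (\<lambda>z. (\<phi> (fst z), \<psi> (snd z)))"
      unfolding W by (intro continuous_intros continuous_on_compose2[OF u(4)] continuous_on_compose2[OF v(4)]) auto
    then have "continuous_on W \<kappa>" by (simp add: W map_prod_def case_prod_beta')
    moreover have "continuous_on (\<kappa> ` W) (\<lambda>z. (inv_into U \<phi> (fst z), inv_into V \<psi> (snd z)))"
      unfolding im by (intro continuous_intros continuous_on_compose2[OF u(5)] continuous_on_compose2[OF v(5)]) auto
    then have "continuous_on (\<kappa> ` W) (inv_into W \<kappa>)"
      by (rule continuous_on_eq) (auto simp: im W inv_into_map_prod[OF u(2) v(2)])
    moreover have "inj_on \<kappa> W" unfolding W using u(2) v(2) by (rule map_prod_inj_on)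
    ultimately show ?thesis
      using u(1,3) v(1,3) by (simp add: im open_Times) (simp add: W open_Times)
  qed
  ultimately show ?thesis unfolding chart_atlas_def by auto
qed

lemma smooth_into_Pair:
  assumes A: "chart_atlas A" and B: "chart_atlas B" and S: "open S"
    and F: "smooth_into A S F" and G: "smooth_into B S G"
  shows "smooth_into (prod_atlas A B) S (\<lambda>x. (F x, G x))"
proof -
  have cF: "continuous_on S F" and cG: "continuous_on S G"
    using F G by (auto intro: smooth_into_continuous)
  have "smooth_on (\<lambda>x. \<kappa> (F x, G x)) (S \<inter> (\<lambda>x. (F x, G x)) -` W)"
    if W: "(W, \<kappa>) \<in> prod_atlas A B" for W \<kappa>
  proof -
    obtain U \<phi> V \<psi> where U: "(U, \<phi>) \<in> A" and V: "(V, \<psi>) \<in> B"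
      and W: "W = U \<times> V" "\<kappa> = map_prod \<phi> \<psi>" using W unfolding prod_atlas_def by auto
    have eq: "S \<inter> (\<lambda>x. (F x, G x)) -` W = (S \<inter> F -` U) \<inter> (S \<inter> G -` V)" unfolding W by auto
    have "open ((S \<inter> F -` U) \<inter> (S \<inter> G -` V))"
      using continuous_open_preimage[OF cF S chart_atlasD(1)[OF A U]]
        continuous_open_preimage[OF cG S chart_atlasD(1)[OF B V]] by blast
    then have "smooth_on (\<lambda>x. (\<phi> (F x), \<psi> (G x))) ((S \<inter> F -` U) \<inter> (S \<inter> G -` V))"
      by (rule smooth_on_Pair)
         (auto intro: smooth_on_subset smooth_into_chart[OF F U] smooth_into_chart[OF G V])
    then show ?thesis unfolding eq unfolding W by simp
  qed
  then show ?thesis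
    unfolding smooth_into_def using cF cG by (auto intro: continuous_intros)
qed

section \<open>Tangent vectors in charts\<close>

text \<open>The sine serves as a smooth reparametrization of the line with bounded range and derivative 1
  at 0.\<close>

lemma Ck_on_sin_cos: "Ck_on k sin (UNIV::real set) \<and> Ck_on k cos (UNIV::real set)"
proof (induction k)
  case (Suc k)
  have "Ck_on (Suc k) sin (UNIV::real set)"
  proof (rule Ck_on_SucI[where f' = "\<lambda>x v. v *\<^sub>R cos x"])
    show "(sin has_derivative (\<lambda>v. v *\<^sub>R cos x)) (at x)" for x :: real
      using DERIV_sin[of x] by (simp add: has_field_derivative_def mult.commute[of _ "cos x"] )
    show "Ck_on k (\<lambda>x. v *\<^sub>R cos x) (UNIV::real set)" for v :: real
      using Suc by (intro Ck_on_scaleR Ck_on_const) simp_all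
  qed simp
  moreover have "Ck_on (Suc k) cos (UNIV::real set)"
  proof (rule Ck_on_SucI[where f' = "\<lambda>x v. (-v) *\<^sub>R sin x"])
    show "(cos has_derivative (\<lambda>v. (-v) *\<^sub>R sin x)) (at x)" for x :: real
      using DERIV_cos[of x, unfolded has_field_derivative_def]
      by (rule has_derivative_eq_rhs) (simp add: fun_eq_iff)
    show "Ck_on k (\<lambda>x. (-v) *\<^sub>R sin x) (UNIV::real set)" for v :: real
      using Suc by (intro Ck_on_scaleR Ck_on_const) simp_all
  qed simp
  ultimately show ?case by blast
qed (auto intro: continuous_intros)

lemma smooth_on_sin: "smooth_on sin (UNIV::real set)"
  using Ck_on_sin_cos by (simp add: smooth_on_def)

text \<open>The tangent vector at \<open>p\<close> with coordinates \<open>v\<close>; as for velocities, its value on functions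
  that are not smooth is 0.\<close>

definition coord_tangent ::
    "('m::topological_space, 'e::real_normed_vector) atlas \<Rightarrow> 'm set \<Rightarrow> ('m \<Rightarrow> 'e) \<Rightarrow> 'm \<Rightarrow> 'e \<Rightarrow> 'm tangent"
  where "coord_tangent A U \<phi> p v =
    (\<lambda>f. if smooth_fun A f then frechet_derivative (\<lambda>x. f (inv_into U \<phi> x)) (at (\<phi> p)) v else 0)"

locale smooth_manifold =
  fixes A :: "('m::{t2_space,second_countable_topology}, 'e::banach) atlas"
  assumes smooth_atlas: "smooth_atlas A"
begin

lemma fd: "finite_dimensional TYPE('e)"
  using smooth_atlas unfolding smooth_atlas_def finite_dimensional_def by auto

lemma charts: "chart_atlas A"
proof -
  have "inj_on \<phi> U \<and> continuous_on U \<phi> \<and> continuous_on (\<phi> ` U) (inv_into U \<phi>)"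
    if "homeomorphism U (\<phi> ` U) \<phi> (inv_into U \<phi>)" for U and \<phi> :: "'m \<Rightarrow> 'e"
    using that unfolding homeomorphism_def by (metis inj_on_def)
  then show ?thesis
    using smooth_atlas unfolding smooth_atlas_def chart_atlas_def by fast
qed

lemma smooth_into_chart_inverse:
  assumes "(U, \<phi>) \<in> A"
  shows "smooth_into A (\<phi> ` U) (inv_into U \<phi>)"
  unfolding smooth_into_def
proof safe
  note ch = chart_atlasD[OF charts assms]
  show "continuous_on (\<phi> ` U) (inv_into U \<phi>)" by (rule ch)
  fix V \<psi> assume V: "(V, \<psi>) \<in> A"
  have "\<phi> ` U \<inter> inv_into U \<phi> -` V = \<phi> ` (U \<inter> V)"
    using ch(2) by (auto simp: inv_into_f_f)
  then show "smooth_on (\<lambda>x. \<psi> (inv_into U \<phi> x)) (\<phi> ` U \<inter> inv_into U \<phi> -` V)"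
    using smooth_atlas assms V unfolding smooth_atlas_def by (auto simp: o_def)
qed

lemma smooth_fun_smooth_on:
  "smooth_fun A f \<Longrightarrow> open S \<Longrightarrow> smooth_into A S F \<Longrightarrow> smooth_on (\<lambda>x. f (F x)) S"
  using smooth_map_smooth_into[OF fd chart_atlas_real_line charts, of f S F]
  by (simp add: smooth_into_real_line)

lemma smooth_fun_chart:
  assumes "smooth_fun A f" "(U, \<phi>) \<in> A"
  shows "smooth_on (\<lambda>x. f (inv_into U \<phi> x)) (\<phi> ` U)"
  using smooth_fun_smooth_on[OF assms(1) _ smooth_into_chart_inverse[OF assms(2)]]
    chart_atlasD(3)[OF charts assms(2)] by blast

lemma continuous_if_chartwise:
  assumes "\<And>U \<phi>. (U, \<phi>) \<in> A \<Longrightarrow> continuous_on (\<phi> ` U) (\<lambda>x. f (inv_into U \<phi> x))"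
  shows "continuous_on UNIV f"
proof (rule continuous_at_imp_continuous_on, rule ballI)
  fix p
  obtain U \<phi> where U: "(U, \<phi>) \<in> A" "p \<in> U" using chart_at[OF charts] .
  note ch = chart_atlasD[OF charts U(1)]
  have "continuous_on U (\<lambda>q. f (inv_into U \<phi> (\<phi> q)))"
    using continuous_on_compose2[OF assms[OF U(1)] ch(4)] by auto
  then have "continuous_on U f"
    by (rule continuous_on_eq) (use ch(2) in \<open>auto simp: inv_into_f_f\<close>)
  then show "isCont f p" using ch(1) U(2) continuous_on_eq_continuous_at by blast
qed

lemma smooth_funI:
  assumes "\<And>U \<phi>. (U, \<phi>) \<in> A \<Longrightarrow> smooth_on (\<lambda>x. f (inv_into U \<phi> x)) (\<phi> ` U)"
  shows "smooth_fun A f"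
proof -
  have "continuous_on UNIV f"
    using assms by (intro continuous_if_chartwise smooth_on_continuous)
  then show ?thesis
    using assms unfolding smooth_map_def real_line_def by (auto simp: o_def)
qed

lemma smooth_fun_const: "smooth_fun A (\<lambda>p. c)"
  by (rule smooth_funI) (rule smooth_on_const[OF chart_atlasD(3)[OF charts]])

lemma smooth_fun_add:
  assumes "smooth_fun A f" "smooth_fun A g"
  shows "smooth_fun A (\<lambda>p. f p + g p)"
proof (rule smooth_funI)
  fix U \<phi> assume U: "(U, \<phi>) \<in> A"
  show "smooth_on (\<lambda>x. f (inv_into U \<phi> x) + g (inv_into U \<phi> x)) (\<phi> ` U)"
    by (rule smooth_on_add[OF chart_atlasD(3)[OF charts U]
          smooth_fun_chart[OF assms(1) U] smooth_fun_chart[OF assms(2) U]])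
qed

lemma smooth_fun_scale:
  assumes "smooth_fun A f"
  shows "smooth_fun A (\<lambda>p. r * f p)"
proof (rule smooth_funI)
  fix U \<phi> assume U: "(U, \<phi>) \<in> A"
  show "smooth_on (\<lambda>x. r * f (inv_into U \<phi> x)) (\<phi> ` U)"
    by (rule smooth_on_scaleR[OF chart_atlasD(3)[OF charts U] smooth_on_const[OF chart_atlasD(3)[OF charts U]]
          smooth_fun_chart[OF assms U], unfolded real_scaleR_def])
qed

lemma smooth_fun_diff: "smooth_fun A f \<Longrightarrow> smooth_fun A g \<Longrightarrow> smooth_fun A (\<lambda>p. f p - g p)"
  using smooth_fun_add[OF _ smooth_fun_scale[of g "-1"], of f] by simp

lemma curve_derivative:
  assumes f: "smooth_fun A f" and U: "(U, \<phi>) \<in> A" "c s \<in> U" and c: "isCont c s"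
    and d: "((\<lambda>t. \<phi> (c t)) has_vector_derivative v) (at s)"
  shows "((\<lambda>t. f (c t)) has_real_derivative coord_tangent A U \<phi> (c s) v f) (at s)"
proof -
  note ch = chart_atlasD[OF charts U(1)]
  let ?F = "\<lambda>x. f (inv_into U \<phi> x)"
  have dF: "(?F has_derivative frechet_derivative ?F (at (\<phi> (c s)))) (at (\<phi> (c s)))"
    using smooth_on_has_derivative[OF smooth_fun_chart[OF f U(1)]] U(2) by blast
  have "((\<lambda>t. ?F (\<phi> (c t))) has_derivative
      (\<lambda>h. frechet_derivative ?F (at (\<phi> (c s))) (h *\<^sub>R v))) (at s)"
    using has_derivative_compose[OF d[unfolded has_vector_derivative_def] dF] .
  moreover have "frechet_derivative ?F (at (\<phi> (c s))) (h *\<^sub>R v) = coord_tangent A U \<phi> (c s) v f * h" for h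
    using linear_scale[OF has_derivative_linear[OF dF], of h v] f by (simp add: coord_tangent_def)
  ultimately have "((\<lambda>t. ?F (\<phi> (c t))) has_real_derivative coord_tangent A U \<phi> (c s) v f) (at s)"
    by (simp add: has_field_derivative_def)
  moreover have "\<forall>\<^sub>F t in nhds s. ?F (\<phi> (c t)) = f (c t)"
  proof -
    have "\<forall>\<^sub>F t in nhds s. c t \<in> U"
      using c ch(1) U(2) by (simp add: eventually_nhds continuous_at_open)
    then show ?thesis by eventually_elim (use ch(2) in \<open>simp add: inv_into_f_f\<close>)
  qed
  ultimately show ?thesis
    by (simp add: DERIV_cong_ev[OF refl _ refl])
qed

lemma smooth_curve_chart_derivative:
  assumes "smooth_curve A c" "(U, \<phi>) \<in> A" "c s \<in> U"
  shows "((\<lambda>t. \<phi> (c t)) has_vector_derivative frechet_derivative (\<lambda>t. \<phi> (c t)) (at s) 1) (at s)"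
proof -
  have d: "((\<lambda>t. \<phi> (c t)) has_derivative frechet_derivative (\<lambda>t. \<phi> (c t)) (at s)) (at s)"
    using smooth_on_has_derivative[OF smooth_into_chart[OF assms(1)[unfolded smooth_curve_iff] assms(2)]]
      assms(3) by auto
  have "frechet_derivative (\<lambda>t. \<phi> (c t)) (at s) h = h *\<^sub>R frechet_derivative (\<lambda>t. \<phi> (c t)) (at s) 1" for h
    by (rule linear_scale[OF has_derivative_linear[OF d], of h 1, unfolded real_scaleR_def mult_1_right])
  then show ?thesis
    unfolding has_vector_derivative_def by (intro has_derivative_eq_rhs[OF d] ext)
qed

lemma smooth_curve_isCont: "smooth_curve A c \<Longrightarrow> isCont c s"
  using smooth_into_continuous[of A UNIV c] continuous_on_eq_continuous_at[of UNIV c]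
  by (simp add: smooth_curve_iff)

lemma smooth_curve_has_real_derivative:
  assumes "smooth_curve A c" "smooth_fun A f"
  shows "((\<lambda>t. f (c t)) has_real_derivative deriv (\<lambda>t. f (c t)) s) (at s)"
proof -
  obtain U \<phi> where U: "(U, \<phi>) \<in> A" "c s \<in> U" using chart_at[OF charts] .
  from curve_derivative[OF assms(2) U smooth_curve_isCont[OF assms(1)]
      smooth_curve_chart_derivative[OF assms(1) U]]
  show ?thesis by (simp add: DERIV_imp_deriv)
qed

lemma velocity_has_derivative:
  assumes "smooth_curve A c" "smooth_fun A f"
  shows "((\<lambda>t. f (c t)) has_real_derivative velocity A c f) (at 0)"
  using smooth_curve_has_real_derivative[OF assms] assms(2) by (simp add: velocity_def o_def)

lemma velocity_eqI:
  assumes "\<And>f. smooth_fun A f \<Longrightarrow> ((\<lambda>t. f (c t)) has_real_derivative D f) (at 0)"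
    "\<And>f. \<not> smooth_fun A f \<Longrightarrow> D f = 0"
  shows "velocity A c = D"
  using assms by (auto simp: velocity_def fun_eq_iff o_def intro: DERIV_imp_deriv)

lemma velocity_coord:
  assumes "smooth_curve A c" "(U, \<phi>) \<in> A" "c 0 \<in> U"
  shows "velocity A c = coord_tangent A U \<phi> (c 0) (frechet_derivative (\<lambda>t. \<phi> (c t)) (at 0) 1)"
  using curve_derivative[OF _ assms(2,3) smooth_curve_isCont[OF assms(1)]
      smooth_curve_chart_derivative[OF assms]]
  by (intro velocity_eqI) (auto simp: coord_tangent_def)

text \<open>The straight line through \<open>\<phi> p\<close> with direction \<open>v\<close> leaves the chart in general, but a curve
  has to be defined on all of the real line. Running back and forth on a short piece of the straight
  line, with the parameter \<open>\<epsilon> sin (t / \<epsilon>)\<close> in place of \<open>t\<close>, does not change the velocity at 0.\<close>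

lemma coord_curve_exists:
  assumes U: "(U, \<phi>) \<in> A" "p \<in> U"
  obtains c where "smooth_curve A c" "c 0 = p" "velocity A c = coord_tangent A U \<phi> p v"
proof -
  note ch = chart_atlasD[OF charts U(1)]
  obtain r where r: "r > 0" "ball (\<phi> p) r \<subseteq> \<phi> ` U"
    using ch(3) U(2) by (meson image_eqI open_contains_ball_eq)
  define \<epsilon> where "\<epsilon> = r / (1 + norm v)"
  have \<epsilon>: "\<epsilon> > 0" using r(1) by (simp add: \<epsilon>_def add_pos_nonneg)
  define x where "x t = \<phi> p + (\<epsilon> * sin (t / \<epsilon>)) *\<^sub>R v" for t
  have x_in: "x t \<in> \<phi> ` U" for t
  proof -
    have "norm ((\<epsilon> * sin (t / \<epsilon>)) *\<^sub>R v) \<le> \<epsilon> * norm v"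
      using \<epsilon> by (simp add: abs_mult mult_right_mono)
    also have "\<dots> < r" using r(1) by (simp add: \<epsilon>_def field_simps add_pos_nonneg)
    finally have "x t \<in> ball (\<phi> p) r" by (simp add: x_def dist_norm)
    then show ?thesis using r(2) by blast
  qed
  have "smooth_on (\<lambda>t. sin (t / \<epsilon>)) UNIV"
    using smooth_on_compose[OF finite_dimensional_real open_UNIV open_UNIV smooth_on_sin
        smooth_on_linear[OF bounded_linear_divide[of \<epsilon>] open_UNIV]] by simp
  then have "smooth_on (\<lambda>t. \<epsilon> *\<^sub>R sin (t / \<epsilon>)) UNIV"
    by (intro smooth_on_scaleR smooth_on_const) auto
  then have sx: "smooth_on x UNIV"
    unfolding x_def by (intro smooth_on_add smooth_on_scaleR smooth_on_const) auto
  define c where "c t = inv_into U \<phi> (x t)" for t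
  have "smooth_into A UNIV c"
    unfolding c_def using x_in
    by (intro smooth_into_precompose[OF fd charts open_UNIV ch(3) smooth_into_chart_inverse[OF U(1)] sx]) auto
  then have c: "smooth_curve A c" by (simp add: smooth_curve_iff)
  have c0: "c 0 = p" using U(2) ch(2) by (simp add: c_def x_def inv_into_f_f)
  have "((\<lambda>t. \<epsilon> * sin (t / \<epsilon>)) has_real_derivative 1) (at 0)"
    using \<epsilon> by (auto intro!: derivative_eq_intros)
  then have "((\<lambda>t. (\<epsilon> * sin (t / \<epsilon>)) *\<^sub>R v) has_vector_derivative (\<epsilon> * sin (0 / \<epsilon>)) *\<^sub>R 0 + 1 *\<^sub>R v) (at 0)"
    by (rule has_vector_derivative_scaleR) (rule has_vector_derivative_const)
  then have "((\<lambda>t. (\<epsilon> * sin (t / \<epsilon>)) *\<^sub>R v) has_vector_derivative v) (at 0)" by simp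
  then have "(x has_vector_derivative v) (at 0)"
    unfolding x_def using has_vector_derivative_add[OF has_vector_derivative_const[of "\<phi> p"]] by force
  moreover have "(\<lambda>t. \<phi> (c t)) = x" using x_in by (auto simp: c_def f_inv_into_f)
  ultimately have "((\<lambda>t. \<phi> (c t)) has_vector_derivative v) (at 0)" by simp
  from curve_derivative[OF _ U(1) _ smooth_curve_isCont[OF c] this] c0 U(2)
  have "velocity A c = coord_tangent A U \<phi> p v"
    by (intro velocity_eqI) (auto simp: coord_tangent_def)
  with c c0 show ?thesis by (rule that)
qed

text \<open>Tangent vectors are functionals on globally defined smooth functions. To see that they form a
  finite-dimensional vector space it suffices that they are the image of the model space under the linear map that
  sends coordinates to functionals.\<close>

lemma tangent_space_chart:
  assumes "(U, \<phi>) \<in> A" "p \<in> U"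
  shows "tangent_space A p = range (coord_tangent A U \<phi> p)"
proof
  show "tangent_space A p \<subseteq> range (coord_tangent A U \<phi> p)"
    using velocity_coord[OF _ assms(1)] assms(2) by (auto simp: tangent_space_def)
  show "range (coord_tangent A U \<phi> p) \<subseteq> tangent_space A p"
  proof safe
    fix v
    obtain c where "smooth_curve A c" "c 0 = p" "velocity A c = coord_tangent A U \<phi> p v"
      using coord_curve_exists[OF assms] .
    then show "coord_tangent A U \<phi> p v \<in> tangent_space A p" unfolding tangent_space_def by force
  qed
qed

lemma linear_coord_tangent:
  assumes "(U, \<phi>) \<in> A" "p \<in> U"
  shows "linear (coord_tangent A U \<phi> p)"
proof -
  have lin: "linear (frechet_derivative (\<lambda>x. f (inv_into U \<phi> x)) (at (\<phi> p)))" if "smooth_fun A f" for f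
    using smooth_on_has_derivative[OF smooth_fun_chart[OF that assms(1)]] assms(2)
      has_derivative_linear by blast
  show ?thesis
    by (rule linearI)
       (auto simp: coord_tangent_def fun_eq_iff plus_fun_def scaleR_fun_def
         linear_add[OF lin] linear_scale[OF lin])
qed

lemma subspace_tangent_space: "subspace (tangent_space A p)"
proof -
  obtain U \<phi> where U: "(U, \<phi>) \<in> A" "p \<in> U" using chart_at[OF charts] .
  show ?thesis unfolding tangent_space_chart[OF U]
    using linear_subspace_image[OF linear_coord_tangent[OF U] subspace_UNIV] .
qed

lemma tangent_space_finite_span: "\<exists>C. finite C \<and> tangent_space A p \<subseteq> span C"
proof -
  obtain U \<phi> where U: "(U, \<phi>) \<in> A" "p \<in> U" using chart_at[OF charts] .
  obtain B :: "'e set" where B: "finite B" "span B = UNIV"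
    using fd unfolding finite_dimensional_def by auto
  have "range (coord_tangent A U \<phi> p) = span (coord_tangent A U \<phi> p ` B)"
    using linear_span_image[OF linear_coord_tangent[OF U], of B] B(2) by simp
  then show ?thesis
    using B(1) tangent_space_chart[OF U] by (intro exI[of _ "coord_tangent A U \<phi> p ` B"]) auto
qed

lemma tangent_not_smooth: "w \<in> tangent_space A p \<Longrightarrow> \<not> smooth_fun A f \<Longrightarrow> w f = 0"
  by (auto simp: tangent_space_def velocity_def)

lemma tangent_add:
  assumes "w \<in> tangent_space A p" "smooth_fun A f" "smooth_fun A g"
  shows "w (\<lambda>q. f q + g q) = w f + w g"
proof -
  obtain c where c: "smooth_curve A c" "w = velocity A c"
    using assms(1) by (auto simp: tangent_space_def)
  show ?thesis
    unfolding c(2)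
    using DERIV_unique[OF velocity_has_derivative[OF c(1) smooth_fun_add[OF assms(2,3)]]
        DERIV_add[OF velocity_has_derivative[OF c(1) assms(2)] velocity_has_derivative[OF c(1) assms(3)]]] .
qed

lemma tangent_scale:
  assumes "w \<in> tangent_space A p" "smooth_fun A f"
  shows "w (\<lambda>q. r * f q) = r * w f"
proof -
  obtain c where c: "smooth_curve A c" "w = velocity A c"
    using assms(1) by (auto simp: tangent_space_def)
  show ?thesis
    unfolding c(2)
    using DERIV_unique[OF velocity_has_derivative[OF c(1) smooth_fun_scale[OF assms(2)]]
        DERIV_cmult[OF velocity_has_derivative[OF c(1) assms(2)]]] .
qed

end

section \<open>Symmetry of second derivatives\<close>

lemma directional_derivative:
  assumes "smooth_on f S" "p + s *\<^sub>R v \<in> S"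
  shows "((\<lambda>h. f (p + h *\<^sub>R v)) has_vector_derivative frechet_derivative f (at (p + s *\<^sub>R v)) v) (at s)"
proof -
  have d: "(f has_derivative frechet_derivative f (at (p + s *\<^sub>R v))) (at (p + s *\<^sub>R v))"
    using assms by (rule smooth_on_has_derivative)
  have "((\<lambda>h. p + h *\<^sub>R v) has_derivative (\<lambda>h. h *\<^sub>R v)) (at s)"
    by (auto intro!: derivative_eq_intros)
  from has_derivative_compose[OF this d] show ?thesis
    unfolding has_vector_derivative_def
    by (rule has_derivative_eq_rhs) (simp add: fun_eq_iff linear_scale[OF has_derivative_linear[OF d]])
qed

lemma directional_derivative_real:
  fixes f :: "'a::real_normed_vector \<Rightarrow> real"
  assumes "smooth_on f S" "p + s *\<^sub>R v \<in> S"
  shows "((\<lambda>h. f (p + h *\<^sub>R v)) has_real_derivative frechet_derivative f (at (p + s *\<^sub>R v)) v) (at s)"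
  using directional_derivative[OF assms] by (simp add: has_real_derivative_iff_has_vector_derivative)

text \<open>On the plane through \<open>p\<close> spanned by \<open>u\<close> and \<open>v\<close>, the function \<open>f\<close> is, up to a boundary
  term, the integral of its derivative in the direction \<open>v\<close>. Differentiation in the direction \<open>u\<close> under the integral sign, and
  then in the direction \<open>v\<close> by the fundamental theorem of calculus, exchanges the two derivatives.\<close>

lemma second_derivative_symmetric:
  fixes f :: "'a::real_normed_vector \<Rightarrow> real"
  assumes f: "smooth_on f UNIV"
  shows "frechet_derivative (\<lambda>z. frechet_derivative f (at z) v) (at p) u =
    frechet_derivative (\<lambda>z. frechet_derivative f (at z) u) (at p) v"
proof -
  define fu where "fu z = frechet_derivative f (at z) u" for z
  define fv where "fv z = frechet_derivative f (at z) v" for z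
  define fvu where "fvu z = frechet_derivative fv (at z) u" for z
  define z where "z s t = p + s *\<^sub>R u + t *\<^sub>R v" for s t :: real
  have sm: "smooth_on fu UNIV" "smooth_on fv UNIV" "smooth_on fvu UNIV"
    unfolding fu_def fvu_def fv_def using f by (simp_all add: smooth_on_directional_derivative)
  have z': "z s t = (p + t *\<^sub>R v) + s *\<^sub>R u" for s t by (simp add: z_def)
  have dt: "((\<lambda>t. f (z s t)) has_real_derivative fv (z s t)) (at t)" for s t
    unfolding z_def fv_def by (rule directional_derivative_real[OF f]) simp
  have ds: "((\<lambda>s. f (z s t)) has_real_derivative fu (z s t)) (at s)" for s t
    unfolding z' fu_def by (rule directional_derivative_real[OF f]) simp
  have dvs: "((\<lambda>s. fv (z s t)) has_real_derivative fvu (z s t)) (at s)" for s t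
    unfolding z' fvu_def by (rule directional_derivative_real[OF sm(2)]) simp
  have cz: "continuous_on S (\<lambda>w. z (a w) (b w))" if "continuous_on S a" "continuous_on S b"
    for a b and S :: "'w::topological_space set"
    unfolding z_def using that by (intro continuous_intros)
  have cfv: "continuous_on S (\<lambda>t. fv (z s t))" for s S
    using continuous_on_compose2[OF smooth_on_continuous[OF sm(2)] cz[of S "\<lambda>_. s" "\<lambda>t. t"]]
    by (auto intro: continuous_intros)
  have cfvu: "continuous_on S (\<lambda>(s, t). fvu (z s t))" for S
    using continuous_on_compose2[OF smooth_on_continuous[OF sm(3)] cz[of S fst snd]]
    by (simp add: case_prod_beta' continuous_on_fst continuous_on_snd continuous_on_id)
  \<comment> \<open>The integral starts at \<open>-1\<close> so that 0 is an interior point, and the derivative at 0 of the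
    integral is a two-sided one.\<close>
  have FTC: "integral {-1..t} (\<lambda>\<tau>. fv (z s \<tau>)) = f (z s t) - f (z s (-1))" if "-1 \<le> t" for s t
    using fundamental_theorem_of_calculus[OF that, of "\<lambda>t. f (z s t)" "\<lambda>t. fv (z s t)"] dt
    by (simp add: has_real_derivative_iff_has_vector_derivative has_vector_derivative_at_within integral_unique)
  have eq: "integral {-1..t} (\<lambda>\<tau>. fvu (z 0 \<tau>)) = fu (z 0 t) - fu (z 0 (-1))" if "-1 \<le> t" for t
  proof (rule DERIV_unique)
    have "((\<lambda>s. integral (cbox (-1) t) (\<lambda>\<tau>. fv (z s \<tau>))) has_real_derivative
        integral (cbox (-1) t) (\<lambda>\<tau>. fvu (z 0 \<tau>))) (at 0 within UNIV)"
      using dvs cfvu by (intro leibniz_rule_field_derivative) (auto intro: integrable_continuous_real cfv)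
    then show "((\<lambda>s. f (z s t) - f (z s (-1))) has_real_derivative integral {-1..t} (\<lambda>\<tau>. fvu (z 0 \<tau>))) (at 0)"
      using FTC[OF that] by simp
    show "((\<lambda>s. f (z s t) - f (z s (-1))) has_real_derivative fu (z 0 t) - fu (z 0 (-1))) (at 0)"
      by (intro DERIV_diff ds)
  qed
  have "continuous_on {-1..1} (\<lambda>\<tau>. fvu (z 0 \<tau>))"
    using continuous_on_compose2[OF smooth_on_continuous[OF sm(3)] cz[of "{-1..1}" "\<lambda>_. 0" "\<lambda>t. t"]]
    by (auto intro: continuous_intros)
  from integral_has_real_derivative[OF this, of 0]
  have "((\<lambda>t. integral {-1..t} (\<lambda>\<tau>. fvu (z 0 \<tau>))) has_real_derivative fvu (z 0 0)) (at 0 within {-1..1})"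
    by simp
  then have "((\<lambda>t. fu (z 0 t) - fu (z 0 (-1))) has_real_derivative fvu (z 0 0)) (at 0 within {-1..1})"
    by (rule has_field_derivative_transform_within[where d = 1]) (auto simp: eq)
  moreover have "at 0 within {-1..1} = at (0::real)"
    by (rule at_within_interior) (simp add: interior_atLeastAtMost_real)
  ultimately have "((\<lambda>t. fu (z 0 t) - fu (z 0 (-1))) has_real_derivative fvu (z 0 0)) (at 0)"
    by simp
  moreover have "((\<lambda>t. fu (z 0 t) - fu (z 0 (-1))) has_real_derivative frechet_derivative fu (at p) v - 0) (at 0)"
    using directional_derivative_real[OF sm(1), of p 0 v]
    by (intro DERIV_diff) (auto simp: z_def)
  ultimately have "fvu (z 0 0) = frechet_derivative fu (at p) v"
    using DERIV_unique by fastforce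
  then show ?thesis by (simp add: fvu_def z_def fu_def[abs_def] fv_def[abs_def])
qed

section \<open>Left-invariant vector fields and conjugation\<close>

locale lie_group_on =
  fixes A :: "('g::{t2_space,second_countable_topology}, 'e::banach) atlas"
    and mul :: "'g \<Rightarrow> 'g \<Rightarrow> 'g" and e :: 'g and invs :: "'g \<Rightarrow> 'g"
  assumes lie_group: "lie_group A mul e invs"
begin

sublocale smooth_manifold A
  using lie_group by (unfold_locales) (simp add: lie_group_def)

sublocale group mul e invs
  using lie_group by (simp add: lie_group_def)

abbreviation \<gg> where "\<gg> \<equiv> lie_algebra A mul"

lemma smooth_into_mul:
  assumes S: "open S" and "smooth_into A S F" "smooth_into A S G"
  shows "smooth_into A S (\<lambda>x. mul (F x) (G x))"
  using smooth_map_smooth_into[OF finite_dimensional_prod[OF fd fd] charts chart_atlas_prod[OF charts charts] _ S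
      smooth_into_Pair[OF charts charts assms], of "\<lambda>(x, y). mul x y"] lie_group
  by (simp add: lie_group_def)

lemma smooth_into_invs:
  assumes "open S" "smooth_into A S F"
  shows "smooth_into A S (\<lambda>x. invs (F x))"
  using smooth_map_smooth_into[OF fd charts charts _ assms] lie_group by (simp add: lie_group_def)

lemma smooth_into_curve:
  assumes "smooth_curve A c" "open S" "smooth_on r S"
  shows "smooth_into A S (\<lambda>x. c (r x))"
  using smooth_into_precompose[OF finite_dimensional_real charts assms(2) open_UNIV _ assms(3)] assms(1)
  by (simp add: smooth_curve_iff)

lemma smooth_fun_translate:
  assumes "smooth_fun A f"
  shows "smooth_fun A (\<lambda>p. f (mul (mul h p) k))"
proof (rule smooth_funI)
  fix U \<phi> assume U: "(U, \<phi>) \<in> A"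
  note o = chart_atlasD(3)[OF charts U]
  show "smooth_on (\<lambda>x. f (mul (mul h (inv_into U \<phi> x)) k)) (\<phi> ` U)"
    by (rule smooth_fun_smooth_on[OF assms o smooth_into_mul[OF o smooth_into_mul[OF o
          smooth_into_const[OF o] smooth_into_chart_inverse[OF U]] smooth_into_const[OF o]]])
qed

lemma smooth_fun_left_translate: "smooth_fun A f \<Longrightarrow> smooth_fun A (\<lambda>p. f (mul h p))"
  using smooth_fun_translate[of f h e] by simp

lemma lie_algebra_tangent: "X \<in> \<gg> \<Longrightarrow> X p \<in> tangent_space A p"
  by (simp add: lie_algebra_def smooth_vector_field_def)

lemma lie_algebra_smooth: "X \<in> \<gg> \<Longrightarrow> smooth_fun A f \<Longrightarrow> smooth_fun A (\<lambda>p. X p f)"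
  by (simp add: lie_algebra_def smooth_vector_field_def)

lemma lie_algebra_not_smooth: "X \<in> \<gg> \<Longrightarrow> \<not> smooth_fun A f \<Longrightarrow> X p f = 0"
  using tangent_not_smooth[OF lie_algebra_tangent] .

lemma lie_algebra_left_translate:
  assumes "X \<in> \<gg>" "smooth_fun A f"
  shows "X (mul h p) f = X p (\<lambda>q. f (mul h q))"
  using assms by (simp add: lie_algebra_def push_forward_def o_def)

text \<open>A left-invariant vector field is determined by its value at \<open>e\<close>; values on functions that are
  not smooth are 0 by convention.\<close>

lemma lie_algebra_eqI:
  assumes X: "X \<in> \<gg>" and Y: "Y \<in> \<gg>" and eq: "\<And>f. smooth_fun A f \<Longrightarrow> X e f = Y e f"
  shows "X = Y"
proof (intro ext)
  fix p f
  show "X p f = Y p f"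
  proof (cases "smooth_fun A f")
    case True
    then show ?thesis
      using lie_algebra_left_translate[OF X True, of p e] lie_algebra_left_translate[OF Y True, of p e]
        eq[OF smooth_fun_left_translate[OF True, of p]] by simp
  next
    case False
    then show ?thesis using X Y by (simp add: lie_algebra_not_smooth)
  qed
qed

lemma lie_algebra_curve_derivative:
  assumes X: "X \<in> \<gg>" and c: "smooth_curve A c" "velocity A c = X e" and f: "smooth_fun A f"
  shows "((\<lambda>t. f (mul p (c t))) has_real_derivative X p f) (at 0)"
  using velocity_has_derivative[OF c(1) smooth_fun_left_translate[OF f, of p]] c(2)
    lie_algebra_left_translate[OF X f, of p e] by simp

lemma lie_algebra_curve_exists:
  assumes "X \<in> \<gg>"
  obtains c where "smooth_curve A c" "velocity A c = X e" "c 0 = e"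
proof -
  have "X e \<in> tangent_space A e" using assms by (rule lie_algebra_tangent)
  then show ?thesis using that by (auto simp: tangent_space_def)
qed

lemma one_parameter_group_zero:
  assumes "one_parameter_group A mul \<gamma>"
  shows "\<gamma> 0 = e"
proof -
  have "mul (\<gamma> 0) (\<gamma> 0) = mul (\<gamma> 0) e"
    using assms unfolding one_parameter_group_def by (metis add_0 right_neutral)
  then show ?thesis by (simp only: left_cancel)
qed

lemma one_parameter_group_minus:
  assumes "one_parameter_group A mul \<gamma>"
  shows "\<gamma> (- t) = invs (\<gamma> t)"
proof -
  have "mul (\<gamma> t) (\<gamma> (- t)) = e"
    using assms one_parameter_group_zero[OF assms] unfolding one_parameter_group_def
    by (metis add.right_inverse)
  then have "mul (\<gamma> t) (\<gamma> (- t)) = mul (\<gamma> t) (invs (\<gamma> t))" by simp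
  then show ?thesis by (simp only: left_cancel)
qed

text \<open>Let \<open>a\<close> be a curve with velocity \<open>Y\<close> and \<open>K (h, r, k) = F (\<gamma> h \<cdot> a r \<cdot> \<gamma> k)\<close>. The derivative in
  question is that of \<open>\<partial>\<^sub>r K\<close> at the origin in the direction \<open>(1, 0, -1)\<close>. A left-invariant field
  differentiates by a curve multiplied from the right, so \<open>\<partial>\<^sub>h \<partial>\<^sub>r K\<close> is \<open>X (Y F)\<close> at \<open>e\<close>, and
  \<open>\<partial>\<^sub>r \<partial>\<^sub>k K\<close> is \<open>Y (X F)\<close> at \<open>e\<close>. Hence the symmetry of second derivatives turns the derivative
  into the bracket.\<close>

lemma conjugation_derivative_at_0:
  assumes X: "X \<in> \<gg>" and Y: "Y \<in> \<gg>" and g: "smooth_curve A \<gamma>" "velocity A \<gamma> = X e" "\<gamma> 0 = e"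
    and F: "smooth_fun A F"
  shows "((\<lambda>h. Y e (\<lambda>p. F (mul (mul (\<gamma> h) p) (\<gamma> (- h))))) has_real_derivative lie_bracket X Y e F) (at 0)"
proof -
  obtain a where a: "smooth_curve A a" "velocity A a = Y e" "a 0 = e"
    using lie_algebra_curve_exists[OF Y] .
  define K :: "real \<times> real \<times> real \<Rightarrow> real"
    where "K z = F (mul (mul (\<gamma> (fst z)) (a (fst (snd z)))) (\<gamma> (snd (snd z))))" for z
  define G where "G z = frechet_derivative K (at z) (0, 1, 0)" for z
  define H where "H z = frechet_derivative K (at z) (0, 0, 1)" for z
  have K: "smooth_on K UNIV"
    unfolding K_def
    by (intro smooth_fun_smooth_on[OF F] smooth_into_mul smooth_into_curve[OF g(1)] smooth_into_curve[OF a(1)]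
        smooth_on_linear open_UNIV bounded_linear_fst bounded_linear_compose[OF bounded_linear_fst]
        bounded_linear_compose[OF bounded_linear_snd] bounded_linear_snd)
  have G: "smooth_on G UNIV" and H: "smooth_on H UNIV"
    unfolding G_def H_def using K by (simp_all add: smooth_on_directional_derivative)
  have G_eq: "G (h, 0, k) = Y e (\<lambda>p. F (mul (mul (\<gamma> h) p) (\<gamma> k)))" for h k
  proof (rule DERIV_unique)
    show "((\<lambda>r. F (mul (mul (\<gamma> h) (a r)) (\<gamma> k))) has_real_derivative G (h, 0, k)) (at 0)"
      using directional_derivative_real[OF K, of "(h, 0, k)" 0 "(0, 1, 0)"] by (simp add: K_def G_def)
    show "((\<lambda>r. F (mul (mul (\<gamma> h) (a r)) (\<gamma> k))) has_real_derivative
        Y e (\<lambda>p. F (mul (mul (\<gamma> h) p) (\<gamma> k)))) (at 0)"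
      using velocity_has_derivative[OF a(1) smooth_fun_translate[OF F, of "\<gamma> h" "\<gamma> k"]] a(2) by simp
  qed
  have H_eq: "H (0, r, 0) = X (a r) F" for r
  proof (rule DERIV_unique)
    show "((\<lambda>k. F (mul (a r) (\<gamma> k))) has_real_derivative H (0, r, 0)) (at 0)"
      using directional_derivative_real[OF K, of "(0, r, 0)" 0 "(0, 0, 1)"] g(3) by (simp add: K_def H_def)
    show "((\<lambda>k. F (mul (a r) (\<gamma> k))) has_real_derivative X (a r) F) (at 0)"
      by (rule lie_algebra_curve_derivative[OF X g(1,2) F])
  qed
  have dG: "linear (frechet_derivative G (at 0))"
    using smooth_on_has_derivative[OF G UNIV_I] by (rule has_derivative_linear)
  have G1: "frechet_derivative G (at 0) (1, 0, 0) = X e (\<lambda>p. Y p F)"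
  proof (rule DERIV_unique)
    show "((\<lambda>h. Y (\<gamma> h) F) has_real_derivative X e (\<lambda>p. Y p F)) (at 0)"
      using velocity_has_derivative[OF g(1) lie_algebra_smooth[OF Y F]] g(2) by simp
    have "G (h, 0, 0) = Y (\<gamma> h) F" for h
      using G_eq[of h 0] lie_algebra_left_translate[OF Y F, of "\<gamma> h" e] g(3) by simp
    then show "((\<lambda>h. Y (\<gamma> h) F) has_real_derivative frechet_derivative G (at 0) (1, 0, 0)) (at 0)"
      using directional_derivative_real[OF G, of 0 0 "(1, 0, 0)"] by (simp add: zero_prod_def)
  qed
  have G2: "frechet_derivative G (at 0) (0, 0, 1) = Y e (\<lambda>p. X p F)"
  proof -
    have "frechet_derivative G (at 0) (0, 0, 1) = frechet_derivative H (at 0) (0, 1, 0)"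
      unfolding G_def H_def by (rule second_derivative_symmetric[OF K])
    also have "\<dots> = Y e (\<lambda>p. X p F)"
    proof (rule DERIV_unique)
      show "((\<lambda>r. X (a r) F) has_real_derivative Y e (\<lambda>p. X p F)) (at 0)"
        using velocity_has_derivative[OF a(1) lie_algebra_smooth[OF X F]] a(2) by simp
      show "((\<lambda>r. X (a r) F) has_real_derivative frechet_derivative H (at 0) (0, 1, 0)) (at 0)"
        using directional_derivative_real[OF H, of 0 0 "(0, 1, 0)"] by (simp add: zero_prod_def H_eq)
    qed
    finally show ?thesis .
  qed
  have "frechet_derivative G (at 0) (1, 0, -1) = lie_bracket X Y e F"
    using linear_diff[OF dG, of "(1, 0, 0)" "(0, 0, 1)"] G1 G2 by (simp add: lie_bracket_def)
  then have "frechet_derivative G (at (0, 0, 0)) (1, 0, -1) = lie_bracket X Y e F"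
    by (simp add: zero_prod_def)
  then show ?thesis
    using directional_derivative_real[OF G, of 0 0 "(1, 0, -1)"] by (simp add: zero_prod_def G_eq)
qed

text \<open>Conjugation by \<open>\<gamma> (s + h)\<close> is conjugation by \<open>\<gamma> h\<close> followed by conjugation by \<open>\<gamma> s\<close>, so the
  derivative at \<open>s\<close> is the derivative at 0 for the conjugated function.\<close>

lemma conjugation_derivative:
  assumes X: "X \<in> \<gg>" and Y: "Y \<in> \<gg>" and g: "one_parameter_group A mul \<gamma>" "velocity A \<gamma> = X e"
    and f: "smooth_fun A f"
  shows "((\<lambda>s. Y e (\<lambda>p. f (mul (mul (\<gamma> s) p) (invs (\<gamma> s))))) has_real_derivative
    lie_bracket X Y e (\<lambda>p. f (mul (mul (\<gamma> s) p) (invs (\<gamma> s))))) (at s)"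
proof -
  have sm: "smooth_curve A \<gamma>" and add: "\<gamma> (s + t) = mul (\<gamma> s) (\<gamma> t)" for s t
    using g(1) by (auto simp: one_parameter_group_def)
  let ?F = "\<lambda>p. f (mul (mul (\<gamma> s) p) (\<gamma> (- s)))"
  have "((\<lambda>h. Y e (\<lambda>p. ?F (mul (mul (\<gamma> h) p) (\<gamma> (- h))))) has_real_derivative lie_bracket X Y e ?F) (at 0)"
    by (rule conjugation_derivative_at_0[OF X Y sm g(2) one_parameter_group_zero[OF g(1)] smooth_fun_translate[OF f]])
  moreover have "\<gamma> (- s - h) = mul (\<gamma> (- h)) (\<gamma> (- s))" for h
    using add[of "- h" "- s"] by (simp add: minus_diff_commute)
  ultimately have "((\<lambda>h. Y e (\<lambda>p. f (mul (mul (\<gamma> (h + s)) p) (\<gamma> (- (h + s)))))) has_real_derivative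
      lie_bracket X Y e ?F) (at 0)"
    by (simp add: add assoc add.commute[of _ s])
  then show ?thesis
    unfolding one_parameter_group_minus[OF g(1), symmetric]
    using DERIV_shift[of "\<lambda>s. Y e (\<lambda>p. f (mul (mul (\<gamma> s) p) (\<gamma> (- s))))" _ 0 s] by simp
qed

lemma conjugation_continuous:
  assumes Y: "Y \<in> \<gg>" and f: "smooth_fun A f"
  shows "continuous_on UNIV (\<lambda>g. Y e (\<lambda>p. f (mul (mul g p) (invs g))))"
proof (rule continuous_if_chartwise)
  fix U \<phi> assume U: "(U, \<phi>) \<in> A"
  note o = chart_atlasD(3)[OF charts U]
  obtain a where a: "smooth_curve A a" "velocity A a = Y e" "a 0 = e"
    using lie_algebra_curve_exists[OF Y] .
  let ?S = "\<phi> ` U \<times> (UNIV::real set)"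
  have S: "open ?S" using o by (simp add: open_Times)
  define K where "K z = f (mul (mul (inv_into U \<phi> (fst z)) (a (snd z))) (invs (inv_into U \<phi> (fst z))))"
    for z :: "'e \<times> real"
  have inv: "smooth_into A ?S (\<lambda>z. inv_into U \<phi> (fst z))"
    by (rule smooth_into_precompose[OF fd charts S o smooth_into_chart_inverse[OF U]
          smooth_on_linear[OF bounded_linear_fst S]]) auto
  have K: "smooth_on K ?S"
    unfolding K_def
    by (intro smooth_fun_smooth_on[OF f] smooth_into_mul smooth_into_invs inv S
        smooth_into_curve[OF a(1)] smooth_on_linear bounded_linear_snd)
  have K_eq: "frechet_derivative K (at (x, 0)) (0, 1) =
      Y e (\<lambda>p. f (mul (mul (inv_into U \<phi> x) p) (invs (inv_into U \<phi> x))))" if "x \<in> \<phi> ` U" for x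
  proof (rule DERIV_unique)
    show "((\<lambda>r. f (mul (mul (inv_into U \<phi> x) (a r)) (invs (inv_into U \<phi> x)))) has_real_derivative
        frechet_derivative K (at (x, 0)) (0, 1)) (at 0)"
      using directional_derivative_real[OF K, of "(x, 0)" 0 "(0, 1)"] that by (simp add: K_def)
    show "((\<lambda>r. f (mul (mul (inv_into U \<phi> x) (a r)) (invs (inv_into U \<phi> x)))) has_real_derivative
        Y e (\<lambda>p. f (mul (mul (inv_into U \<phi> x) p) (invs (inv_into U \<phi> x))))) (at 0)"
      using velocity_has_derivative[OF a(1) smooth_fun_translate[OF f]] a(2) by simp
  qed
  have "continuous_on (\<phi> ` U) (\<lambda>x. frechet_derivative K (at (x, 0)) (0, 1))"
    by (rule continuous_on_compose2[OF smooth_on_continuous[OF smooth_on_directional_derivative[OF K]]])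
       (auto intro: continuous_intros)
  then show "continuous_on (\<phi> ` U) (\<lambda>x. Y e (\<lambda>p. f (mul (mul (inv_into U \<phi> x) p) (invs (inv_into U \<phi> x)))))"
    by (rule continuous_on_eq) (rule K_eq)
qed

end

section \<open>Ordinary differential equations\<close>

lemma smooth_on_locally_lipschitz:
  fixes V :: "'a::real_normed_vector \<Rightarrow> 'b::real_normed_vector"
  assumes fd: "finite_dimensional TYPE('a)" and V: "smooth_on V S" and S: "open S" "x0 \<in> S"
  obtains \<delta> L M where "\<delta> > 0" "L \<ge> 0" "M \<ge> 0" "cball x0 \<delta> \<subseteq> S"
    "\<And>x y. x \<in> cball x0 \<delta> \<Longrightarrow> y \<in> cball x0 \<delta> \<Longrightarrow> norm (V x - V y) \<le> L * norm (x - y)"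
    "\<And>x. x \<in> cball x0 \<delta> \<Longrightarrow> norm (V x) \<le> M"
proof -
  obtain B :: "'a set" and l where B: "finite B"
    and l: "\<And>b. b \<in> B \<Longrightarrow> bounded_linear (l b)" "\<And>v. (\<Sum>b\<in>B. l b v *\<^sub>R b) = v"
    using finite_dimensional_coordinates[OF fd] by blast
  let ?D = "\<lambda>b x. frechet_derivative V (at x) b"
  have near: "\<forall>\<^sub>F x in nhds x0. norm (g x) < norm (g x0) + 1" if "smooth_on g S" for g :: "'a \<Rightarrow> 'b"
  proof -
    have "isCont g x0"
      using smooth_on_continuous[OF that] S continuous_on_eq_continuous_at by blast
    then have "((\<lambda>x. norm (g x)) \<longlongrightarrow> norm (g x0)) (nhds x0)"
      by (intro tendsto_norm) (simp add: continuous_at tendsto_nhds_iff)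
    then show ?thesis by (rule order_tendstoD) simp
  qed
  have "\<forall>\<^sub>F x in nhds x0. (\<forall>b\<in>B. norm (?D b x) < norm (?D b x0) + 1) \<and>
      norm (V x) < norm (V x0) + 1 \<and> x \<in> S"
    using near[OF V] near[OF smooth_on_directional_derivative[OF V]] S B
    by (intro eventually_conj eventually_ball_finite ballI) (auto intro: eventually_nhds_in_open)
  then obtain r where r: "r > 0" "\<And>x. dist x x0 < r \<Longrightarrow>
      (\<forall>b\<in>B. norm (?D b x) < norm (?D b x0) + 1) \<and> norm (V x) < norm (V x0) + 1 \<and> x \<in> S"
    by (auto simp: eventually_nhds_metric)
  define L where "L = (\<Sum>b\<in>B. onorm (l b) * (norm (?D b x0) + 1))"
  have inr: "dist x x0 < r" if "x \<in> cball x0 (r/2)" for x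
    using that r(1) by (simp add: dist_commute)
  show ?thesis
  proof (rule that)
    show "0 < r/2" using r(1) by simp
    show "0 \<le> L" unfolding L_def by (intro sum_nonneg mult_nonneg_nonneg onorm_pos_le l) auto
    show "0 \<le> norm (V x0) + 1" by simp
    show "cball x0 (r/2) \<subseteq> S" using r(2) inr by blast
    show "norm (V x) \<le> norm (V x0) + 1" if "x \<in> cball x0 (r/2)" for x
      using r(2)[OF inr[OF that]] by simp
    fix x y assume xy: "x \<in> cball x0 (r/2)" "y \<in> cball x0 (r/2)"
    show "norm (V x - V y) \<le> L * norm (x - y)"
    proof (rule differentiable_bound[OF convex_cball _ _ xy])
      fix z assume z: "z \<in> cball x0 (r/2)"
      note rz = r(2)[OF inr[OF z]]
      have d: "(V has_derivative frechet_derivative V (at z)) (at z)"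
        using V rz by (intro smooth_on_has_derivative) auto
      then show "(V has_derivative frechet_derivative V (at z)) (at z within cball x0 (r/2))"
        by (rule has_derivative_at_withinI)
      have lin: "linear (frechet_derivative V (at z))" using d by (rule has_derivative_linear)
      show "onorm (frechet_derivative V (at z)) \<le> L"
      proof (rule onorm_bound)
        show "0 \<le> L" unfolding L_def by (intro sum_nonneg mult_nonneg_nonneg onorm_pos_le l) auto
        fix v
        have "frechet_derivative V (at z) v = frechet_derivative V (at z) (\<Sum>b\<in>B. l b v *\<^sub>R b)"
          by (simp only: l(2))
        also have "\<dots> = (\<Sum>b\<in>B. l b v *\<^sub>R ?D b z)"
          by (simp add: linear_sum[OF lin] linear_scale[OF lin])
        also have "norm \<dots> \<le> (\<Sum>b\<in>B. onorm (l b) * norm v * (norm (?D b x0) + 1))"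
        proof (rule sum_norm_le)
          fix b assume b: "b \<in> B"
          have "\<bar>l b v\<bar> \<le> onorm (l b) * norm v" using onorm[OF l(1)[OF b], of v] by simp
          moreover have "norm (?D b z) \<le> norm (?D b x0) + 1" using rz b by (simp add: less_imp_le)
          ultimately show "norm (l b v *\<^sub>R ?D b z) \<le> onorm (l b) * norm v * (norm (?D b x0) + 1)"
            by (simp add: mult_mono')
        qed
        also have "\<dots> = L * norm v"
          unfolding L_def sum_distrib_right by (simp add: mult_ac)
        finally show "norm (frechet_derivative V (at z) v) \<le> L * norm v" .
      qed
    qed
  qed
qed

lemma has_vector_derivative_eventually_eq:
  assumes "(f has_vector_derivative d) (at s)" "\<forall>\<^sub>F t in nhds s. f t = g t"
  shows "(g has_vector_derivative d) (at s)"
proof -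
  have "f s = g s" using assms(2) by (rule eventually_nhds_x_imp_x)
  then show ?thesis
    using assms has_vector_derivative_cong_ev[where S = UNIV and x = s and f = f and g = g] by simp
qed

lemma vector_derivative_bound:
  fixes f :: "real \<Rightarrow> 'a::real_normed_vector"
  assumes "convex S" "\<And>t. t \<in> S \<Longrightarrow> (f has_vector_derivative f' t) (at t within S)"
    "\<And>t. t \<in> S \<Longrightarrow> norm (f' t) \<le> B" "s \<in> S" "t \<in> S"
  shows "norm (f s - f t) \<le> B * \<bar>s - t\<bar>"
proof -
  have "onorm (\<lambda>h. h *\<^sub>R f' t) \<le> B" if "t \<in> S" for t
    using assms(3)[OF that] order_trans[OF norm_ge_zero assms(3)[OF that]]
    by (intro onorm_bound) (simp_all add: mult.commute[of B] mult_left_mono)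
  then show ?thesis
    using differentiable_bound[OF assms(1) _ _ assms(4,5), of f "\<lambda>t h. h *\<^sub>R f' t" B] assms(2)
    by (simp add: has_vector_derivative_def)
qed

text \<open>Picard iteration. The solution is needed on both sides of 0, so the integral from 0 to \<open>t\<close> is
  written as a difference \<open>J\<close> of integrals that start at \<open>- \<epsilon>\<close>. The iteration takes place among
  bounded continuous functions on the line; outside the interval its values are extended by constants.\<close>

lemma ode_exists:
  fixes V :: "'a::banach \<Rightarrow> 'a"
  assumes \<delta>: "\<delta> > 0" and L: "L \<ge> 0" and \<epsilon>: "\<epsilon> > 0" "\<epsilon> * L \<le> 1/2" "\<epsilon> * M \<le> \<delta>"
    and lip: "\<And>x y. x \<in> cball x0 \<delta> \<Longrightarrow> y \<in> cball x0 \<delta> \<Longrightarrow> norm (V x - V y) \<le> L * norm (x - y)"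
    and bound: "\<And>x. x \<in> cball x0 \<delta> \<Longrightarrow> norm (V x) \<le> M"
  obtains x where "x 0 = x0" "\<And>t. t \<in> {-\<epsilon>..\<epsilon>} \<Longrightarrow> x t \<in> cball x0 \<delta>"
    "\<And>t. t \<in> {-\<epsilon>..\<epsilon>} \<Longrightarrow> (x has_vector_derivative V (x t)) (at t within {-\<epsilon>..\<epsilon>})"
proof -
  let ?I = "{-\<epsilon>..\<epsilon>}" and ?C = "cball x0 \<delta>"
  define J where "J g t = integral {-\<epsilon>..t} g - integral {-\<epsilon>..0} g" for g :: "real \<Rightarrow> 'a" and t
  have J_deriv: "(J g has_vector_derivative g t) (at t within ?I)" if "continuous_on ?I g" "t \<in> ?I" for g t
  proof -
    have "(J g has_vector_derivative g t - 0) (at t within ?I)"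
      unfolding J_def[abs_def]
      by (intro has_vector_derivative_diff integral_has_vector_derivative that has_vector_derivative_const)
    then show ?thesis by simp
  qed
  have J0: "J g 0 = 0" for g by (simp add: J_def)
  have J_bound: "norm (J g t) \<le> \<epsilon> * B"
    if "continuous_on ?I g" "\<And>s. s \<in> ?I \<Longrightarrow> norm (g s) \<le> B" "t \<in> ?I" for g t B
  proof -
    have "norm (J g t - J g 0) \<le> B * \<bar>t - 0\<bar>"
      by (rule vector_derivative_bound[OF _ J_deriv[OF that(1)] that(2,3)]) (use \<epsilon> in auto)
    also have "B * \<bar>t - 0\<bar> \<le> B * \<epsilon>"
      using that(3) order_trans[OF norm_ge_zero that(2)[OF that(3)]] by (intro mult_left_mono) auto
    finally show ?thesis by (simp add: J0 mult.commute)
  qed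
  have J_diff: "J g t - J h t = J (\<lambda>s. g s - h s) t"
    if "continuous_on ?I g" "continuous_on ?I h" "t \<in> ?I" for g h t
  proof -
    have "g integrable_on {-\<epsilon>..r}" "h integrable_on {-\<epsilon>..r}" if "r \<in> ?I" for r
      using \<open>continuous_on ?I g\<close> \<open>continuous_on ?I h\<close> that
      by (auto intro!: integrable_continuous_real elim!: continuous_on_subset)
    from this[OF that(3)] this[of 0] \<epsilon>(1) show ?thesis
      by (simp add: J_def integral_diff)
  qed
  define cl where "cl t = max (-\<epsilon>) (min \<epsilon> t)" for t :: real
  have cl: "cl t \<in> ?I" for t using \<epsilon>(1) by (auto simp: cl_def)
  have cl_id: "cl t = t" if "t \<in> ?I" for t using that by (auto simp: cl_def)
  have cont_cl: "continuous_on UNIV cl" unfolding cl_def by (intro continuous_intros)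
  have contV: "continuous_on ?C V"
  proof -
    have "L-lipschitz_on ?C V" using lip L by (intro lipschitz_onI) (auto simp: dist_norm)
    then show ?thesis by (rule lipschitz_on_continuous_on)
  qed
  define K where "K = PiC (UNIV::real set) (\<lambda>_. ?C)"
  have K_iff: "u \<in> K \<longleftrightarrow> (\<forall>t. apply_bcontfun u t \<in> ?C)" for u
    by (simp add: K_def mem_PiC_iff Pi_iff)
  have contVu: "continuous_on T (\<lambda>s. V (apply_bcontfun u s))" if "u \<in> K" for u T
    by (rule continuous_on_compose2[OF contV continuous_on_subset[OF continuous_on_apply_bcontfun[of UNIV u]]])
       (use that K_iff in auto)
  define h where "h u t = x0 + J (\<lambda>s. V (apply_bcontfun u s)) (cl t)" for u t
  define P where "P u = Bcontfun (h u)" for u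
  have h_in: "h u t \<in> ?C" if "u \<in> K" for u t
  proof -
    have "norm (J (\<lambda>s. V (apply_bcontfun u s)) (cl t)) \<le> \<epsilon> * M"
      by (rule J_bound[OF contVu[OF that] _ cl]) (use that K_iff bound in auto)
    also note \<epsilon>(3)
    finally show ?thesis by (simp add: h_def dist_norm)
  qed
  have P_apply: "apply_bcontfun (P u) = h u" if "u \<in> K" for u
  proof -
    have "continuous_on ?I (J (\<lambda>s. V (apply_bcontfun u s)))"
      unfolding continuous_on_eq_continuous_within
      using has_vector_derivative_continuous[OF J_deriv[OF contVu[OF that]]] by blast
    then have "continuous_on UNIV (h u)"
      unfolding h_def[abs_def] using cl
      by (intro continuous_intros continuous_on_compose2[OF _ cont_cl]) auto
    moreover have "bounded (range (h u))"
      using h_in[OF that] by (intro bounded_subset[OF bounded_cball[of x0 \<delta>]]) auto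
    ultimately show ?thesis
      unfolding P_def by (intro Bcontfun_inverse) (simp add: bcontfun_def)
  qed
  have "\<exists>!u. u \<in> K \<and> P u = u"
  proof (rule Banach_fix[where c = "1/2"])
    show "complete K"
      unfolding K_def using closed_PiC[of UNIV "\<lambda>_. ?C"] by (simp add: complete_eq_closed)
    have "Bcontfun (\<lambda>_. x0) \<in> K"
      using \<delta> by (simp add: K_iff Bcontfun_inverse bcontfun_def)
    then show "K \<noteq> {}" by blast
    show "P ` K \<subseteq> K" using h_in P_apply by (auto simp: K_iff)
    fix u v assume u: "u \<in> K" and v: "v \<in> K"
    show "dist (P u) (P v) \<le> 1/2 * dist u v"
    proof (rule dist_bound)
      fix t
      have "dist (apply_bcontfun (P u) t) (apply_bcontfun (P v) t) =
          norm (J (\<lambda>s. V (apply_bcontfun u s) - V (apply_bcontfun v s)) (cl t))"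
        by (simp add: P_apply u v h_def dist_norm J_diff[OF contVu[OF u] contVu[OF v] cl])
      also have "\<dots> \<le> \<epsilon> * (L * dist u v)"
      proof (rule J_bound[OF _ _ cl])
        show "continuous_on ?I (\<lambda>s. V (apply_bcontfun u s) - V (apply_bcontfun v s))"
          by (intro continuous_on_diff contVu u v)
        fix s
        have "norm (V (apply_bcontfun u s) - V (apply_bcontfun v s)) \<le> L * dist (apply_bcontfun u s) (apply_bcontfun v s)"
          using u v K_iff by (simp add: dist_norm lip)
        also have "\<dots> \<le> L * dist u v"
          by (intro mult_left_mono dist_bounded L)
        finally show "norm (V (apply_bcontfun u s) - V (apply_bcontfun v s)) \<le> L * dist u v" .
      qed
      also have "\<dots> \<le> 1/2 * dist u v"
        using mult_right_mono[OF \<epsilon>(2) zero_le_dist[of u v]] by (simp add: mult.assoc)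
      finally show "dist (apply_bcontfun (P u) t) (apply_bcontfun (P v) t) \<le> 1/2 * dist u v" .
    qed
  qed auto
  then obtain u where u: "u \<in> K" "P u = u" by blast
  have fix_eq: "apply_bcontfun u t = x0 + J (\<lambda>s. V (apply_bcontfun u s)) t" if "t \<in> ?I" for t
  proof -
    have "apply_bcontfun u t = h u t" using P_apply[OF u(1)] u(2) by metis
    then show ?thesis by (simp only: h_def cl_id[OF that])
  qed
  show ?thesis
  proof (rule that[of "apply_bcontfun u"])
    show "apply_bcontfun u 0 = x0" using fix_eq[of 0] \<epsilon>(1) J0 by simp
    show "apply_bcontfun u t \<in> ?C" for t using u(1) K_iff by blast
    fix t assume t: "t \<in> ?I"
    have "((\<lambda>t. x0 + J (\<lambda>s. V (apply_bcontfun u s)) t) has_vector_derivative 0 + V (apply_bcontfun u t)) (at t within ?I)"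
      by (rule has_vector_derivative_add[OF has_vector_derivative_const J_deriv[OF contVu[OF u(1)] t]])
    then show "(apply_bcontfun u has_vector_derivative V (apply_bcontfun u t)) (at t within ?I)"
      using has_vector_derivative_transform[OF t fix_eq] by simp
  qed
qed

text \<open>At the point \<open>m\<close> where the distance of two solutions is maximal, the mean value theorem bounds
  this distance by half of itself.\<close>

lemma ode_unique:
  fixes u v :: "real \<Rightarrow> 'a::real_normed_vector"
  assumes lip: "\<And>x y. x \<in> C \<Longrightarrow> y \<in> C \<Longrightarrow> norm (V x - V y) \<le> L * norm (x - y)"
    and L: "L \<ge> 0" "\<epsilon> * L \<le> 1/2"
    and u: "\<And>t. \<bar>t\<bar> < \<epsilon> \<Longrightarrow> (u has_vector_derivative V (u t)) (at t)" "\<And>t. \<bar>t\<bar> < \<epsilon> \<Longrightarrow> u t \<in> C"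
    and v: "\<And>t. \<bar>t\<bar> < \<epsilon> \<Longrightarrow> (v has_vector_derivative V (v t)) (at t)" "\<And>t. \<bar>t\<bar> < \<epsilon> \<Longrightarrow> v t \<in> C"
    and init: "u 0 = v 0" and t: "\<bar>t\<bar> < \<epsilon>"
  shows "u t = v t"
proof -
  let ?S = "{-\<bar>t\<bar>..\<bar>t\<bar>}"
  let ?w = "\<lambda>s. u s - v s"
  have w: "(?w has_vector_derivative V (u s) - V (v s)) (at s within ?S)" if "s \<in> ?S" for s
    using that t by (intro has_vector_derivative_at_within[OF has_vector_derivative_diff] u v) auto
  have "continuous_on ?S ?w"
    unfolding continuous_on_eq_continuous_within using has_vector_derivative_continuous[OF w] by blast
  then have "continuous_on ?S (\<lambda>s. norm (?w s))" by (rule continuous_on_norm)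
  then obtain m where m: "m \<in> ?S" "\<And>s. s \<in> ?S \<Longrightarrow> norm (?w s) \<le> norm (?w m)"
    using continuous_attains_sup[of ?S "\<lambda>s. norm (?w s)"] by fastforce
  have "norm (?w m - ?w 0) \<le> (L * norm (?w m)) * \<bar>m - 0\<bar>"
  proof (rule vector_derivative_bound[OF _ w _ m(1)])
    fix s assume s: "s \<in> ?S"
    have "norm (V (u s) - V (v s)) \<le> L * norm (?w s)"
      using s t by (intro lip u(2) v(2)) auto
    also have "\<dots> \<le> L * norm (?w m)" using m(2)[OF s] L(1) by (rule mult_left_mono)
    finally show "norm (V (u s) - V (v s)) \<le> L * norm (?w m)" .
  qed auto
  also have "\<dots> \<le> (L * norm (?w m)) * \<epsilon>"
    using m(1) t L(1) by (intro mult_left_mono) auto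
  also have "\<dots> \<le> 1/2 * norm (?w m)"
    using mult_right_mono[OF L(2) norm_ge_zero[of "?w m"]] by (simp add: mult_ac)
  finally have "norm (?w m) \<le> 0" using init by simp
  moreover have "norm (?w t) \<le> norm (?w m)" by (rule m(2)) auto
  ultimately show ?thesis by simp
qed

text \<open>A solution gains one derivative from the equation: if it is \<open>C\<close>-\<open>k\<close>, then so is \<open>V (x t)\<close>.\<close>

lemma ode_solution_smooth:
  fixes x :: "real \<Rightarrow> 'a::real_normed_vector"
  assumes fd: "finite_dimensional TYPE('a)" and V: "smooth_on V S" "open S"
    and I: "open I" and x: "\<And>t. t \<in> I \<Longrightarrow> (x has_vector_derivative V (x t)) (at t)" "x ` I \<subseteq> S"
  shows "smooth_on x I"
proof -
  have "Ck_on k x I" for k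
  proof (induction k)
    case 0
    then show ?case using x(1)
      by (auto intro!: continuous_at_imp_continuous_on has_vector_derivative_continuous)
  next
    case (Suc k)
    show ?case
    proof (rule Ck_on_SucI[OF I])
      show "(x has_derivative (\<lambda>h. h *\<^sub>R V (x t))) (at t)" if "t \<in> I" for t
        using x(1)[OF that] by (simp add: has_vector_derivative_def)
      have "Ck_on k (\<lambda>t. V (x t)) I"
        using V(1) by (intro Ck_on_compose[OF fd I V(2) _ Suc x(2)]) (simp add: smooth_on_def)
      then show "Ck_on k (\<lambda>t. h *\<^sub>R V (x t)) I" for h
        by (intro Ck_on_scaleR[OF I] Ck_on_const[OF I])
    qed
  qed
  then show ?thesis by (simp add: smooth_on_def)
qed

section \<open>One-parameter groups\<close>

lemma (in group) funpow_square_commute: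
  assumes "f a b = f b a"
  shows "((\<lambda>g. f g g) ^^ n) (f a b) = f (((\<lambda>g. f g g) ^^ n) a) (((\<lambda>g. f g g) ^^ n) b)"
  using assms
proof (induction n arbitrary: a b)
  case (Suc n)
  have sq: "f (f a b) (f a b) = f (f a a) (f b b)"
    using Suc.prems by (metis assoc)
  have "f (f a a) (f b b) = f (f b b) (f a a)"
    using Suc.prems by (metis assoc)
  from Suc.IH[OF this] sq show ?case by (simp only: funpow_Suc_right o_def)
qed simp

text \<open>The value at \<open>t\<close> of the extension is the \<open>n\<close>-fold iterated square of \<open>\<gamma> (t / 2 ^ n)\<close> for any
  sufficiently large \<open>n\<close>. Values of \<open>\<gamma>\<close> near 0 commute with each other, so that iterated squaring
  respects their products.\<close>

lemma (in group) local_homomorphism_extends: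
  fixes \<gamma> :: "real \<Rightarrow> 'a"
  assumes \<epsilon>: "\<epsilon> > 0" and hom: "\<And>s t. \<bar>s\<bar> < \<epsilon> \<Longrightarrow> \<bar>t\<bar> < \<epsilon> \<Longrightarrow> \<gamma> (s + t) = f (\<gamma> s) (\<gamma> t)"
  obtains \<Gamma> where "\<And>s t. \<Gamma> (s + t) = f (\<Gamma> s) (\<Gamma> t)" "\<And>t. \<bar>t\<bar> < \<epsilon> \<Longrightarrow> \<Gamma> t = \<gamma> t"
proof -
  let ?sq = "\<lambda>g. f g g"
  define D where "D n t = (?sq ^^ n) (\<gamma> (t / 2 ^ n))" for n t
  have small_mono: "\<bar>t / 2 ^ m\<bar> < \<epsilon>" if "\<bar>t / 2 ^ n\<bar> < \<epsilon>" "n \<le> m" for n m and t :: real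
  proof -
    have "\<bar>t\<bar> / 2 ^ m \<le> \<bar>t\<bar> / 2 ^ n"
      using that(2) by (intro divide_left_mono power_increasing) auto
    then show ?thesis using that(1) by simp
  qed
  have D_Suc: "D (Suc n) t = D n t" if "\<bar>t / 2 ^ n\<bar> < \<epsilon>" for n t
  proof -
    have small: "\<bar>t / 2 ^ Suc n\<bar> < \<epsilon>" using small_mono[OF that, of "Suc n"] by simp
    have "t / 2 ^ n = t / 2 ^ Suc n + t / 2 ^ Suc n" by simp
    then have "\<gamma> (t / 2 ^ n) = ?sq (\<gamma> (t / 2 ^ Suc n))" using hom[OF small small] by metis
    then show ?thesis by (simp only: D_def funpow_Suc_right o_def)
  qed
  have D_stable: "D m t = D n t" if "\<bar>t / 2 ^ n\<bar> < \<epsilon>" "n \<le> m" for n m t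
    using that(2)
  proof (induction m rule: dec_induct)
    case (step m)
    then show ?case using D_Suc[OF small_mono[OF that(1)]] by simp
  qed simp
  have ex: "\<exists>n. \<bar>t / 2 ^ n\<bar> < \<epsilon>" for t :: real
  proof -
    obtain n where "\<bar>t\<bar> / \<epsilon> < 2 ^ n" using real_arch_pow[of 2 "\<bar>t\<bar> / \<epsilon>"] by auto
    then show ?thesis using \<epsilon> by (intro exI[of _ n]) (simp add: field_simps)
  qed
  define N where "N t = (SOME n. \<bar>t / 2 ^ n\<bar> < \<epsilon>)" for t :: real
  have N: "\<bar>t / 2 ^ N t\<bar> < \<epsilon>" for t unfolding N_def by (rule someI_ex[OF ex])
  define \<Gamma> where "\<Gamma> t = D (N t) t" for t
  have \<Gamma>_eq: "\<Gamma> t = D n t" if "\<bar>t / 2 ^ n\<bar> < \<epsilon>" for n t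
    using D_stable[OF that, of "max n (N t)"] D_stable[OF N, of t "max n (N t)"] by (simp add: \<Gamma>_def)
  show ?thesis
  proof (rule that)
    show "\<Gamma> t = \<gamma> t" if "\<bar>t\<bar> < \<epsilon>" for t
      using \<Gamma>_eq[of t 0] that by (simp add: D_def)
    fix s t
    define n where "n = max (N s) (max (N t) (N (s + t)))"
    have s: "\<bar>s / 2 ^ n\<bar> < \<epsilon>" and t: "\<bar>t / 2 ^ n\<bar> < \<epsilon>" and st: "\<bar>(s + t) / 2 ^ n\<bar> < \<epsilon>"
      by (rule small_mono[OF N]; simp add: n_def)+
    have comm: "f (\<gamma> (s / 2 ^ n)) (\<gamma> (t / 2 ^ n)) = f (\<gamma> (t / 2 ^ n)) (\<gamma> (s / 2 ^ n))"
      using hom[OF s t] hom[OF t s] by (simp add: add.commute)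
    have "D n (s + t) = f (D n s) (D n t)"
      unfolding D_def add_divide_distrib hom[OF s t] by (rule funpow_square_commute[OF comm])
    then show "\<Gamma> (s + t) = f (\<Gamma> s) (\<Gamma> t)"
      by (simp add: \<Gamma>_eq[OF s] \<Gamma>_eq[OF t] \<Gamma>_eq[OF st])
  qed
qed

context lie_group_on
begin

lemma chart_left_translate_derivative:
  assumes U: "(U, \<phi>) \<in> A" and d: "d s \<in> U" "isCont d s" "((\<lambda>t. \<phi> (d t)) has_vector_derivative v) (at s)"
    and g: "mul g (d s) \<in> U"
  shows "((\<lambda>t. \<phi> (mul g (d t))) has_vector_derivative
    frechet_derivative (\<lambda>x. \<phi> (mul g (inv_into U \<phi> x))) (at (\<phi> (d s))) v) (at s)"
proof -
  note ch = chart_atlasD[OF charts U]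
  let ?L = "\<lambda>x. \<phi> (mul g (inv_into U \<phi> x))"
  have "smooth_into A (\<phi> ` U) (\<lambda>x. mul g (inv_into U \<phi> x))"
    by (intro smooth_into_mul smooth_into_const smooth_into_chart_inverse ch U)
  from smooth_into_chart[OF this U]
  have dL: "(?L has_derivative frechet_derivative ?L (at (\<phi> (d s)))) (at (\<phi> (d s)))"
    by (rule smooth_on_has_derivative) (use d(1) g ch(2) in \<open>auto simp: inv_into_f_f\<close>)
  have "((\<lambda>t. ?L (\<phi> (d t))) has_vector_derivative frechet_derivative ?L (at (\<phi> (d s))) v) (at s)"
    unfolding has_vector_derivative_def
    using has_derivative_compose[OF d(3)[unfolded has_vector_derivative_def] dL]
    by (rule has_derivative_eq_rhs) (simp add: fun_eq_iff linear_scale[OF has_derivative_linear[OF dL]])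
  moreover have "\<forall>\<^sub>F t in nhds s. d t \<in> U"
    using d(1,2) ch(1) by (simp add: eventually_nhds continuous_at_open)
  then have "\<forall>\<^sub>F t in nhds s. ?L (\<phi> (d t)) = \<phi> (mul g (d t))"
    by eventually_elim (use ch(2) in \<open>simp add: inv_into_f_f\<close>)
  ultimately show ?thesis
    by (rule has_vector_derivative_eventually_eq)
qed

text \<open>In the chart, the flow of the left-invariant field with value \<open>X\<close> at \<open>e\<close> is governed by the field
  \<open>V\<close> whose value at \<open>\<phi> p\<close> is the velocity of \<open>\<phi> (p \<cdot> c t)\<close> at \<open>t = 0\<close>, where \<open>c\<close> is any curve with
  velocity \<open>X\<close>. Left translates of solutions are again solutions. Hence \<open>u (s + t)\<close> and \<open>u s \<cdot> u t\<close>
  solve the same equation in \<open>t\<close> with the same initial value, and they agree.\<close>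

lemma local_one_parameter_group:
  assumes X: "X \<in> \<gg>" and U: "(U, \<phi>) \<in> A" "e \<in> U"
  obtains u \<eta> v where "\<eta> > 0" "u 0 = e" "smooth_into A {-\<eta><..<\<eta>} u"
    "\<And>s t. \<bar>s\<bar> < \<eta> \<Longrightarrow> \<bar>t\<bar> < \<eta> \<Longrightarrow> u (s + t) = mul (u s) (u t)"
    "((\<lambda>t. \<phi> (u t)) has_vector_derivative v) (at 0)" "X e = coord_tangent A U \<phi> e v"
proof -
  note ch = chart_atlasD[OF charts U(1)]
  let ?inv = "inv_into U \<phi>"
  obtain c where c: "smooth_curve A c" "velocity A c = X e" "c 0 = e"
    using lie_algebra_curve_exists[OF X] .
  let ?R = "\<lambda>z. mul (?inv (fst z)) (c (snd z))"
  let ?S0 = "\<phi> ` U \<times> (UNIV::real set)"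
  have S0: "open ?S0" using ch(3) by (simp add: open_Times)
  have inv: "smooth_into A ?S0 (\<lambda>z. ?inv (fst z))"
    by (rule smooth_into_precompose[OF fd charts S0 ch(3) smooth_into_chart_inverse[OF U(1)]
          smooth_on_linear[OF bounded_linear_fst S0]]) auto
  have R: "smooth_into A ?S0 ?R"
    by (intro smooth_into_mul S0 inv smooth_into_curve[OF c(1)] smooth_on_linear bounded_linear_snd)
  define S where "S = ?S0 \<inter> ?R -` U"
  have S: "open S"
    unfolding S_def using continuous_open_preimage[OF smooth_into_continuous[OF R] S0 ch(1)] .
  define N where "N z = \<phi> (?R z)" for z
  have N: "smooth_on N S"
    unfolding N_def S_def by (rule smooth_into_chart[OF R U(1)])
  define V where "V x = frechet_derivative N (at (x, 0)) (0, 1)" for x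
  have in_S: "(x, 0) \<in> S" if "x \<in> \<phi> ` U" for x
    using that c(3) ch(2) by (auto simp: S_def inv_into_f_f)
  have V: "smooth_on V (\<phi> ` U)"
    unfolding V_def
    by (rule smooth_on_compose[OF finite_dimensional_prod[OF fd finite_dimensional_real] ch(3) S
          smooth_on_directional_derivative[OF N] smooth_on_Pair[OF ch(3) smooth_on_id[OF ch(3)] smooth_on_const[OF ch(3)]]])
       (use in_S in auto)
  have V_curve: "((\<lambda>\<tau>. \<phi> (mul p (c \<tau>))) has_vector_derivative V (\<phi> p)) (at 0)" if "p \<in> U" for p
    using directional_derivative[OF N, of "(\<phi> p, 0)" 0 "(0, 1)"] in_S that ch(2)
    by (simp add: N_def V_def inv_into_f_f)
  \<comment> \<open>Left translation by \<open>g\<close>, read in the chart, maps \<open>V\<close> to itself: both sides are velocities of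
    the curve \<open>g \<cdot> d s \<cdot> c \<tau>\<close>.\<close>
  have V_left: "((\<lambda>t. \<phi> (mul g (d t))) has_vector_derivative V (\<phi> (mul g (d s)))) (at s)"
    if d: "d s \<in> U" "isCont d s" "((\<lambda>t. \<phi> (d t)) has_vector_derivative V (\<phi> (d s))) (at s)"
      and g: "mul g (d s) \<in> U" for d g s
  proof -
    have "isCont (\<lambda>\<tau>. mul (d s) (c \<tau>)) 0"
      using smooth_into_mul[OF open_UNIV smooth_into_const[OF open_UNIV] c(1)[unfolded smooth_curve_iff], of "d s"]
        smooth_curve_isCont by (simp add: smooth_curve_iff)
    from chart_left_translate_derivative[OF U(1) _ this, of _ g] V_curve[OF d(1)] d(1) g c(3)
    have "((\<lambda>\<tau>. \<phi> (mul (mul g (d s)) (c \<tau>))) has_vector_derivative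
        frechet_derivative (\<lambda>x. \<phi> (mul g (?inv x))) (at (\<phi> (d s))) (V (\<phi> (d s)))) (at 0)"
      by (simp add: assoc)
    then have "frechet_derivative (\<lambda>x. \<phi> (mul g (?inv x))) (at (\<phi> (d s))) (V (\<phi> (d s))) = V (\<phi> (mul g (d s)))"
      using vector_derivative_unique_at[OF _ V_curve[OF g]] by blast
    then show ?thesis
      using chart_left_translate_derivative[OF U(1) d g] by simp
  qed
  obtain \<delta> L M where \<delta>: "\<delta> > 0" and L: "L \<ge> 0" and M: "M \<ge> 0" and sub: "cball (\<phi> e) \<delta> \<subseteq> \<phi> ` U"
    and lip: "\<And>x y. x \<in> cball (\<phi> e) \<delta> \<Longrightarrow> y \<in> cball (\<phi> e) \<delta> \<Longrightarrow> norm (V x - V y) \<le> L * norm (x - y)"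
    and bound: "\<And>x. x \<in> cball (\<phi> e) \<delta> \<Longrightarrow> norm (V x) \<le> M"
    using smooth_on_locally_lipschitz[OF fd V ch(3), of "\<phi> e"] U(2) by blast
  define \<epsilon> where "\<epsilon> = min (1 / (2 * (L + 1))) (\<delta> / (M + 1))"
  have \<epsilon>: "\<epsilon> > 0" using \<delta> L M by (simp add: \<epsilon>_def)
  have "\<epsilon> * L \<le> 1 / (2 * (L + 1)) * L" using L by (intro mult_right_mono) (auto simp: \<epsilon>_def)
  also have "\<dots> \<le> 1/2" using L by (simp add: field_simps)
  finally have \<epsilon>L: "\<epsilon> * L \<le> 1/2" .
  have "\<epsilon> * M \<le> \<delta> / (M + 1) * M" using M by (intro mult_right_mono) (auto simp: \<epsilon>_def)
  also have "\<dots> \<le> \<delta>" using M \<delta> by (simp add: field_simps)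
  finally have \<epsilon>M: "\<epsilon> * M \<le> \<delta>" .
  obtain x where x0: "x 0 = \<phi> e" and x_in: "\<And>t. t \<in> {-\<epsilon>..\<epsilon>} \<Longrightarrow> x t \<in> cball (\<phi> e) \<delta>"
    and x_deriv': "\<And>t. t \<in> {-\<epsilon>..\<epsilon>} \<Longrightarrow> (x has_vector_derivative V (x t)) (at t within {-\<epsilon>..\<epsilon>})"
    using ode_exists[OF \<delta> L \<epsilon> \<epsilon>L \<epsilon>M lip bound] by blast
  have x_deriv: "(x has_vector_derivative V (x t)) (at t)" if "\<bar>t\<bar> < \<epsilon>" for t
  proof -
    have "at t within {-\<epsilon>..\<epsilon>} = at t"
      using that by (intro at_within_interior) (auto simp: interior_atLeastAtMost_real)
    then show ?thesis using x_deriv'[of t] that by (simp add: abs_less_iff)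
  qed
  have x_U: "x t \<in> \<phi> ` U" if "\<bar>t\<bar> < \<epsilon>" for t
    using x_in[of t] that sub by (auto simp: abs_less_iff)
  define u where "u t = ?inv (x t)" for t
  let ?I = "{-\<epsilon><..<\<epsilon>}"
  have I: "t \<in> ?I \<longleftrightarrow> \<bar>t\<bar> < \<epsilon>" for t by auto
  have \<phi>u: "\<phi> (u t) = x t" and u_U: "u t \<in> U" if "\<bar>t\<bar> < \<epsilon>" for t
    using x_U[OF that] by (auto simp: u_def f_inv_into_f inv_into_into)
  have x_smooth: "smooth_on x ?I"
    by (rule ode_solution_smooth[OF fd V ch(3)]) (use x_deriv x_U in auto)
  have u_smooth: "smooth_into A ?I u"
    unfolding u_def
    by (rule smooth_into_precompose[OF fd charts _ ch(3) smooth_into_chart_inverse[OF U(1)] x_smooth])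
       (use x_U in auto)
  have u_cont: "isCont u t" if "\<bar>t\<bar> < \<epsilon>" for t
    using smooth_into_continuous[OF u_smooth] that continuous_on_eq_continuous_at[of ?I u]
    by (auto simp: abs_less_iff)
  have u_deriv: "((\<lambda>t. \<phi> (u t)) has_vector_derivative V (\<phi> (u t))) (at t)" if t: "\<bar>t\<bar> < \<epsilon>" for t
  proof -
    have "\<forall>\<^sub>F s in nhds t. s \<in> ?I" using t by (intro eventually_nhds_in_open) auto
    then have "\<forall>\<^sub>F s in nhds t. x s = \<phi> (u s)" by eventually_elim (use \<phi>u in auto)
    with x_deriv[OF t] show ?thesis
      unfolding \<phi>u[OF t] by (rule has_vector_derivative_eventually_eq)
  qed
  have u0: "u 0 = e" using x0 U(2) ch(2) by (simp add: u_def inv_into_f_f)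
  \<comment> \<open>For the products \<open>u s \<cdot> u t\<close> to stay in the ball on which \<open>V\<close> is Lipschitz, the interval has
    to be shortened.\<close>
  let ?W = "U \<inter> \<phi> -` ball (\<phi> e) \<delta>"
  have W: "open ?W" using continuous_open_preimage[OF ch(4,1) open_ball] .
  have II: "open (?I \<times> ?I)" by (intro open_Times) auto
  have uu: "smooth_into A (?I \<times> ?I) (\<lambda>z. mul (u (fst z)) (u (snd z)))"
    by (intro smooth_into_mul II smooth_into_precompose[OF finite_dimensional_real charts II _ u_smooth]
        smooth_on_linear bounded_linear_fst bounded_linear_snd) auto
  have "open ((?I \<times> ?I) \<inter> (\<lambda>z. mul (u (fst z)) (u (snd z))) -` ?W)"
    using continuous_open_preimage[OF smooth_into_continuous[OF uu] II W] .
  moreover have "(0, 0) \<in> (?I \<times> ?I) \<inter> (\<lambda>z. mul (u (fst z)) (u (snd z))) -` ?W"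
    using \<epsilon> u0 U(2) \<delta> by simp
  ultimately obtain \<rho> where \<rho>: "\<rho> > 0"
    "ball (0, 0) \<rho> \<subseteq> (?I \<times> ?I) \<inter> (\<lambda>z. mul (u (fst z)) (u (snd z))) -` ?W"
    using open_contains_ball by blast
  define \<eta> where "\<eta> = min (\<epsilon>/2) (\<rho>/2)"
  have \<eta>: "\<eta> > 0" "\<eta> < \<epsilon>" using \<epsilon> \<rho>(1) by (auto simp: \<eta>_def)
  have prod_W: "mul (u s) (u t) \<in> ?W" if "\<bar>s\<bar> < \<eta>" "\<bar>t\<bar> < \<eta>" for s t
  proof -
    have "norm (s, t) \<le> \<bar>s\<bar> + \<bar>t\<bar>" using norm_Pair_le[of s t] by simp
    also have "\<dots> < \<rho>" using that by (auto simp: \<eta>_def)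
    finally have "(s, t) \<in> ball (0, 0) \<rho>" by (simp add: dist_norm norm_Pair)
    then show ?thesis using \<rho>(2) by auto
  qed
  have sum_small: "\<bar>s + t\<bar> < \<epsilon>" if "\<bar>s\<bar> < \<eta>" "\<bar>t\<bar> < \<eta>" for s t
    using that by (auto simp: \<eta>_def)
  have hom: "u (s + t) = mul (u s) (u t)" if s: "\<bar>s\<bar> < \<eta>" and t: "\<bar>t\<bar> < \<eta>" for s t
  proof -
    have "x (s + t) = \<phi> (mul (u s) (u t))"
    proof (rule ode_unique[of "cball (\<phi> e) \<delta>" V L \<eta> "\<lambda>t. x (s + t)" "\<lambda>t. \<phi> (mul (u s) (u t))", OF lip L])
      show "\<eta> * L \<le> 1/2" using \<epsilon>L mult_right_mono[of \<eta> \<epsilon> L] L \<eta> by linarith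
      show "x (s + 0) = \<phi> (mul (u s) (u 0))" using \<phi>u[of s] s \<eta> u0 by simp
      show "\<bar>t\<bar> < \<eta>" by (rule t)
    next
      fix t assume t: "\<bar>t\<bar> < \<eta>"
      have "((\<lambda>t. s + t) has_vector_derivative 1) (at t)"
        by (auto intro!: derivative_eq_intros)
      from vector_diff_chain_at[OF this x_deriv[OF sum_small[OF s t]]]
      show "((\<lambda>t. x (s + t)) has_vector_derivative V (x (s + t))) (at t)"
        by (simp add: o_def)
      show "x (s + t) \<in> cball (\<phi> e) \<delta>"
        using sum_small[OF s t] by (intro x_in) auto
      have t': "\<bar>t\<bar> < \<epsilon>" using t \<eta> by simp
      show "((\<lambda>t. \<phi> (mul (u s) (u t))) has_vector_derivative V (\<phi> (mul (u s) (u t)))) (at t)"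
        using prod_W[OF s t] by (intro V_left u_U u_cont u_deriv t') auto
      show "\<phi> (mul (u s) (u t)) \<in> cball (\<phi> e) \<delta>"
        using prod_W[OF s t] by auto
    qed
    then show ?thesis
      using prod_W[OF s t] ch(2) by (simp add: u_def[of "s + t"] inv_into_f_f)
  qed
  have "((\<lambda>t. \<phi> (c t)) has_vector_derivative V (\<phi> e)) (at 0)"
    using V_curve[OF U(2)] by simp
  from curve_derivative[OF _ U(1) _ smooth_curve_isCont[OF c(1)] this] c(3) U(2)
  have "velocity A c = coord_tangent A U \<phi> e (V (\<phi> e))"
    by (intro velocity_eqI) (auto simp: coord_tangent_def)
  then have "X e = coord_tangent A U \<phi> e (V (\<phi> e))" using c(2) by simp
  moreover have "((\<lambda>t. \<phi> (u t)) has_vector_derivative V (\<phi> e)) (at 0)"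
    using u_deriv[of 0] \<epsilon> u0 by simp
  moreover have "smooth_into A {-\<eta><..<\<eta>} u"
    using \<eta> by (intro smooth_into_subset[OF u_smooth]) auto
  ultimately show ?thesis using that \<eta>(1) u0 hom by blast
qed

lemma one_parameter_group_exists:
  assumes X: "X \<in> \<gg>"
  obtains \<gamma> where "one_parameter_group A mul \<gamma>" "velocity A \<gamma> = X e"
proof -
  obtain U \<phi> where U: "(U, \<phi>) \<in> A" "e \<in> U" using chart_at[OF charts] .
  obtain u \<eta> v where \<eta>: "\<eta> > 0" and u0: "u 0 = e" and u: "smooth_into A {-\<eta><..<\<eta>} u"
    and hom: "\<And>s t. \<bar>s\<bar> < \<eta> \<Longrightarrow> \<bar>t\<bar> < \<eta> \<Longrightarrow> u (s + t) = mul (u s) (u t)"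
    and v: "((\<lambda>t. \<phi> (u t)) has_vector_derivative v) (at 0)" "X e = coord_tangent A U \<phi> e v"
    by (rule local_one_parameter_group[OF X U]) blast
  obtain \<Gamma> where \<Gamma>: "\<And>s t. \<Gamma> (s + t) = mul (\<Gamma> s) (\<Gamma> t)" "\<And>t. \<bar>t\<bar> < \<eta> \<Longrightarrow> \<Gamma> t = u t"
    by (rule local_homomorphism_extends[OF \<eta> hom]) blast+
  have "smooth_into A UNIV \<Gamma>"
  proof (rule smooth_into_local[OF _ open_UNIV charts])
    fix t0 :: real
    let ?N = "ball t0 \<eta>"
    have "smooth_into A ?N (\<lambda>t. u (t + (- t0)))"
      by (rule smooth_into_precompose[OF finite_dimensional_real charts open_ball _ u
            smooth_on_add[OF open_ball smooth_on_id[OF open_ball] smooth_on_const[OF open_ball]]])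
         (auto simp: dist_real_def)
    then have "smooth_into A ?N (\<lambda>t. mul (\<Gamma> t0) (u (t + (- t0))))"
      by (intro smooth_into_mul smooth_into_const open_ball)
    moreover have "mul (\<Gamma> t0) (u (t + (- t0))) = \<Gamma> t" if "t \<in> ?N" for t
      using \<Gamma>(1)[of t0 "t - t0"] \<Gamma>(2)[of "t - t0"] that by (simp add: dist_real_def abs_minus_commute)
    ultimately have "smooth_into A ?N \<Gamma>"
      by (rule smooth_into_cong[OF _ _ open_ball charts])
    then show "\<exists>N. open N \<and> t0 \<in> N \<and> smooth_into A (N \<inter> UNIV) \<Gamma>"
      using \<eta> by (intro exI[of _ ?N]) simp
  qed
  then have curve: "smooth_curve A \<Gamma>" by (simp add: smooth_curve_iff)
  have \<Gamma>0: "\<Gamma> 0 = e" using \<Gamma>(2)[of 0] u0 \<eta> by simp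
  have "\<forall>\<^sub>F t in nhds 0. t \<in> {-\<eta><..<\<eta>}" using \<eta> by (intro eventually_nhds_in_open) auto
  then have "\<forall>\<^sub>F t in nhds 0. \<phi> (u t) = \<phi> (\<Gamma> t)" by eventually_elim (simp add: \<Gamma>(2) abs_less_iff)
  with v(1) have "((\<lambda>t. \<phi> (\<Gamma> t)) has_vector_derivative v) (at 0)"
    by (rule has_vector_derivative_eventually_eq)
  from curve_derivative[OF _ U(1) _ smooth_curve_isCont[OF curve] this] \<Gamma>0 U(2)
  have "velocity A \<Gamma> = X e"
    unfolding v(2) by (intro velocity_eqI) (auto simp: coord_tangent_def)
  with \<Gamma>(1) curve show ?thesis by (intro that[of \<Gamma>]) (simp_all add: one_parameter_group_def)
qed


section \<open>The Lie algebra as a finite-dimensional space\<close>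

lemma lie_algebra_smooth_always: "X \<in> \<gg> \<Longrightarrow> smooth_fun A (\<lambda>p. X p f)"
  using lie_algebra_smooth[of X f] lie_algebra_not_smooth[of X f] smooth_fun_const[of 0]
  by (cases "smooth_fun A f") simp_all

lemma tangent_translate:
  assumes "w \<in> tangent_space A p"
  shows "push_forward A (mul h) w \<in> tangent_space A (mul h p)"
proof -
  obtain c where c: "smooth_curve A c" "c 0 = p" "w = velocity A c"
    using assms by (auto simp: tangent_space_def)
  have "smooth_curve A (\<lambda>t. mul h (c t))"
    using c(1) smooth_into_mul[OF open_UNIV smooth_into_const[OF open_UNIV]] by (simp add: smooth_curve_iff)
  moreover have "velocity A (\<lambda>t. mul h (c t)) = push_forward A (mul h) w"
    using velocity_has_derivative[OF c(1) smooth_fun_left_translate]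
    by (intro velocity_eqI) (auto simp: push_forward_def c(3) o_def)
  ultimately show ?thesis unfolding tangent_space_def using c(2) by force
qed

lemma lie_algebraI:
  assumes e: "X e \<in> tangent_space A e"
    and smooth: "\<And>f. smooth_fun A f \<Longrightarrow> smooth_fun A (\<lambda>p. X p f)"
    and left: "\<And>h p f. smooth_fun A f \<Longrightarrow> X (mul h p) f = X p (\<lambda>q. f (mul h q))"
    and zero: "\<And>p f. \<not> smooth_fun A f \<Longrightarrow> X p f = 0"
  shows "X \<in> \<gg>"
proof -
  have inv: "X (mul h p) = push_forward A (mul h) (X p)" for h p
    using left zero by (auto simp: push_forward_def fun_eq_iff o_def)
  have "X p \<in> tangent_space A p" for p
    using tangent_translate[OF e, of p] inv[of p e] by simp
  then show ?thesis
    using inv smooth by (simp add: lie_algebra_def smooth_vector_field_def)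
qed

lemma lie_algebra_subspace: "subspace \<gg>"
proof (rule subspaceI)
  show "0 \<in> \<gg>"
    using subspace_0[OF subspace_tangent_space] smooth_fun_const[of 0]
    by (intro lie_algebraI) (simp_all add: zero_fun_def)
  fix X Y assume X: "X \<in> \<gg>" and Y: "Y \<in> \<gg>"
  show "X + Y \<in> \<gg>"
  proof (rule lie_algebraI)
    show "(X + Y) e \<in> tangent_space A e"
      using subspace_add[OF subspace_tangent_space lie_algebra_tangent[OF X] lie_algebra_tangent[OF Y]]
      by (simp add: plus_fun_def)
  qed (use X Y in \<open>simp_all add: plus_fun_def lie_algebra_smooth smooth_fun_add
      lie_algebra_left_translate lie_algebra_not_smooth\<close>)
next
  fix r X assume X: "X \<in> \<gg>"
  show "r *\<^sub>R X \<in> \<gg>"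
  proof (rule lie_algebraI)
    show "(r *\<^sub>R X) e \<in> tangent_space A e"
      using subspace_scale[OF subspace_tangent_space lie_algebra_tangent[OF X]]
      by (simp add: scaleR_fun_def)
  qed (use X in \<open>simp_all add: scaleR_fun_def lie_algebra_smooth smooth_fun_scale
      lie_algebra_left_translate lie_algebra_not_smooth\<close>)
qed

text \<open>Evaluation at \<open>e\<close> embeds the Lie algebra into the tangent space at \<open>e\<close>.\<close>

lemma lie_algebra_finite_basis: "\<exists>B. finite B \<and> span B = \<gg>"
proof -
  let ?ev = "\<lambda>X::'g vector_field. X e"
  have lin: "linear ?ev" by (rule linearI) (simp_all add: plus_fun_def scaleR_fun_def)
  obtain B where B: "B \<subseteq> \<gg>" "independent B" "\<gg> \<subseteq> span B"
    using maximal_independent_subset by blast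
  have span: "span B = \<gg>" using span_minimal[OF B(1) lie_algebra_subspace] B(3) by blast
  have inj: "inj_on ?ev \<gg>" by (rule inj_onI) (simp add: lie_algebra_eqI)
  obtain C where C: "finite C" "tangent_space A e \<subseteq> span C"
    using tangent_space_finite_span by blast
  have "independent (?ev ` B)"
    using linear_independent_injective_image[OF lin B(2)] inj span by simp
  moreover have "?ev ` B \<subseteq> span C" using B(1) lie_algebra_tangent C(2) by blast
  ultimately have "finite (?ev ` B)" using independent_span_bound[OF C(1)] by blast
  then have "finite B" using inj_on_subset[OF inj B(1)] by (rule finite_imageD)
  with span show ?thesis by blast
qed

text \<open>The bracket at \<open>e\<close> has to be the velocity of a curve, not just a derivation. Let \<open>w t\<close> be the
  coordinates of the image of \<open>Y\<close> under conjugation by \<open>\<gamma> t\<close>, a smooth curve in the model space.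
  By \<open>conjugation_derivative_at_0\<close> the bracket is the tangent vector whose coordinates are the
  derivative of \<open>w\<close> at 0.\<close>

lemma lie_bracket_tangent:
  assumes X: "X \<in> \<gg>" and Y: "Y \<in> \<gg>"
  shows "lie_bracket X Y e \<in> tangent_space A e"
proof -
  obtain U \<phi> where U: "(U, \<phi>) \<in> A" "e \<in> U" using chart_at[OF charts] .
  note ch = chart_atlasD[OF charts U(1)]
  obtain \<gamma> where \<gamma>: "one_parameter_group A mul \<gamma>" "velocity A \<gamma> = X e"
    using one_parameter_group_exists[OF X] .
  obtain a where a: "smooth_curve A a" "velocity A a = Y e" "a 0 = e"
    using lie_algebra_curve_exists[OF Y] .
  have \<gamma>': "smooth_curve A \<gamma>" "\<gamma> 0 = e" "\<And>t. mul (\<gamma> t) (\<gamma> (- t)) = e"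
    using \<gamma>(1) one_parameter_group_zero[OF \<gamma>(1)] one_parameter_group_minus[OF \<gamma>(1)]
    by (simp_all add: one_parameter_group_def)
  define M where "M z = mul (mul (\<gamma> (fst z)) (a (snd z))) (\<gamma> (- fst z))" for z :: "real \<times> real"
  have M: "smooth_into A UNIV M"
    unfolding M_def
    by (intro smooth_into_mul smooth_into_curve[OF \<gamma>'(1)] smooth_into_curve[OF a(1)]
        smooth_on_linear open_UNIV bounded_linear_fst bounded_linear_snd bounded_linear_minus)
  have M0: "M (t, 0) = e" for t using a(3) \<gamma>'(3) by (simp add: M_def)
  define S where "S = UNIV \<inter> M -` U"
  have S: "open S"
    unfolding S_def using continuous_open_preimage[OF smooth_into_continuous[OF M] open_UNIV ch(1)] .
  define N where "N z = \<phi> (M z)" for z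
  have N: "smooth_on N S" unfolding N_def S_def by (rule smooth_into_chart[OF M U(1)])
  define w where "w t = frechet_derivative N (at (t, 0)) (0, 1)" for t :: real
  have in_S: "(t, 0) \<in> S" for t using M0 U(2) by (simp add: S_def)
  have w: "smooth_on w UNIV"
    unfolding w_def
    by (rule smooth_on_compose[OF finite_dimensional_prod[OF finite_dimensional_real finite_dimensional_real] open_UNIV S
          smooth_on_directional_derivative[OF N] smooth_on_Pair[OF open_UNIV smooth_on_id[OF open_UNIV] smooth_on_const[OF open_UNIV]]])
       (use in_S in auto)
  define w' where "w' = frechet_derivative w (at 0) 1"
  have w': "(w has_vector_derivative w') (at 0)"
    using directional_derivative[OF w, of 0 0 1] by (simp add: w'_def)
  have conj: "Y e (\<lambda>p. f (mul (mul (\<gamma> t) p) (\<gamma> (- t)))) = coord_tangent A U \<phi> e (w t) f"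
    if f: "smooth_fun A f" for f t
  proof (rule DERIV_unique)
    have curve: "smooth_curve A (\<lambda>r. M (t, r))"
      unfolding smooth_curve_iff
      by (rule smooth_into_precompose[OF finite_dimensional_prod[OF finite_dimensional_real finite_dimensional_real]
            charts open_UNIV open_UNIV M smooth_on_Pair[OF open_UNIV smooth_on_const[OF open_UNIV] smooth_on_id[OF open_UNIV]]]) auto
    have "((\<lambda>r. \<phi> (M (t, r))) has_vector_derivative w t) (at 0)"
      using directional_derivative[OF N, of "(t, 0)" 0 "(0, 1)"] in_S by (simp add: N_def w_def)
    from curve_derivative[OF f U(1) _ smooth_curve_isCont[OF curve] this]
    show "((\<lambda>r. f (M (t, r))) has_real_derivative coord_tangent A U \<phi> e (w t) f) (at 0)"
      using M0 U(2) by simp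
    show "((\<lambda>r. f (M (t, r))) has_real_derivative Y e (\<lambda>p. f (mul (mul (\<gamma> t) p) (\<gamma> (- t))))) (at 0)"
      using velocity_has_derivative[OF a(1) smooth_fun_translate[OF f]] a(2) by (simp add: M_def)
  qed
  have "lie_bracket X Y e f = coord_tangent A U \<phi> e w' f" for f
  proof (cases "smooth_fun A f")
    case True
    let ?D = "\<lambda>v. coord_tangent A U \<phi> e v f"
    have "bounded_linear ?D"
      using smooth_on_has_derivative[OF smooth_fun_chart[OF True U(1)]] U(2) True
      by (auto simp: coord_tangent_def intro: has_derivative_bounded_linear)
    from bounded_linear.has_vector_derivative[OF this w']
    have "((\<lambda>t. ?D (w t)) has_real_derivative ?D w') (at 0)"
      by (simp add: has_real_derivative_iff_has_vector_derivative)
    then show ?thesis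
      using DERIV_unique[OF conjugation_derivative_at_0[OF X Y \<gamma>'(1) \<gamma>(2) \<gamma>'(2) True]] conj[OF True]
      by simp
  next
    case False
    then show ?thesis
      using tangent_scale[OF lie_algebra_tangent[OF X] smooth_fun_const, of e 0]
        tangent_scale[OF lie_algebra_tangent[OF Y] smooth_fun_const, of e 0]
      by (simp add: lie_bracket_def coord_tangent_def lie_algebra_not_smooth[OF X] lie_algebra_not_smooth[OF Y])
  qed
  then have "lie_bracket X Y e = coord_tangent A U \<phi> e w'" by (rule ext)
  then show ?thesis unfolding tangent_space_chart[OF U] by blast
qed

lemma lie_bracket_closed:
  assumes X: "X \<in> \<gg>" and Y: "Y \<in> \<gg>"
  shows "lie_bracket X Y \<in> \<gg>"
proof (rule lie_algebraI)
  show "lie_bracket X Y e \<in> tangent_space A e" using X Y by (rule lie_bracket_tangent)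
  show "smooth_fun A (\<lambda>p. lie_bracket X Y p f)" if "smooth_fun A f" for f
    unfolding lie_bracket_def
    by (rule smooth_fun_diff[OF lie_algebra_smooth[OF X lie_algebra_smooth[OF Y that]]
          lie_algebra_smooth[OF Y lie_algebra_smooth[OF X that]]])
  show "lie_bracket X Y (mul h p) f = lie_bracket X Y p (\<lambda>q. f (mul h q))" if "smooth_fun A f" for h p f
    by (simp add: lie_bracket_def lie_algebra_left_translate[OF X lie_algebra_smooth[OF Y that]]
        lie_algebra_left_translate[OF Y lie_algebra_smooth[OF X that]]
        lie_algebra_left_translate[OF X that] lie_algebra_left_translate[OF Y that])
  show "lie_bracket X Y p f = 0" if "\<not> smooth_fun A f" for p f
    using tangent_scale[OF lie_algebra_tangent[OF X] smooth_fun_const, of p 0]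
      tangent_scale[OF lie_algebra_tangent[OF Y] smooth_fun_const, of p 0]
    by (simp add: lie_bracket_def lie_algebra_not_smooth[OF X that] lie_algebra_not_smooth[OF Y that])
qed

lemma lie_bracket_add:
  assumes X: "X \<in> \<gg>" and Y: "Y \<in> \<gg>" and Z: "Z \<in> \<gg>"
  shows "lie_bracket X (Y + Z) = lie_bracket X Y + lie_bracket X Z"
  by (intro ext)
     (simp add: lie_bracket_def plus_fun_def
       tangent_add[OF lie_algebra_tangent[OF X] lie_algebra_smooth_always[OF Y] lie_algebra_smooth_always[OF Z]])

lemma lie_bracket_scaleR:
  assumes X: "X \<in> \<gg>" and Y: "Y \<in> \<gg>"
  shows "lie_bracket X (r *\<^sub>R Y) = r *\<^sub>R lie_bracket X Y"
  by (intro ext)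
     (simp add: lie_bracket_def scaleR_fun_def right_diff_distrib
       tangent_scale[OF lie_algebra_tangent[OF X] lie_algebra_smooth_always[OF Y]])

lemma lie_bracket_scaleR_left:
  assumes X: "X \<in> \<gg>" and Y: "Y \<in> \<gg>"
  shows "lie_bracket (r *\<^sub>R X) Y = r *\<^sub>R lie_bracket X Y"
  by (intro ext)
     (simp add: lie_bracket_def scaleR_fun_def right_diff_distrib
       tangent_scale[OF lie_algebra_tangent[OF Y] lie_algebra_smooth_always[OF X]])

section \<open>Boundedness of conjugation on a precompact group\<close>

lemma lie_exp_one_parameter_group:
  assumes X: "X \<in> \<gg>"
  obtains \<gamma> where "one_parameter_group A mul \<gamma>" "velocity A \<gamma> = X e" "lie_exp A mul e X = \<gamma> 1"
proof -
  let ?P = "\<lambda>\<gamma>. one_parameter_group A mul \<gamma> \<and> velocity A \<gamma> = X e"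
  have "\<exists>\<gamma>. ?P \<gamma>" using one_parameter_group_exists[OF X] by blast
  then have "?P (SOME \<gamma>. ?P \<gamma>)" by (rule someI_ex)
  then show ?thesis using that[of "SOME \<gamma>. ?P \<gamma>"] by (simp add: lie_exp_def)
qed

text \<open>The function \<open>\<Phi> t s Y\<close> is the derivative at \<open>e\<close> in the direction \<open>Y\<close> of
  \<open>p \<mapsto> f (\<gamma> p \<gamma>\<inverse>)\<close> with \<open>\<gamma>\<close> the value at \<open>s\<close> of the one-parameter group chosen for \<open>tX\<close>. The
  chosen groups for different \<open>t\<close> are kept apart: \<open>s\<close> is the variable of the differential equation,
  and the bound concerns \<open>s = 1\<close>, where the value of the group is \<open>exp (tX)\<close>.\<close>

lemma precompact_bounded_flow:
  assumes X: "X \<in> \<gg>" and pc: "generates_precompact A mul e X" and f: "smooth_fun A f"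
  obtains \<Phi> :: "real \<Rightarrow> real \<Rightarrow> 'g vector_field \<Rightarrow> real"
  where "\<And>t s. linear (\<Phi> t s)"
    "\<And>t Y. \<Phi> t 0 Y = Y e f"
    "\<And>t s Y. Y \<in> \<gg> \<Longrightarrow> ((\<lambda>s. \<Phi> t s Y) has_real_derivative t * \<Phi> t s (lie_bracket X Y)) (at s)"
    "\<And>Y. Y \<in> \<gg> \<Longrightarrow> \<exists>M. \<forall>t. \<bar>\<Phi> t 1 Y\<bar> \<le> M"
proof -
  have tX: "t *\<^sub>R X \<in> \<gg>" for t using subspace_scale[OF lie_algebra_subspace X] .
  have "\<exists>\<gamma>. one_parameter_group A mul \<gamma> \<and> velocity A \<gamma> = (t *\<^sub>R X) e \<and>
      lie_exp A mul e (t *\<^sub>R X) = \<gamma> 1" for t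
    using lie_exp_one_parameter_group[OF tX] by metis
  then obtain \<gamma> where \<gamma>: "\<And>t. one_parameter_group A mul (\<gamma> t)" "\<And>t. velocity A (\<gamma> t) = (t *\<^sub>R X) e"
    "\<And>t. lie_exp A mul e (t *\<^sub>R X) = \<gamma> t 1"
    by metis
  define C where "C Y g = Y e (\<lambda>p. f (mul (mul g p) (invs g)))" for Y :: "'g vector_field" and g
  show ?thesis
  proof (rule that[of "\<lambda>t s Y. C Y (\<gamma> t s)"])
    show "linear (\<lambda>Y. C Y (\<gamma> t s))" for t s
      by (rule linearI) (simp_all add: C_def plus_fun_def scaleR_fun_def)
    have "invs e = e" by (metis left_neutral right_inverse)
    then show "C Y (\<gamma> t 0) = Y e f" for t Y
      by (simp add: C_def one_parameter_group_zero[OF \<gamma>(1)])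
    fix Y assume Y: "Y \<in> \<gg>"
    show "((\<lambda>s. C Y (\<gamma> t s)) has_real_derivative t * C (lie_bracket X Y) (\<gamma> t s)) (at s)" for t s
      using conjugation_derivative[OF tX Y \<gamma>(1) \<gamma>(2) f, of t s]
      unfolding C_def lie_bracket_scaleR_left[OF X Y] by (simp add: scaleR_fun_def)
    let ?K = "closure (range (\<lambda>t. lie_exp A mul e (t *\<^sub>R X)))"
    have "continuous_on UNIV (C Y)"
      unfolding C_def by (rule conjugation_continuous[OF Y f])
    then have "compact (C Y ` ?K)"
      using pc unfolding generates_precompact_def
      by (intro compact_continuous_image) (auto elim: continuous_on_subset)
    then obtain M where "\<forall>x\<in>C Y ` ?K. norm x \<le> M"
      using compact_imp_bounded bounded_iff by metis
    moreover have "\<gamma> t 1 \<in> ?K" for t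
      using closure_subset \<gamma>(3) by (metis (mono_tags, lifting) rangeI subsetD)
    ultimately show "\<exists>M. \<forall>t. \<bar>C Y (\<gamma> t 1)\<bar> \<le> M" by auto
  qed
qed

end

section \<open>Operators without Jordan chains\<close>

text \<open>The operator is linear only on \<open>V\<close>, because \<open>ad\<^sub>X\<close> is linear only on vector fields that map
  smooth functions to smooth functions.\<close>

locale complexified_operator =
  fixes V :: "'v::real_vector set" and T :: "'v \<Rightarrow> 'v"
  assumes V: "subspace V"
    and fin: "\<exists>B. finite B \<and> span B = V"
    and closed: "\<And>x. x \<in> V \<Longrightarrow> T x \<in> V"
    and add: "\<And>x y. x \<in> V \<Longrightarrow> y \<in> V \<Longrightarrow> T (x + y) = T x + T y"
    and scale: "\<And>r x. x \<in> V \<Longrightarrow> T (r *\<^sub>R x) = r *\<^sub>R T x"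
begin

abbreviation TC where "TC \<equiv> map_prod T T"
abbreviation VC where "VC \<equiv> V \<times> V"

lemma VC_subspace: "cplx.subspace VC"
  using V unfolding cplx.subspace_def
  by (auto simp: zero_prod_def cscale_def subspace_0 intro!: subspace_add subspace_diff subspace_scale)

lemma TC_closed: "w \<in> VC \<Longrightarrow> TC w \<in> VC"
  using closed by auto

lemma TC_add: "w \<in> VC \<Longrightarrow> z \<in> VC \<Longrightarrow> TC (w + z) = TC w + TC z"
  using add by auto

lemma TC_scale:
  assumes "w \<in> VC"
  shows "TC (cscale c w) = cscale c (TC w)"
proof -
  have "T (a *\<^sub>R x - b *\<^sub>R y) = a *\<^sub>R T x - b *\<^sub>R T y" if "x \<in> V" "y \<in> V" for a b x y
    using add[of "a *\<^sub>R x" "(-b) *\<^sub>R y"] scale[of x a] scale[of y "-b"] that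
      subspace_scale[OF V, of x a] subspace_scale[OF V, of y "-b"] by simp
  moreover have "T (a *\<^sub>R x + b *\<^sub>R y) = a *\<^sub>R T x + b *\<^sub>R T y" if "x \<in> V" "y \<in> V" for a b x y
    using add[of "a *\<^sub>R x" "b *\<^sub>R y"] scale that subspace_scale[OF V] by simp
  ultimately show ?thesis using assms by (auto simp: cscale_def)
qed

lemma TC_diff:
  assumes "w \<in> VC" "z \<in> VC"
  shows "TC (w - z) = TC w - TC z"
  using TC_add[OF assms(1), of "cscale (-1) z"] TC_scale[OF assms(2), of "-1"]
    cplx.subspace_scale[OF VC_subspace assms(2), of "-1"] by simp

lemma TC_zero: "TC 0 = 0"
  using TC_scale[OF cplx.subspace_0[OF VC_subspace], of 0] by simp

lemma TC_power_closed: "w \<in> VC \<Longrightarrow> (TC ^^ n) w \<in> VC"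
  by (induction n) (auto intro: TC_closed simp del: mem_Times_iff)

lemma TC_power_diff:
  assumes "w \<in> VC" "z \<in> VC"
  shows "(TC ^^ n) (w - cscale c z) = (TC ^^ n) w - cscale c ((TC ^^ n) z)"
proof (induction n)
  case (Suc n)
  then show ?case
    using TC_diff[OF TC_power_closed[OF assms(1)] cplx.subspace_scale[OF VC_subspace TC_power_closed[OF assms(2)]]]
      TC_scale[OF TC_power_closed[OF assms(2)]] by simp
qed simp

lemma VC_finite_span: "\<exists>F. finite F \<and> VC \<subseteq> cplx.span F"
proof -
  obtain B where B: "finite B" "span B = V" using fin by blast
  let ?F = "(\<lambda>b. (b, 0)) ` B"
  have "(x, 0) \<in> cplx.span ?F" if "x \<in> span B" for x
    using that
  proof (induction rule: span_induct_alt)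
    case base
    then show ?case using cplx.span_zero[of ?F] by (simp add: zero_prod_def)
  next
    case (step c b y)
    have "cscale (of_real c) (b, 0) + (y, 0) \<in> cplx.span ?F"
      using step by (intro cplx.span_add[OF cplx.span_scale[OF cplx.span_base]]) auto
    moreover have "cscale (of_real c) (b, 0) + (y, 0) = (c *\<^sub>R b + y, 0)" by (simp add: cscale_def)
    ultimately show ?case by (simp only:)
  qed
  then have "w \<in> cplx.span ?F" if "w \<in> VC" for w
  proof -
    have "(fst w, 0) + cscale \<i> (snd w, 0) \<in> cplx.span ?F"
      using that B(2) \<open>\<And>x. x \<in> span B \<Longrightarrow> (x, 0) \<in> cplx.span ?F\<close>
      by (intro cplx.span_add cplx.span_scale) auto
    moreover have "(fst w, 0) + cscale \<i> (snd w, 0) = w" by (simp add: cscale_def)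
    ultimately show ?thesis by (simp only:)
  qed
  then show ?thesis using B(1) by (intro exI[of _ ?F]) auto
qed

text \<open>The value at \<open>w\<close> of the polynomial \<open>p\<close> in the complexified operator.\<close>

definition poly_action :: "complex poly \<Rightarrow> 'v \<times> 'v \<Rightarrow> 'v \<times> 'v"
  where "poly_action p w = (\<Sum>i\<le>degree p. cscale (coeff p i) ((TC ^^ i) w))"

lemma poly_action_eq:
  assumes "degree p \<le> n"
  shows "poly_action p w = (\<Sum>i\<le>n. cscale (coeff p i) ((TC ^^ i) w))"
  unfolding poly_action_def using assms
  by (intro sum.mono_neutral_left) (auto simp: coeff_eq_0)

lemma poly_action_linear_factor:
  assumes w: "w \<in> VC"
  shows "poly_action ([:- c, 1:] * q) w = poly_action q (TC w - cscale c w)"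
proof -
  let ?n = "degree q"
  have "degree ([:- c, 1:] * q) \<le> Suc ?n"
    using degree_mult_le[of "[:- c, 1:]" q] by simp
  then have "poly_action ([:- c, 1:] * q) w =
      (\<Sum>i\<le>Suc ?n. cscale (coeff (pCons 0 q) i - c * coeff q i) ((TC ^^ i) w))"
    by (simp add: poly_action_eq)
  also have "\<dots> = (\<Sum>i\<le>Suc ?n. cscale (coeff (pCons 0 q) i) ((TC ^^ i) w)) -
      (\<Sum>i\<le>Suc ?n. cscale (c * coeff q i) ((TC ^^ i) w))"
    by (simp add: cplx.scale_left_diff_distrib sum_subtractf)
  also have "(\<Sum>i\<le>Suc ?n. cscale (coeff (pCons 0 q) i) ((TC ^^ i) w)) =
      (\<Sum>i\<le>?n. cscale (coeff q i) ((TC ^^ i) (TC w)))"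
    by (simp add: sum.atMost_Suc_shift funpow_swap1 del: sum.atMost_Suc)
  also have "(\<Sum>i\<le>Suc ?n. cscale (c * coeff q i) ((TC ^^ i) w)) =
      (\<Sum>i\<le>?n. cscale (coeff q i) (cscale c ((TC ^^ i) w)))"
    by (simp add: coeff_eq_0 mult.commute)
  finally show ?thesis
    unfolding poly_action_def TC_power_diff[OF TC_closed[OF w] w]
    by (simp add: cplx.scale_right_diff_distrib sum_subtractf)
qed

text \<open>The iterates \<open>w, T w, T (T w), \<dots>\<close> are linearly dependent, either because two of them coincide
  or because they are more than the dimension allows.\<close>

lemma annihilating_poly:
  assumes w: "w \<in> VC"
  shows "\<exists>p. p \<noteq> 0 \<and> poly_action p w = 0"
proof -
  obtain F where F: "finite F" "VC \<subseteq> cplx.span F" using VC_finite_span by blast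
  let ?x = "\<lambda>i. (TC ^^ i) w"
  let ?n = "card F"
  have relation: "\<exists>p. p \<noteq> 0 \<and> poly_action p w = 0"
    if a: "(\<Sum>i\<le>?n. cscale (a i) (?x i)) = 0" "j \<le> ?n" "a j \<noteq> 0" for a j
  proof -
    define p where "p = (\<Sum>i\<le>?n. monom (a i) i)"
    have coeff: "coeff p i = (if i \<le> ?n then a i else 0)" for i
      by (simp add: p_def coeff_sum)
    have "degree p \<le> ?n" by (rule degree_le) (simp add: coeff)
    then have "poly_action p w = 0" using a(1) by (simp add: poly_action_eq coeff)
    moreover have "p \<noteq> 0" using coeff[of j] a by auto
    ultimately show ?thesis by blast
  qed
  show ?thesis
  proof (cases "inj_on ?x {..?n}")
    case True
    have "?x ` {..?n} \<subseteq> cplx.span F" using TC_power_closed[OF w] F(2) by blast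
    then have "cplx.dependent (?x ` {..?n})"
      using cplx.independent_span_bound[OF F(1), of "?x ` {..?n}"] card_image[OF True] by auto
    then obtain u v where "v \<in> ?x ` {..?n}" "u v \<noteq> 0" "(\<Sum>y\<in>?x ` {..?n}. cscale (u y) y) = 0"
      using cplx.dependent_finite[of "?x ` {..?n}"] by blast
    then show ?thesis
      using relation[of "\<lambda>i. u (?x i)"] by (auto simp: sum.reindex[OF True] o_def)
  next
    case False
    then obtain i j where ij: "i \<le> ?n" "j \<le> ?n" "?x i = ?x j" "i \<noteq> j" by (auto simp: inj_on_def)
    define a where "a k = (if k = i then 1 else if k = j then -1 else (0::complex))" for k
    have "(\<Sum>k\<le>?n. cscale (a k) (?x k)) = (\<Sum>k\<in>{i, j}. cscale (a k) (?x k))"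
      using ij by (intro sum.mono_neutral_right) (auto simp: a_def)
    also have "\<dots> = 0" using ij by (simp add: a_def)
    finally show ?thesis using relation[of a i] ij(1) by (simp add: a_def)
  qed
qed

text \<open>Every vector \<open>w\<close> is annihilated by a product of linear factors. By induction on their number,
  \<open>(T - c) w\<close> is a sum of eigenvectors for some \<open>c\<close>. Those with an eigenvalue different from \<open>c\<close>
  have a preimage under \<open>T - c\<close> among the multiples of themselves. Subtracting these preimages from
  \<open>w\<close> leaves a vector that \<open>T - c\<close> maps to some \<open>z\<close> with \<open>T z = c z\<close>. As there are no Jordan
  chains, \<open>z = 0\<close>, and \<open>w\<close> is a sum of eigenvectors.\<close>

lemma complex_diagonalizable_if_no_jordan_chain:
  assumes no_chain: "\<And>c w z. w \<in> VC \<Longrightarrow> z \<in> VC \<Longrightarrow> TC w = cscale c w + z \<Longrightarrow> TC z = cscale c z \<Longrightarrow> z = 0"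
  shows "complex_diagonalizable V T"
proof -
  define E where "E = {w \<in> VC. \<exists>c. TC w = cscale c w}"
  have E_VC: "E \<subseteq> VC" by (auto simp: E_def)
  have span_VC: "cplx.span E \<subseteq> VC" by (rule cplx.span_minimal[OF E_VC VC_subspace])
  \<comment> \<open>Up to an eigenvector for \<open>c\<close> itself, every sum of eigenvectors is in the image of \<open>T - c\<close>.\<close>
  have solve: "\<exists>v\<in>cplx.span E. \<exists>z\<in>VC. TC z = cscale c z \<and> u = TC v - cscale c v + z"
    if "u \<in> cplx.span E" for u c
    using that
  proof (induction rule: cplx.span_induct_alt)
    case base
    show ?case
      using cplx.span_zero[of E] cplx.subspace_0[OF VC_subspace] TC_zero
      by (intro bexI[of _ 0]) (auto intro!: bexI[of _ 0] simp del: map_prod_simp)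
  next
    case (step k x y)
    have x: "x \<in> VC" using step(1) E_VC by blast
    obtain v z where v: "v \<in> cplx.span E" and z: "z \<in> VC" "TC z = cscale c z" "y = TC v - cscale c v + z"
      using step(2) by blast
    have vV: "v \<in> VC" using v span_VC by blast
    have "\<exists>v0\<in>cplx.span E. \<exists>z0\<in>VC. TC z0 = cscale c z0 \<and> x = TC v0 - cscale c v0 + z0"
    proof -
      obtain d where d: "TC x = cscale d x" using step(1) by (auto simp: E_def)
      show ?thesis
      proof (cases "d = c")
        case True
        then show ?thesis
          using d x TC_zero cplx.span_zero[of E] by (intro bexI[of _ 0] bexI[of _ x]) auto
      next
        case False
        let ?v = "cscale (1 / (d - c)) x"
        have "TC ?v - cscale c ?v = cscale (1 / (d - c) * d - c * (1 / (d - c))) x"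
          by (simp add: TC_scale[OF x] d cplx.scale_left_diff_distrib)
        also have "1 / (d - c) * d - c * (1 / (d - c)) = (d - c) * (1 / (d - c))"
          by (simp only: left_diff_distrib mult.commute)
        also have "\<dots> = 1" using False by simp
        finally have "x = TC ?v - cscale c ?v + 0" by simp
        then show ?thesis
          using cplx.span_scale[OF cplx.span_base[OF step(1)]] TC_zero cplx.subspace_0[OF VC_subspace]
          by (intro bexI[of _ ?v] bexI[of _ 0]) auto
      qed
    qed
    then obtain v0 z0 where v0: "v0 \<in> cplx.span E" and z0: "z0 \<in> VC" "TC z0 = cscale c z0"
      "x = TC v0 - cscale c v0 + z0" by blast
    have v0V: "v0 \<in> VC" using v0 span_VC by blast
    note sc = cplx.subspace_scale[OF VC_subspace]
    show ?case
    proof (intro bexI conjI)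
      show "cscale k v0 + v \<in> cplx.span E" by (intro cplx.span_add cplx.span_scale v0 v)
      show "cscale k z0 + z \<in> VC" by (intro cplx.subspace_add[OF VC_subspace] sc z0 z)
      show "TC (cscale k z0 + z) = cscale c (cscale k z0 + z)"
        by (simp only: TC_add[OF sc[OF z0(1)] z(1)] TC_scale[OF z0(1)] z0(2) z(2)
            cplx.scale_right_distrib cplx.scale_scale mult.commute)
      have "cscale k x + y = cscale k (TC v0 - cscale c v0 + z0) + (TC v - cscale c v + z)"
        by (subst z0(3), subst z(3)) (rule refl)
      also have "\<dots> = (cscale k (TC v0) + TC v) - cscale c (cscale k v0 + v) + (cscale k z0 + z)"
        by (simp add: cplx.scale_right_distrib cplx.scale_right_diff_distrib mult.commute)
      also have "cscale k (TC v0) + TC v = TC (cscale k v0 + v)"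
        by (simp only: TC_add[OF sc[OF v0V] vV] TC_scale[OF v0V])
      finally show "cscale k x + y = TC (cscale k v0 + v) - cscale c (cscale k v0 + v) + (cscale k z0 + z)" .
    qed
  qed
  have lift: "w \<in> cplx.span E" if w: "w \<in> VC" and u: "TC w - cscale c w \<in> cplx.span E" for w c
  proof -
    obtain v z where v: "v \<in> cplx.span E" and z: "z \<in> VC" "TC z = cscale c z"
      "TC w - cscale c w = TC v - cscale c v + z"
      using solve[OF u, of c] by blast
    have vV: "v \<in> VC" using v span_VC by blast
    have wv: "w - v \<in> VC" by (rule cplx.subspace_diff[OF VC_subspace w vV])
    have eq: "TC (w - v) = cscale c (w - v) + z"
      unfolding TC_diff[OF w vV] cplx.scale_right_diff_distrib using z(3) by (simp add: algebra_simps)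
    have "z = 0" by (rule no_chain[OF wv z(1) eq z(2)])
    with eq wv have "w - v \<in> E" by (auto simp: E_def simp del: mem_Times_iff map_prod_simp)
    then show ?thesis using cplx.span_add[OF cplx.span_base v, of "w - v"] by simp
  qed
  have annihilated: "w \<in> cplx.span E" if "p \<noteq> 0" "w \<in> VC" "poly_action p w = 0" for p w
    using that
  proof (induction "degree p" arbitrary: p w)
    case 0
    then obtain a where a: "p = [:a:]" using degree_eq_zeroE by metis
    with 0 have "w = 0" by (simp add: poly_action_def)
    then show ?case by (simp add: cplx.span_zero)
  next
    case (Suc n)
    have "\<not> constant (poly p)" using Suc.hyps(2) by (simp add: constant_degree)
    then obtain c where "poly p c = 0" using fundamental_theorem_of_algebra by blast
    then obtain q where q: "p = [:- c, 1:] * q" by (auto simp: poly_eq_0_iff_dvd)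
    with Suc.prems have "q \<noteq> 0" by auto
    then have "degree p = Suc (degree q)" 
      unfolding q using degree_mult_eq[of "[:- c, 1:]" q] by (simp del: mult_pCons_left)
    with Suc.hyps have deg: "n = degree q" by simp
    have u: "TC w - cscale c w \<in> VC"
      by (rule cplx.subspace_diff[OF VC_subspace TC_closed[OF Suc.prems(2)]
            cplx.subspace_scale[OF VC_subspace Suc.prems(2)]])
    have "poly_action q (TC w - cscale c w) = 0"
      using Suc.prems(3) poly_action_linear_factor[OF Suc.prems(2), of c q] unfolding q by metis
    then have "TC w - cscale c w \<in> cplx.span E"
      by (rule Suc.hyps(1)[OF deg \<open>q \<noteq> 0\<close> u])
    then show ?case by (rule lift[OF Suc.prems(2)])
  qed
  obtain B where B: "B \<subseteq> E" "cplx.independent B" "E \<subseteq> cplx.span B"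
    using cplx.maximal_independent_subset by blast
  have "VC \<subseteq> cplx.span E" using annihilating_poly annihilated by blast
  also have "\<dots> \<subseteq> cplx.span B" using cplx.span_minimal[OF B(3) cplx.subspace_span] .
  finally have "cplx.span B = VC"
    using cplx.span_minimal[OF _ VC_subspace, of B] B(1) E_VC by blast
  then show ?thesis
    unfolding complex_diagonalizable_def using B(1,2) by (intro exI[of _ B]) (auto simp: E_def)
qed

end

section \<open>The flow along a Jordan chain\<close>

lemma bounded_exp_growth:
  fixes c z :: complex
  assumes "\<And>t::real. norm (exp (t *\<^sub>R c) * z) \<le> M" "z \<noteq> 0"
  shows "Re c = 0"
proof (rule ccontr)
  assume c: "Re c \<noteq> 0"
  \<comment> \<open>At time \<open>N / Re c\<close> the exponential factor is \<open>exp N\<close>, and the bound becomes \<open>exp N \<le> N\<close>.\<close>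
  define N where "N = M / norm z"
  have "exp N \<le> N"
  proof -
    have "norm (exp ((N / Re c) *\<^sub>R c) * z) = exp N * norm z"
      using c by (simp add: norm_mult)
    then show ?thesis using assms(1)[of "N / Re c"] assms(2) by (simp add: N_def field_simps)
  qed
  then show False using exp_ge_add_one_self[of N] by linarith
qed

lemma bounded_linear_growth:
  fixes z w :: complex
  assumes "\<And>t::real. norm (z + t *\<^sub>R w) \<le> M"
  shows "w = 0"
proof (rule ccontr)
  assume w: "w \<noteq> 0"
  define t where "t = (M + norm z + 1) / norm w"
  have "M \<ge> 0" using assms[of 0] norm_ge_zero order_trans by blast
  then have "norm (t *\<^sub>R w) = M + norm z + 1" using w by (simp add: t_def)
  moreover have "norm (t *\<^sub>R w) \<le> norm (z + t *\<^sub>R w) + norm z"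
    using norm_triangle_ineq4[of "z + t *\<^sub>R w" z] by simp
  ultimately show False using assms[of t] by linarith
qed

definition complexify :: "('v \<Rightarrow> real) \<Rightarrow> 'v \<times> 'v \<Rightarrow> complex"
  where "complexify l w = of_real (l (fst w)) + \<i> * of_real (l (snd w))"

lemma complexify_add:
  assumes "linear l"
  shows "complexify l (w + z) = complexify l w + complexify l z"
  by (simp add: complexify_def linear_add[OF assms] algebra_simps)

lemma complexify_cscale:
  assumes "linear l"
  shows "complexify l (cscale c w) = c * complexify l w"
  by (simp add: complexify_def cscale_def linear_add[OF assms] linear_diff[OF assms]
      linear_scale[OF assms] complex_eq_iff)

text \<open>After multiplication by \<open>exp (- s t c)\<close> the flow is constant on \<open>z\<close>, and on \<open>w\<close> it has the
  constant derivative \<open>t z\<close>.\<close>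

lemma jordan_chain_flow:
  fixes \<Phi> :: "real \<Rightarrow> 'v::real_vector \<Rightarrow> real"
  assumes lin: "\<And>s. linear (\<Phi> s)"
    and deriv: "\<And>s Y. Y \<in> V \<Longrightarrow> ((\<lambda>s. \<Phi> s Y) has_real_derivative t * \<Phi> s (T Y)) (at s)"
    and w: "w \<in> V \<times> V" "map_prod T T w = cscale c w + z"
    and z: "z \<in> V \<times> V" "map_prod T T z = cscale c z"
  shows "complexify (\<Phi> 1) w = exp (t *\<^sub>R c) * (complexify (\<Phi> 0) w + t *\<^sub>R complexify (\<Phi> 0) z)"
proof -
  let ?E = "\<lambda>s::real. exp (s *\<^sub>R (- (t *\<^sub>R c)))"
  have E: "(?E has_vector_derivative ?E s * (- (t *\<^sub>R c))) (at s)" for s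
    by (rule exp_scaleR_has_vector_derivative_right)
  have d: "((\<lambda>s. complexify (\<Phi> s) y) has_vector_derivative t *\<^sub>R complexify (\<Phi> s) (map_prod T T y)) (at s)"
    if "y \<in> V \<times> V" for y s
  proof -
    have "((\<lambda>s. complexify (\<Phi> s) y) has_vector_derivative
        of_real (t * \<Phi> s (T (fst y))) + \<i> * of_real (t * \<Phi> s (T (snd y)))) (at s)"
      unfolding complexify_def using that
      by (intro has_vector_derivative_add has_vector_derivative_mult_right has_vector_derivative_of_real
          deriv) (auto simp: mem_Times_iff)
    then show ?thesis by (simp add: complexify_def scaleR_conv_of_real algebra_simps)
  qed
  have prod: "((\<lambda>s. ?E s * complexify (\<Phi> s) y) has_vector_derivative ?E s * (t *\<^sub>R complexify (\<Phi> s) x)) (at s)"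
    if "y \<in> V \<times> V" "map_prod T T y = cscale c y + x" for y x s
  proof -
    have "((\<lambda>s. ?E s * complexify (\<Phi> s) y) has_vector_derivative
        ?E s * (t *\<^sub>R complexify (\<Phi> s) (map_prod T T y)) + ?E s * (- (t *\<^sub>R c)) * complexify (\<Phi> s) y) (at s)"
      by (rule has_vector_derivative_mult[OF E d[OF that(1)]])
    then show ?thesis
      by (simp add: that(2) complexify_add[OF lin] complexify_cscale[OF lin] algebra_simps scaleR_conv_of_real)
  qed
  have const: "f s = f 0" if "\<And>s. (f has_vector_derivative 0) (at s)" for f :: "real \<Rightarrow> complex" and s
    using has_vector_derivative_zero_constant[of UNIV f] that by (metis UNIV_I convex_UNIV)
  have z_const: "?E s * complexify (\<Phi> s) z = complexify (\<Phi> 0) z" for s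
  proof -
    have "complexify (\<Phi> s) 0 = 0" for s
      using complexify_cscale[OF lin, of s 0 0] by simp
    then have "((\<lambda>s. ?E s * complexify (\<Phi> s) z) has_vector_derivative 0) (at s)" for s
      using prod[of z 0 s] z by simp
    from const[OF this, of s] show ?thesis by simp
  qed
  have "((\<lambda>s. ?E s * complexify (\<Phi> s) w - s *\<^sub>R (t *\<^sub>R complexify (\<Phi> 0) z)) has_vector_derivative
      ?E s * (t *\<^sub>R complexify (\<Phi> s) z) - (s *\<^sub>R 0 + 1 *\<^sub>R (t *\<^sub>R complexify (\<Phi> 0) z))) (at s)" for s
    by (intro has_vector_derivative_diff prod w has_vector_derivative_scaleR has_vector_derivative_const DERIV_ident)
  moreover have "?E s * (t *\<^sub>R complexify (\<Phi> s) z) - (s *\<^sub>R 0 + 1 *\<^sub>R (t *\<^sub>R complexify (\<Phi> 0) z)) = 0" for s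
    unfolding mult_scaleR_right z_const by simp
  ultimately have "((\<lambda>s. ?E s * complexify (\<Phi> s) w - s *\<^sub>R (t *\<^sub>R complexify (\<Phi> 0) z)) has_vector_derivative 0) (at s)" for s
    by (simp only:)
  from const[OF this, of 1] have "?E 1 * complexify (\<Phi> 1) w = complexify (\<Phi> 0) w + t *\<^sub>R complexify (\<Phi> 0) z"
    by (simp add: algebra_simps)
  then have "exp (t *\<^sub>R c) * (?E 1 * complexify (\<Phi> 1) w) =
      exp (t *\<^sub>R c) * (complexify (\<Phi> 0) w + t *\<^sub>R complexify (\<Phi> 0) z)" by simp
  moreover have "exp (t *\<^sub>R c) * (?E 1 * y) = y" for y
    by (simp add: exp_minus)
  ultimately show ?thesis by metis
qed

section \<open>The adjoint operator of a precompact one-parameter group\<close>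

context lie_group_on
begin

lemma precompact_jordan_bound:
  assumes X: "X \<in> \<gg>" and pc: "generates_precompact A mul e X" and f: "smooth_fun A f"
    and w: "w \<in> \<gg> \<times> \<gg>" "map_prod (lie_bracket X) (lie_bracket X) w = cscale c w + z"
    and z: "z \<in> \<gg> \<times> \<gg>" "map_prod (lie_bracket X) (lie_bracket X) z = cscale c z"
  obtains M where "\<And>t::real. norm (exp (t *\<^sub>R c) *
    (complexify (\<lambda>Y. Y e f) w + t *\<^sub>R complexify (\<lambda>Y. Y e f) z)) \<le> M"
proof -
  obtain \<Phi> :: "real \<Rightarrow> real \<Rightarrow> 'g vector_field \<Rightarrow> real"
    where lin: "\<And>t s. linear (\<Phi> t s)" and init: "\<And>t Y. \<Phi> t 0 Y = Y e f"
    and deriv: "\<And>t s Y. Y \<in> \<gg> \<Longrightarrow> ((\<lambda>s. \<Phi> t s Y) has_real_derivative t * \<Phi> t s (lie_bracket X Y)) (at s)"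
    and bound: "\<And>Y. Y \<in> \<gg> \<Longrightarrow> \<exists>M. \<forall>t. \<bar>\<Phi> t 1 Y\<bar> \<le> M"
    by (rule precompact_bounded_flow[OF X pc f]) blast
  have wV: "fst w \<in> \<gg>" "snd w \<in> \<gg>" using w(1) by auto
  obtain M1 M2 where M: "\<And>t. \<bar>\<Phi> t 1 (fst w)\<bar> \<le> M1" "\<And>t. \<bar>\<Phi> t 1 (snd w)\<bar> \<le> M2"
    using bound[OF wV(1)] bound[OF wV(2)] by blast
  have \<Phi>0: "\<Phi> t 0 = (\<lambda>Y. Y e f)" for t using init by (rule ext)
  have "norm (exp (t *\<^sub>R c) * (complexify (\<lambda>Y. Y e f) w + t *\<^sub>R complexify (\<lambda>Y. Y e f) z)) \<le> M1 + M2" for t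
  proof -
    have eq: "exp (t *\<^sub>R c) * (complexify (\<lambda>Y. Y e f) w + t *\<^sub>R complexify (\<lambda>Y. Y e f) z) = complexify (\<Phi> t 1) w"
      using jordan_chain_flow[of "\<Phi> t" \<gg> t "lie_bracket X" w c z, OF lin deriv w z] by (simp add: \<Phi>0)
    have "norm (complexify (\<Phi> t 1) w) \<le> \<bar>\<Phi> t 1 (fst w)\<bar> + \<bar>\<Phi> t 1 (snd w)\<bar>"
      unfolding complexify_def by (rule order_trans[OF norm_triangle_ineq]) (simp add: norm_mult)
    then show ?thesis unfolding eq using M[of t] by linarith
  qed
  then show ?thesis using that by blast
qed

text \<open>Testing against a single smooth function may lose a vector, but no vector is lost by all of
  them.\<close>

lemma nonzero_detected:
  assumes "w \<in> \<gg> \<times> \<gg>" "w \<noteq> 0"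
  obtains f where "smooth_fun A f" "complexify (\<lambda>Y. Y e f) w \<noteq> 0"
proof -
  have detect: "\<exists>f. smooth_fun A f \<and> Y e f \<noteq> 0" if "Y \<in> \<gg>" "Y \<noteq> 0" for Y
  proof (rule ccontr)
    assume "\<not> ?thesis"
    then have "Y = 0"
      by (intro lie_algebra_eqI[OF that(1) subspace_0[OF lie_algebra_subspace]]) auto
    with that(2) show False ..
  qed
  have w: "fst w \<in> \<gg>" "snd w \<in> \<gg>" "fst w \<noteq> 0 \<or> snd w \<noteq> 0"
    using assms by (auto simp: prod_eq_iff)
  then obtain f where "smooth_fun A f" "fst w e f \<noteq> 0 \<or> snd w e f \<noteq> 0"
    using detect by metis
  then show ?thesis using that by (auto simp: complexify_def complex_eq_iff)
qed

lemma precompact_eigenvalue: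
  assumes X: "X \<in> \<gg>" and pc: "generates_precompact A mul e X"
    and w: "w \<in> \<gg> \<times> \<gg>" "w \<noteq> 0" "map_prod (lie_bracket X) (lie_bracket X) w = cscale c w"
  shows "Re c = 0"
proof -
  obtain f where f: "smooth_fun A f" "complexify (\<lambda>Y. Y e f) w \<noteq> 0"
    using nonzero_detected[OF w(1,2)] .
  have zero: "0 \<in> \<gg> \<times> \<gg>" "map_prod (lie_bracket X) (lie_bracket X) 0 = cscale c 0"
    using subspace_0[OF lie_algebra_subspace] lie_bracket_scaleR[OF X subspace_0[OF lie_algebra_subspace], of 0]
    by (auto simp: zero_prod_def cscale_def)
  have w0: "map_prod (lie_bracket X) (lie_bracket X) w = cscale c w + 0" using w(3) by simp
  obtain M where "\<And>t::real. norm (exp (t *\<^sub>R c) *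
    (complexify (\<lambda>Y. Y e f) w + t *\<^sub>R complexify (\<lambda>Y. Y e f) 0)) \<le> M"
    by (rule precompact_jordan_bound[OF X pc f(1) w(1) w0 zero]) blast
  moreover have "complexify (\<lambda>Y::'g vector_field. Y e f) 0 = 0"
    by (simp add: complexify_def zero_fun_def)
  ultimately show ?thesis using bounded_exp_growth[OF _ f(2), of c M] by simp
qed

lemma precompact_no_jordan_chain:
  assumes X: "X \<in> \<gg>" and pc: "generates_precompact A mul e X"
    and w: "w \<in> \<gg> \<times> \<gg>" "map_prod (lie_bracket X) (lie_bracket X) w = cscale c w + z"
    and z: "z \<in> \<gg> \<times> \<gg>" "map_prod (lie_bracket X) (lie_bracket X) z = cscale c z"
  shows "z = 0"
proof (rule ccontr)
  assume nz: "z \<noteq> 0"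
  have c: "Re c = 0" by (rule precompact_eigenvalue[OF X pc z(1) nz z(2)])
  obtain f where f: "smooth_fun A f" "complexify (\<lambda>Y. Y e f) z \<noteq> 0"
    using nonzero_detected[OF z(1) nz] .
  obtain M where "\<And>t::real. norm (exp (t *\<^sub>R c) *
    (complexify (\<lambda>Y. Y e f) w + t *\<^sub>R complexify (\<lambda>Y. Y e f) z)) \<le> M"
    by (rule precompact_jordan_bound[OF X pc f(1) w z]) blast
  then have "norm (complexify (\<lambda>Y. Y e f) w + t *\<^sub>R complexify (\<lambda>Y. Y e f) z) \<le> M" for t :: real
    using c by (simp add: norm_mult)
  then show False using bounded_linear_growth f(2) by blast
qed

end

theorem lemma3p3:
  fixes A :: "('g::{t2_space,second_countable_topology}, 'e::banach) atlas"
    and mul :: "'g \<Rightarrow> 'g \<Rightarrow> 'g" and e :: 'g and invs :: "'g \<Rightarrow> 'g"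
    and \<gg> :: "'g vector_field set" and X :: "'g vector_field"
  assumes "lie_group A mul e invs"
    and "\<gg> = lie_algebra A mul"
    and "X \<in> \<gg>"
    and "generates_precompact A mul e X"
  shows "((\<forall>Y\<in>\<gg>. lie_bracket X Y = 0) \<or> \<not> nilpotent_on \<gg> (lie_bracket X)) \<and>
    \<not> (\<exists>Y\<in>\<gg>. Y \<noteq> 0 \<and> (\<exists>r::real. r \<noteq> 0 \<and> lie_bracket X Y = r *\<^sub>R Y)) \<and>
    \<not> (\<exists>Y\<in>\<gg>. lie_bracket X Y \<noteq> 0 \<and> (\<exists>k>0. (lie_bracket X ^^ k) Y = 0)) \<and>
    (\<forall>\<ll> \<mm>. lie_direct_sum lie_bracket \<gg> \<ll> \<mm> \<and> semisimple_lie lie_bracket \<ll> \<and> X \<in> \<ll> \<longrightarrow>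
      complex_diagonalizable \<gg> (lie_bracket X) \<and>
      (\<forall>c. complex_eigenvalue \<gg> (lie_bracket X) c \<longrightarrow> Re c = 0))"
proof -
  interpret lie_group_on A mul e invs by unfold_locales (rule assms(1))
  let ?ad = "lie_bracket X"
  have X: "X \<in> lie_algebra A mul" using assms(2,3) by simp
  note pc = assms(4)
  note zero_in = subspace_0[OF lie_algebra_subspace]
  have ad_zero: "?ad 0 = 0" using lie_bracket_scaleR[OF X zero_in, of 0] by simp
  have ad_closed: "?ad Y \<in> \<gg>" if "Y \<in> \<gg>" for Y
    using lie_bracket_closed[OF X] that assms(2) by simp
  \<comment> \<open>A vector \<open>Y\<close> with \<open>ad (ad Y) = 0\<close> is the beginning of a Jordan chain with eigenvalue 0.\<close>
  have no_square: "?ad Y = 0" if Y: "Y \<in> \<gg>" and sq: "?ad (?ad Y) = 0" for Y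
  proof -
    have "(?ad Y, 0) = (0 :: 'g vector_field \<times> 'g vector_field)"
    proof (rule precompact_no_jordan_chain[OF X pc, of "(Y, 0)" 0])
      show "map_prod ?ad ?ad (Y, 0) = cscale 0 (Y, 0) + (?ad Y, 0)"
        by (simp add: ad_zero cscale_def)
      show "map_prod ?ad ?ad (?ad Y, 0) = cscale 0 (?ad Y, 0)"
        by (simp add: ad_zero sq cscale_def)
    qed (use Y ad_closed zero_in assms(2) in auto)
    then show ?thesis by (simp add: zero_prod_def)
  qed
  have power_closed: "(?ad ^^ k) Y \<in> \<gg>" if "Y \<in> \<gg>" for k Y
    using that ad_closed by (induction k) auto
  have no_power: "?ad Y = 0" if Y: "Y \<in> \<gg>" and "(?ad ^^ Suc k) Y = 0" for k Y
    using that(2)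
  proof (induction k)
    case (Suc k)
    have "?ad (?ad ((?ad ^^ k) Y)) = 0" using Suc.prems unfolding funpow.simps o_apply .
    from no_square[OF power_closed[OF Y] this]
    have "(?ad ^^ Suc k) Y = 0" unfolding funpow.simps o_apply .
    then show ?case by (rule Suc.IH)
  qed simp
  have 1: "\<not> (\<exists>Y\<in>\<gg>. ?ad Y \<noteq> 0 \<and> (\<exists>k>0. (?ad ^^ k) Y = 0))"
    using no_power by (metis gr0_implies_Suc)
  have 2: "(\<forall>Y\<in>\<gg>. ?ad Y = 0) \<or> \<not> nilpotent_on \<gg> ?ad"
  proof (rule disjCI)
    assume "\<not> \<not> nilpotent_on \<gg> ?ad"
    then obtain k where k: "\<And>Y. Y \<in> \<gg> \<Longrightarrow> (?ad ^^ k) Y = 0" unfolding nilpotent_on_def by blast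
    have "(?ad ^^ Suc k) Y = 0" if "Y \<in> \<gg>" for Y using k[OF that] ad_zero by simp
    then show "\<forall>Y\<in>\<gg>. ?ad Y = 0" using no_power by blast
  qed
  have 3: "\<not> (\<exists>Y\<in>\<gg>. Y \<noteq> 0 \<and> (\<exists>r::real. r \<noteq> 0 \<and> ?ad Y = r *\<^sub>R Y))"
  proof
    assume "\<exists>Y\<in>\<gg>. Y \<noteq> 0 \<and> (\<exists>r::real. r \<noteq> 0 \<and> ?ad Y = r *\<^sub>R Y)"
    then obtain Y and r :: real where Y: "Y \<in> \<gg>" "Y \<noteq> 0" "r \<noteq> 0" "?ad Y = r *\<^sub>R Y" by blast
    have "Re (of_real r) = 0"
    proof (rule precompact_eigenvalue[OF X pc, of "(Y, 0)"])
      show "map_prod ?ad ?ad (Y, 0) = cscale (of_real r) (Y, 0)"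
        by (simp add: ad_zero cscale_def Y(4))
    qed (use Y zero_in assms(2) in \<open>auto simp: zero_prod_def\<close>)
    with Y(3) show False by simp
  qed
  have 4: "Re c = 0" if "complex_eigenvalue \<gg> ?ad c" for c
    using that precompact_eigenvalue[OF X pc] unfolding complex_eigenvalue_def assms(2) by blast
  have 5: "complex_diagonalizable \<gg> ?ad"
  proof -
    interpret ad: complexified_operator \<gg> ?ad
      by unfold_locales
         (use X lie_algebra_subspace lie_algebra_finite_basis lie_bracket_closed lie_bracket_add
           lie_bracket_scaleR assms(2) in auto)
    show ?thesis
      using precompact_no_jordan_chain[OF X pc] unfolding assms(2)[symmetric]
      by (rule ad.complex_diagonalizable_if_no_jordan_chain)
  qed
  from 1 2 3 4 5 show ?thesis by blast
qed

end
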